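(* $\mathcal{M}(\partial\Delta^3)\simeq\bigvee^{21}S^3\vee\bigvee^{24}S^4$.
   Context: All simplicial complexes are finite abstract simplicial complexes; simplices are nonempty. $\partial\Delta^3$ is the simplicial complex of all proper nonempty subsets of a $4$-element vertex set (the boundary of the tetrahedron). The Hasse diagram $\mathcal{H}(K)$ of $K$ is the directed graph whose vertices are the simplices of $K$, with an edge $\sigma\to\tau$ whenever $\sigma\subsetneq\tau$ and $\dim\tau=\dim\sigma+1$. A matching on $\mathcal{H}(K)$ is a set $W$ of edges of $\mathcal{H}(K)$, no two sharing a vertex. $W$ is acyclic if the directed graph obtained from $\mathcal{H}(K)$ by reversing every edge in $W$ has no directed cycle. The complex of discrete Morse matchings $\mathcal{M}(K)$ is the simplicial complex whose vertices are the edges of $\mathcal{H}(K)$ and whose simplices are the nonempty acyclic matchings on $\mathcal{H}(K)$. *)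

theory Defs
  imports "HOL-Analysis.Analysis"
begin

text \<open>A finite abstract simplicial complex is represented as a set of (nonempty, finite)
  vertex sets. Its geometric realization is the set of functions vertex -> real that are
  nonnegative, have support equal to a simplex, and sum to 1 over that support, with the
  subspace topology of the product topology (for a finite vertex set this is the usual
  Euclidean topology).\<close>

definition geometric_realization :: "'v set set \<Rightarrow> ('v \<Rightarrow> real) topology" where
  "geometric_realization L =
     subtopology (powertop_real UNIV)
       {f. (\<forall>v. 0 \<le> f v) \<and> {v. f v \<noteq> 0} \<in> L \<and> sum f {v. f v \<noteq> 0} = 1}"

definition boundary_tetrahedron :: "nat set set" where
  "boundary_tetrahedron = {s. s \<noteq> {} \<and> s \<subset> {0,1,2,3}}"

definition hasse_edges :: "'a set set \<Rightarrow> ('a set \<times> 'a set) set" where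
  "hasse_edges K = {(\<sigma>, \<tau>). \<sigma> \<in> K \<and> \<tau> \<in> K \<and> \<sigma> \<subset> \<tau> \<and> card \<tau> = Suc (card \<sigma>)}"

definition is_matching :: "'a set set \<Rightarrow> ('a set \<times> 'a set) set \<Rightarrow> bool" where
  "is_matching K W \<longleftrightarrow> W \<subseteq> hasse_edges K \<and>
     (\<forall>e\<in>W. \<forall>e'\<in>W. e \<noteq> e' \<longrightarrow> {fst e, snd e} \<inter> {fst e', snd e'} = {})"

definition reversed_hasse :: "'a set set \<Rightarrow> ('a set \<times> 'a set) set \<Rightarrow> ('a set \<times> 'a set) set" where
  "reversed_hasse K W = (hasse_edges K - W) \<union> W\<inverse>"

definition acyclic_matching :: "'a set set \<Rightarrow> ('a set \<times> 'a set) set \<Rightarrow> bool" where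
  "acyclic_matching K W \<longleftrightarrow> is_matching K W \<and> acyclic (reversed_hasse K W)"

definition morse_complex :: "'a set set \<Rightarrow> ('a set \<times> 'a set) set set" where
  "morse_complex K = {W. W \<noteq> {} \<and> acyclic_matching K W}"

definition quotient_topology :: "'a topology \<Rightarrow> ('a \<Rightarrow> 'b) \<Rightarrow> 'b topology" where
  "quotient_topology X q =
     topology (\<lambda>U. U \<subseteq> q ` topspace X \<and> openin X {x \<in> topspace X. q x \<in> U})"

definition sphere_basepoint :: "nat \<Rightarrow> real" where
  "sphere_basepoint = (\<lambda>n. if n = 0 then 1 else 0)"

definition wedge_spheres :: "(nat \<Rightarrow> nat) \<Rightarrow> nat set \<Rightarrow> (nat \<times> (nat \<Rightarrow> real)) option topology" where
  "wedge_spheres d I =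
     quotient_topology (sum_topology (\<lambda>i. nsphere (d i)) I)
       (\<lambda>(i, x). if x = sphere_basepoint then None else Some (i, x))"

end

(* A complex obtained from a contractible subcomplex C by attaching n facets with boundary in C is
   homotopy equivalent to the wedge of the corresponding n spheres, since C may be collapsed to a
   point (homotopy extension). Adding an interval [s, t] of simplices, s a proper face of t, to a
   complex that contains t - {w} for all vertices w of s but not s itself, amounts to gluing the
   simplex t along a cone; this does not change the homotopy type and preserves contractibility.

   The matching complex of the tetrahedron has 24 vertices and 4332 simplices. An explicit list of
   interval additions builds a contractible subcomplex C from a vertex; 21 simplices of dimension 3
   and 24 of dimension 4 have their boundary in C; further interval additions then lead to the
   whole complex. The list was found by a randomized greedy collapse. *)

theory Submission
  imports Defs
begin

section \<open>Geometric realizations and expansions\<close>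

text \<open>The spaces are compact polyhedra in a Euclidean space. They are ANRs, so contractible
  and AR agree for nonempty ones; AR passes to a union with AR intersection, and a closed AR subset
  is a retract, so no retraction has to be written down. Two obstacles shape the rest. Collapsing C
  means pushing a homotopy down through a quotient of the cylinder, which is settled by collapsing
  along a proper map. And acyclicity of the modified Hasse diagram must become a finite list of
  forbidden subsets before anything can be computed. Every Hasse edge of the boundary of the
  tetrahedron contains exactly one of its six edges, so a matching is a word with at most one of
  four letters at each of six places; and directed cycles reduce to cycles of length 3 or 4 of two
  partial functions on four points, one for vertices and one for triangles. The tries also carry the
  empty simplex, to which no point of the realization belongs.\<close>

definition face :: "'n::finite set \<Rightarrow> (real^'n) set" where
  "face \<sigma> = {x. (\<forall>i. 0 \<le> x $ i) \<and> (\<forall>i. i \<notin> \<sigma> \<longrightarrow> x $ i = 0) \<and> (\<Sum>i\<in>UNIV. x $ i) = 1}"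

definition body :: "'n::finite set set \<Rightarrow> (real^'n) set" where
  "body L = (\<Union>\<sigma>\<in>L. face \<sigma>)"

definition down_closed :: "'v set set \<Rightarrow> bool" where
  "down_closed L \<longleftrightarrow> (\<forall>\<sigma>\<in>L. \<forall>\<rho>. \<rho> \<subseteq> \<sigma> \<longrightarrow> \<rho> \<in> L)"

lemma down_closedD: "down_closed L \<Longrightarrow> \<sigma> \<in> L \<Longrightarrow> \<rho> \<subseteq> \<sigma> \<Longrightarrow> \<rho> \<in> L"
  by (auto simp: down_closed_def)

lemma face_empty [simp]: "face {} = {}"
  by (auto simp: face_def)

lemma face_mono: "\<sigma> \<subseteq> \<tau> \<Longrightarrow> face \<sigma> \<subseteq> face \<tau>"
  by (auto simp: face_def)

lemma face_Int: "face \<sigma> \<inter> face \<tau> = face (\<sigma> \<inter> \<tau>)"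
  by (auto simp: face_def)

lemma convex_face: "convex (face \<sigma>)"
  unfolding convex_def face_def
  by (auto simp: sum.distrib sum_distrib_left[symmetric])

lemma compact_face: "compact (face \<sigma>)"
proof -
  have "norm x \<le> 1" if "x \<in> face \<sigma>" for x
  proof -
    have "norm x \<le> (\<Sum>i\<in>UNIV. \<bar>x $ i\<bar>)"
      by (rule norm_le_l1_cart)
    also have "\<dots> = 1"
      using that by (auto simp: face_def)
    finally show ?thesis .
  qed
  then have "bounded (face \<sigma>)"
    by (auto simp: bounded_iff)
  moreover have "closed (face \<sigma>)"
    unfolding face_def
    by (intro closed_Collect_conj closed_Collect_all closed_Collect_imp closed_Collect_le
        closed_Collect_eq continuous_intros) auto
  ultimately show ?thesis
    by (simp add: compact_eq_bounded_closed)
qed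

lemma axis_in_face: "v \<in> \<sigma> \<Longrightarrow> axis v 1 \<in> face \<sigma>"
  by (auto simp: face_def axis_def)

lemma compact_body: "compact (body L)"
  unfolding body_def by (intro compact_UN) (auto intro: compact_face)

lemma ANR_body: "ANR (body L)"
  unfolding body_def
  by (rule ANR_finite_Union_convex_closed) (auto intro: convex_face compact_face compact_imp_closed)

lemma AR_face: "\<sigma> \<noteq> {} \<Longrightarrow> AR (face \<sigma>)"
  using axis_in_face by (blast intro: convex_imp_AR convex_face)

text \<open>The union is star-shaped about the vertex v, hence contractible, and a nonempty
  contractible ANR is an AR.\<close>

lemma AR_union_of_faces_with_common_vertex:
  assumes "M \<noteq> {}" and v: "\<And>\<sigma>. \<sigma> \<in> M \<Longrightarrow> v \<in> \<sigma>"
  shows "AR (body M)"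
proof -
  have "starlike (body M)"
    unfolding starlike_def
  proof (intro bexI ballI)
    show "axis v 1 \<in> body M"
      using assms axis_in_face by (fastforce simp: body_def)
    fix x assume "x \<in> body M"
    then obtain \<sigma> where "\<sigma> \<in> M" "x \<in> face \<sigma>"
      by (auto simp: body_def)
    then show "closed_segment (axis v 1) x \<subseteq> body M"
      using closed_segment_subset[OF _ _ convex_face, of _ \<sigma>] axis_in_face[OF v, of \<sigma>]
      unfolding body_def by blast
  qed
  moreover have "body M \<noteq> {}"
    using assms axis_in_face by (fastforce simp: body_def)
  ultimately show ?thesis
    by (simp add: AR_ANR ANR_body starlike_imp_contractible)
qed

text \<open>If L is down closed, the faces of \<tau> missing from L are then exactly those
  containing \<sigma>. The case \<sigma> = \<tau> is included on purpose: it describes a facet whose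
  whole boundary is present, that is, a cell that becomes a sphere. For \<sigma> \<noteq> \<tau> the
  homotopy type does not change.\<close>

definition expandable :: "'v set set \<Rightarrow> 'v set \<Rightarrow> 'v set \<Rightarrow> bool" where
  "expandable L \<sigma> \<tau> \<longleftrightarrow> \<sigma> \<subseteq> \<tau> \<and> \<sigma> \<noteq> {} \<and> \<sigma> \<notin> L \<and> (\<forall>w\<in>\<sigma>. \<tau> - {w} \<in> L)"

lemma down_closed_expand:
  assumes "down_closed L" "expandable L \<sigma> \<tau>"
  shows "down_closed (L \<union> {\<sigma>..\<tau>})"
  unfolding down_closed_def
proof (intro ballI allI impI)
  fix \<rho> \<rho>' assume \<rho>: "\<rho> \<in> L \<union> {\<sigma>..\<tau>}" "\<rho>' \<subseteq> \<rho>"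
  show "\<rho>' \<in> L \<union> {\<sigma>..\<tau>}"
  proof (cases "\<rho> \<in> L")
    case True
    then show ?thesis using \<rho> assms by (auto dest: down_closedD)
  next
    case False
    then have "\<rho>' \<subseteq> \<tau>" using \<rho> by auto
    show ?thesis
    proof (cases "\<sigma> \<subseteq> \<rho>'")
      case True
      then show ?thesis using \<open>\<rho>' \<subseteq> \<tau>\<close> by auto
    next
      case False
      then obtain w where "w \<in> \<sigma>" "\<rho>' \<subseteq> \<tau> - {w}" using \<open>\<rho>' \<subseteq> \<tau>\<close> by auto
      then show ?thesis
        using assms down_closedD[OF assms(1), of "\<tau> - {w}" \<rho>'] by (auto simp: expandable_def)
    qed
  qed
qed

lemma body_expand:
  assumes "\<sigma> \<subseteq> \<tau>"
  shows "body (L \<union> {\<sigma>..\<tau>}) = body L \<union> face \<tau>"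
proof -
  have "(\<Union>\<rho>\<in>{\<sigma>..\<tau>}. face \<rho>) = face \<tau>"
    using face_mono[of _ \<tau>] assms by (intro equalityI UN_least UN_upper) auto
  then show ?thesis
    by (simp only: body_def UN_Un)
qed

text \<open>A simplex of L cannot contain \<sigma>, because L is down closed, so it misses some w in
  \<sigma>; its common part with \<tau> then lies in the face of \<tau> opposite w.\<close>

lemma face_Int_body:
  assumes "down_closed L" "expandable L \<sigma> \<tau>"
  shows "face \<tau> \<inter> body L = body ((\<lambda>w. \<tau> - {w}) ` \<sigma>)"
proof (intro equalityI subsetI)
  fix x assume "x \<in> face \<tau> \<inter> body L"
  then obtain \<rho> where \<rho>: "\<rho> \<in> L" "x \<in> face (\<tau> \<inter> \<rho>)"
    by (auto simp: body_def simp flip: face_Int)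
  have "\<not> \<sigma> \<subseteq> \<rho>"
    using assms \<rho> by (auto simp: expandable_def dest: down_closedD)
  then obtain w where "w \<in> \<sigma>" "w \<notin> \<rho>" by auto
  then show "x \<in> body ((\<lambda>w. \<tau> - {w}) ` \<sigma>)"
    using \<rho> face_mono[of "\<tau> \<inter> \<rho>" "\<tau> - {w}"] by (auto simp: body_def)
next
  fix x assume "x \<in> body ((\<lambda>w. \<tau> - {w}) ` \<sigma>)"
  then obtain w where "w \<in> \<sigma>" "x \<in> face (\<tau> - {w})"
    by (auto simp: body_def)
  then show "x \<in> face \<tau> \<inter> body L"
    using assms face_mono[of "\<tau> - {w}" \<tau>] by (auto simp: expandable_def body_def)
qed

text \<open>As \<sigma> is a proper face, some vertex v of \<tau> lies outside \<sigma>, and v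
  survives in every \<tau> - {w}: the intersection is a union of faces through v.\<close>

lemma AR_face_Int_body:
  assumes "down_closed L" "expandable L \<sigma> \<tau>" "\<sigma> \<noteq> \<tau>"
  shows "AR (face \<tau> \<inter> body L)"
proof -
  obtain v where "v \<in> \<tau>" "v \<notin> \<sigma>"
    using assms by (auto simp: expandable_def)
  then show ?thesis
    unfolding face_Int_body[OF assms(1,2)]
    using assms by (intro AR_union_of_faces_with_common_vertex[of _ v]) (auto simp: expandable_def)
qed

lemma AR_expand:
  assumes "down_closed L" "expandable L \<sigma> \<tau>" "\<sigma> \<noteq> \<tau>" "AR (body L)"
  shows "AR (body (L \<union> {\<sigma>..\<tau>}))"
proof -
  have "\<sigma> \<subseteq> \<tau>" "\<tau> \<noteq> {}" using assms by (auto simp: expandable_def)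
  moreover have "AR (body L \<inter> face \<tau>)"
    using AR_face_Int_body[OF assms(1-3)] by (simp add: Int_commute)
  ultimately have "AR (body L \<union> face \<tau>)"
    using assms(4) by (intro AR_closed_Un AR_face compact_imp_closed compact_face compact_body)
  then show ?thesis
    by (simp only: body_expand[OF \<open>\<sigma> \<subseteq> \<tau>\<close>])
qed

text \<open>The intersection, being an AR, is a retract of the new simplex. The retraction, extended
  by the identity, is homotopic to the identity along straight segments, which stay inside the
  convex simplex.\<close>

lemma homotopy_equivalent_expand:
  assumes "down_closed L" "expandable L \<sigma> \<tau>" "\<sigma> \<noteq> \<tau>"
  shows "top_of_set (body (L \<union> {\<sigma>..\<tau>})) homotopy_equivalent_space top_of_set (body L)"
proof -
  let ?X = "body L \<union> face \<tau>" and ?Z = "face \<tau> \<inter> body L"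
  have "\<sigma> \<subseteq> \<tau>" using assms by (auto simp: expandable_def)
  have cl: "closed (face \<tau>)" "closed (body L)"
    by (auto intro: compact_imp_closed compact_face compact_body)
  have "?Z retract_of face \<tau>"
    by (intro AR_imp_retract conjI closed_subset closed_Int cl AR_face_Int_body[OF assms]) simp
  then obtain \<rho> where \<rho>: "continuous_on (face \<tau>) \<rho>" "\<rho> ` face \<tau> \<subseteq> ?Z" "\<And>x. x \<in> ?Z \<Longrightarrow> \<rho> x = x"
    by (auto simp: retract_of_def retraction_def)
  define r where "r = (\<lambda>x. if x \<in> body L then x else \<rho> x)"
  have contr: "continuous_on ?X r"
    unfolding r_def
    by (rule continuous_on_cases[OF cl(2,1)]) (use \<rho> in auto)
  have rim: "r x \<in> body L" if "x \<in> ?X" for x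
    using \<rho>(2) that by (auto simp: r_def image_subset_iff)
  have seg: "closed_segment (r x) (id x) \<subseteq> ?X" if "x \<in> ?X" for x
  proof (cases "x \<in> body L")
    case True
    then show ?thesis by (simp add: r_def)
  next
    case False
    then have "r x \<in> face \<tau>" "x \<in> face \<tau>"
      using that \<rho>(2) by (auto simp: r_def)
    then have "closed_segment (r x) (id x) \<subseteq> face \<tau>"
      by (simp add: closed_segment_subset convex_face)
    then show ?thesis by blast
  qed
  have "homotopic_with_canon (\<lambda>x. True) ?X ?X r id"
    by (rule homotopic_with_linear[OF contr _ seg]) (auto intro: continuous_on_id)
  moreover have "retraction_maps (top_of_set ?X) (top_of_set (body L)) r id"
    unfolding retraction_maps_def
    using contr rim by (auto simp: r_def)
  ultimately show ?thesis
    unfolding body_expand[OF \<open>\<sigma> \<subseteq> \<tau>\<close>] by (rule deformation_retract_imp_homotopy_equivalent_space)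
qed

text \<open>The realization consists of functions on an arbitrary vertex type, the body has
  coordinates indexed by a finite type. Relabelling by \<psi> and padding with zeros is a continuous
  bijection from a compact space to a Hausdorff one.\<close>

lemma geometric_realization_homeomorphic_body:
  fixes \<psi> :: "'n::finite \<Rightarrow> 'v"
  assumes L: "down_closed L" and inj: "inj_on \<psi> (\<Union>L)"
  shows "geometric_realization ((`) \<psi> ` L) homeomorphic_space top_of_set (body L)"
proof -
  let ?U = "\<Union>L" and ?X = "geometric_realization ((`) \<psi> ` L)"
  define G where "G x = (\<lambda>v. if v \<in> \<psi> ` ?U then x $ inv_into ?U \<psi> v else 0)" for x :: "real^'n"
  have G\<psi>: "G x (\<psi> i) = x $ i" if "i \<in> ?U" for x i
    using that inj by (simp add: G_def)
  have G0: "G x v = 0" if "v \<notin> \<psi> ` ?U" for x v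
    using that by (simp add: G_def)
  have topX: "topspace ?X = {f. (\<forall>v. 0 \<le> f v) \<and> {v. f v \<noteq> 0} \<in> (`) \<psi> ` L \<and> sum f {v. f v \<noteq> 0} = 1}"
    by (simp add: geometric_realization_def)
  have supp: "{i. x $ i \<noteq> 0} \<in> L" if x: "x \<in> body L" for x
  proof -
    obtain \<sigma> where "\<sigma> \<in> L" "x \<in> face \<sigma>" using x by (auto simp: body_def)
    then show ?thesis
      using down_closedD[OF L, of \<sigma> "{i. x $ i \<noteq> 0}"] by (auto simp: face_def)
  qed
  have "G ` body L = topspace ?X"
  proof (intro equalityI subsetI)
    fix f assume "f \<in> G ` body L"
    then obtain x where x: "x \<in> body L" "f = G x" by blast
    define \<sigma> where "\<sigma> = {i. x $ i \<noteq> 0}"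
    have \<sigma>: "\<sigma> \<in> L" using supp[OF x(1)] by (simp add: \<sigma>_def)
    then have "\<sigma> \<subseteq> ?U" by blast
    have pos: "0 \<le> x $ i" "(\<Sum>i\<in>UNIV. x $ i) = 1" for i
      using x by (auto simp: body_def face_def)
    have sf: "{v. f v \<noteq> 0} = \<psi> ` \<sigma>"
    proof (intro equalityI subsetI)
      fix v assume "v \<in> {v. f v \<noteq> 0}"
      then have "f v \<noteq> 0" "v \<in> \<psi> ` ?U"
        using G0[of v x] x(2) by auto
      then obtain i where "i \<in> ?U" "v = \<psi> i" "f v \<noteq> 0"
        by blast
      then show "v \<in> \<psi> ` \<sigma>"
        using G\<psi>[of i x] x(2) by (simp add: \<sigma>_def)
    next
      fix v assume "v \<in> \<psi> ` \<sigma>"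
      then obtain i where "i \<in> \<sigma>" "v = \<psi> i" by blast
      then show "v \<in> {v. f v \<noteq> 0}"
        using G\<psi>[OF subsetD[OF \<open>\<sigma> \<subseteq> ?U\<close>], of i x] x(2) by (simp add: \<sigma>_def)
    qed
    have "sum f (\<psi> ` \<sigma>) = (\<Sum>i\<in>\<sigma>. f (\<psi> i))"
      using inj_on_subset[OF inj \<open>\<sigma> \<subseteq> ?U\<close>] by (simp add: sum.reindex)
    also have "\<dots> = (\<Sum>i\<in>\<sigma>. x $ i)"
      using G\<psi>[OF subsetD[OF \<open>\<sigma> \<subseteq> ?U\<close>]] x(2) by simp
    also have "\<dots> = (\<Sum>i\<in>UNIV. x $ i)"
      by (rule sum.mono_neutral_left) (auto simp: \<sigma>_def)
    finally have "sum f {v. f v \<noteq> 0} = 1"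
      using pos(2) sf by simp
    moreover have "0 \<le> f v" for v
      using pos(1) x(2) by (simp add: G_def)
    ultimately show "f \<in> topspace ?X"
      unfolding topX using sf \<sigma> by blast
  next
    fix f assume f: "f \<in> topspace ?X"
    then have pos: "\<And>v. 0 \<le> f v" and "{v. f v \<noteq> 0} \<in> (`) \<psi> ` L" and "sum f {v. f v \<noteq> 0} = 1"
      unfolding topX by simp_all
    then obtain \<sigma> where \<sigma>: "{v. f v \<noteq> 0} = \<psi> ` \<sigma>" "\<sigma> \<in> L" and sum: "sum f (\<psi> ` \<sigma>) = 1"
      by (metis (no_types, lifting) imageE)
    have "\<sigma> \<subseteq> ?U" using \<sigma>(2) by blast
    define x :: "real^'n" where "x = (\<chi> i. if i \<in> \<sigma> then f (\<psi> i) else 0)"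
    have "(\<Sum>i\<in>UNIV. x $ i) = (\<Sum>i\<in>\<sigma>. x $ i)"
      by (rule sum.mono_neutral_right) (auto simp: x_def)
    also have "\<dots> = (\<Sum>i\<in>\<sigma>. f (\<psi> i))"
      by (simp add: x_def)
    also have "\<dots> = 1"
      using inj_on_subset[OF inj \<open>\<sigma> \<subseteq> ?U\<close>] sum by (simp add: sum.reindex)
    finally have "x \<in> face \<sigma>"
      using pos by (simp add: face_def) (simp add: x_def)
    then have "x \<in> body L"
      using \<sigma>(2) by (auto simp: body_def)
    have "G x v = f v" for v
    proof (cases "v \<in> \<psi> ` ?U")
      case True
      then obtain i where i: "i \<in> ?U" "v = \<psi> i" by blast
      show ?thesis
      proof (cases "i \<in> \<sigma>")
        case True
        then show ?thesis using G\<psi>[OF i(1)] i by (simp add: x_def)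
      next
        case False
        then have "v \<notin> \<psi> ` \<sigma>"
          using inj i \<open>\<sigma> \<subseteq> ?U\<close> by (auto dest: inj_onD)
        then have "f v = 0" using \<sigma>(1) by blast
        then show ?thesis using False G\<psi>[OF i(1)] i by (simp add: x_def)
      qed
    next
      case False
      then have "v \<notin> \<psi> ` \<sigma>" using \<open>\<sigma> \<subseteq> ?U\<close> by blast
      then have "f v = 0" using \<sigma>(1) by blast
      then show ?thesis using G0[OF False] by simp
    qed
    then have "f = G x" by (intro ext) simp
    then show "f \<in> G ` body L"
      using \<open>x \<in> body L\<close> by (rule image_eqI)
  qed
  moreover have "inj_on G (body L)"
  proof (rule inj_onI)
    fix x y assume x: "x \<in> body L" and y: "y \<in> body L" and eq: "G x = G y"
    have "x $ i = y $ i" for i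
    proof (cases "i \<in> ?U")
      case True
      then show ?thesis using G\<psi>[of i x] G\<psi>[of i y] eq by simp
    next
      case False
      then have "i \<notin> {i. x $ i \<noteq> 0}" "i \<notin> {i. y $ i \<noteq> 0}"
        using supp[OF x] supp[OF y] by blast+
      then show ?thesis by simp
    qed
    then show "x = y" by (simp add: vec_eq_iff)
  qed
  moreover have "continuous_map (top_of_set (body L)) (powertop_real UNIV) G"
  proof -
    have "continuous_on (body L) (\<lambda>x. G x v)" for v
      unfolding G_def by (cases "v \<in> \<psi> ` ?U") (auto intro!: continuous_intros)
    then show ?thesis by (simp add: continuous_map_componentwise_UNIV)
  qed
  then have "continuous_map (top_of_set (body L)) ?X G"
    using \<open>G ` body L = topspace ?X\<close> unfolding topX
    by (simp add: geometric_realization_def continuous_map_in_subtopology flip: image_subset_iff_funcset)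
  moreover have "compact_space (top_of_set (body L))"
    by (simp add: compact_space_subtopology compact_body)
  moreover have "Hausdorff_space ?X"
    unfolding geometric_realization_def
    by (simp add: Hausdorff_space_subtopology Hausdorff_space_product_topology)
  ultimately have "homeomorphic_map (top_of_set (body L)) ?X G"
    by (intro continuous_imp_homeomorphic_map) auto
  then show ?thesis
    using homeomorphic_map_imp_homeomorphic_space homeomorphic_space_sym by blast
qed

text \<open>The extension is the one supplied by Borsuk's theorem for the pair
  \<open>[0,1] \<times> X\<close>, \<open>{0} \<times> X \<union> [0,1] \<times> A\<close>.\<close>

lemma contraction_extends:
  fixes X :: "'a::euclidean_space set"
  assumes "closedin (top_of_set X) A" "ANR X" "contractible A" "A \<noteq> {}"
  obtains H a where "continuous_on ({0..1::real} \<times> X) H" "H \<in> {0..1} \<times> X \<rightarrow> X"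
    "\<And>x. x \<in> X \<Longrightarrow> H (0, x) = x" "H ` ({0..1} \<times> A) \<subseteq> A" "a \<in> A" "\<And>x. x \<in> A \<Longrightarrow> H (1, x) = a"
proof -
  let ?T = "{0..1::real} \<times> X" and ?S = "{0::real} \<times> X \<union> {0..1} \<times> A"
  have "A \<subseteq> X"
    using assms closedin_imp_subset by blast
  obtain a h where h: "continuous_on ({0..1::real} \<times> A) h" "h ` ({0..1} \<times> A) \<subseteq> A"
      and h0: "\<And>x. h (0, x) = x" and h1: "\<And>x. h (1, x) = a"
    using assms(3) unfolding contractible_def homotopic_with_def
    by (fastforce simp: image_subset_iff)
  have "a \<in> A"
    using h(2) h1 assms(4) by force
  define g where "g = (\<lambda>z. if snd z \<in> A then h z else snd z)"
  have clo: "closedin (top_of_set ?T) ({0} \<times> X)" "closedin (top_of_set ?T) ({0..1} \<times> A)"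
    using assms(1) by (auto intro: closedin_Times)
  then have cloS: "closedin (top_of_set ?T) ?S"
    by blast
  have hA: "h (t, x) \<in> A" if "0 \<le> t" "t \<le> 1" "x \<in> A" for t x
    using h(2) that by (auto simp: image_subset_iff)
  have sub: "{0..1} \<times> A \<union> {0} \<times> X \<subseteq> ?T"
    using \<open>A \<subseteq> X\<close> by auto
  have "continuous_on ({0..1} \<times> A \<union> {0} \<times> X) g"
    unfolding g_def
  proof (rule continuous_on_cases_local)
    show "closedin (top_of_set ({0..1::real} \<times> A \<union> {0} \<times> X)) ({0..1} \<times> A)"
      by (rule closedin_subset_trans[OF clo(2) _ sub]) auto
    show "closedin (top_of_set ({0..1::real} \<times> A \<union> {0} \<times> X)) ({0} \<times> X)"
      by (rule closedin_subset_trans[OF clo(1) _ sub]) auto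
    show "continuous_on ({0::real} \<times> X) snd"
      by (rule continuous_on_snd[OF continuous_on_id])
    show "h z = snd z" if "z \<in> {0..1} \<times> A \<and> snd z \<notin> A \<or> z \<in> {0} \<times> X \<and> snd z \<in> A" for z
      using that h0 by (cases z) auto
  qed (rule h(1))
  then have contg: "continuous_on ?S g"
    by (simp add: Un_commute)
  have gim: "g ` ?S \<subseteq> X"
    using hA \<open>A \<subseteq> X\<close> by (auto simp: g_def)
  define B where "B = ?S"
  have sc: "(s * t, x) \<in> B" if "0 \<le> s" "s \<le> 1" "(t, x) \<in> B" for s t :: real and x
    using that by (auto simp: mult_le_one B_def)
  have gB: "g z \<in> X" if "z \<in> B" for z
    using gim that by (auto simp: B_def)
  have contgB: "continuous_on B g"
    using contg by (simp add: B_def)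
  \<comment> \<open>Scaling the time coordinate joins g to the projection \<open>snd\<close>. The
    projection is defined on the whole cylinder, so the extension theorem turns this homotopy into
    an extension H of g.\<close>
  have hom: "homotopic_with_canon (\<lambda>x. True) B X snd g"
    unfolding homotopic_with_def
  proof (intro exI conjI allI ballI)
    let ?K = "\<lambda>z. g (fst z * fst (snd z), snd (snd z))"
    have "continuous_on ({0..1} \<times> B) ?K"
      by (rule continuous_on_compose2[OF contgB]) (auto intro!: continuous_intros sc)
    moreover have "?K \<in> {0..1} \<times> B \<rightarrow> X"
      by (auto intro!: gB sc)
    ultimately have "continuous_map (top_of_set ({0..1} \<times> B)) (top_of_set X) ?K"
      by (simp only: continuous_map_subtopology_eu)
    then show "continuous_map (prod_topology (top_of_set {0..1}) (top_of_set B)) (top_of_set X) ?K"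
      by (simp only: prod_topology_subtopology_eu)
    show "?K (0, x) = snd x" for x
      using h0 by (simp add: g_def)
    show "?K (1, x) = g x" for x
      by simp
  qed auto
  obtain H where H: "continuous_on ?T H" "H ` ?T \<subseteq> X" "\<And>z. z \<in> ?S \<Longrightarrow> H z = g z"
    by (rule Borsuk_homotopy_extension_homotopic[OF cloS _ _ _ hom[unfolded B_def]])
       (use assms(2) in \<open>auto intro: continuous_on_snd continuous_on_id\<close>)
  show thesis
  proof
    show "continuous_on ?T H" "H \<in> ?T \<rightarrow> X" "a \<in> A"
      using H(1,2) \<open>a \<in> A\<close> by blast+
    show "H (0, x) = x" if "x \<in> X" for x
      using H(3)[of "(0, x)"] that h0 by (simp add: g_def)
    show "H (1, x) = a" if "x \<in> A" for x
      using H(3)[of "(1, x)"] that h1 by (simp add: g_def)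
    show "H ` ({0..1} \<times> A) \<subseteq> A"
      using H(3) hA by (auto simp: g_def)
  qed
qed

section \<open>Collapsing a contractible subcomplex\<close>

text \<open>The end of the homotopy H is constant on A, so it factors through q; the factor r is the
  homotopy inverse. Since H keeps A inside A at all times, q after H is also constant on fibres and
  induces the homotopy on W. Properness of q makes its product with the unit interval closed, hence
  a quotient map, so this second factor is continuous.\<close>

lemma homotopy_equivalent_collapse:
  assumes prp: "proper_map X W q" and cont: "continuous_map X W q"
    and surj: "q ` topspace X = topspace W"
    and fib: "\<And>x y. x \<in> topspace X \<Longrightarrow> y \<in> topspace X \<Longrightarrow> q x = q y \<Longrightarrow> x = y \<or> x \<in> A \<and> y \<in> A"
    and qA: "\<And>x y. x \<in> A \<Longrightarrow> y \<in> A \<Longrightarrow> q x = q y"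
    and H: "continuous_map (prod_topology (top_of_set {0..1::real}) X) X H"
    and H0: "\<And>x. x \<in> topspace X \<Longrightarrow> H (0, x) = x"
    and HA: "\<And>t x. 0 \<le> t \<Longrightarrow> t \<le> 1 \<Longrightarrow> x \<in> A \<Longrightarrow> H (t, x) \<in> A"
    and H1: "\<And>x. x \<in> A \<Longrightarrow> H (1, x) = a"
  shows "X homotopy_equivalent_space W"
proof -
  let ?I = "top_of_set {0..1::real}"
  let ?Q = "\<lambda>(t, x). (t, q x)"
  have quot: "quotient_map X W q"
    by (simp add: cont continuous_closed_imp_quotient_map prp proper_imp_closed_map surj)
  have "proper_map (prod_topology ?I X) (prod_topology ?I W) ?Q"
    using prp proper_map_id[of ?I] by (simp add: proper_map_prod id_def)
  moreover have "continuous_map (prod_topology ?I X) (prod_topology ?I W) ?Q"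
    by (simp add: continuous_map_prod_top cont)
  moreover have "?Q ` topspace (prod_topology ?I X) = topspace (prod_topology ?I W)"
    using surj by (force simp: image_iff)
  ultimately have Quot: "quotient_map (prod_topology ?I X) (prod_topology ?I W) ?Q"
    by (simp add: continuous_closed_imp_quotient_map proper_imp_closed_map)
  have contH: "continuous_map X X (\<lambda>x. H (t, x))" if "0 \<le> t" "t \<le> 1" for t
  proof -
    have "continuous_map X (prod_topology ?I X) (\<lambda>x. (t, x))"
      using that by (auto simp: continuous_map_pairwise o_def)
    from continuous_map_compose[OF this H] show ?thesis by (simp add: o_def)
  qed
  have "H (1, x) = H (1, y)" if "x \<in> topspace X" "y \<in> topspace X" "q x = q y" for x y
    using fib[OF that] H1 by auto
  with quotient_map_lift_exists[OF quot contH[of 1]]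
  obtain r where r: "continuous_map W X r" "\<And>x. x \<in> topspace X \<Longrightarrow> r (q x) = H (1, x)"
    by (metis zero_le_one order_refl)
  have contqH: "continuous_map (prod_topology ?I X) W (q \<circ> H)"
    using H cont by (rule continuous_map_compose)
  have "(q \<circ> H) u = (q \<circ> H) v"
    if uv: "u \<in> topspace (prod_topology ?I X)" "v \<in> topspace (prod_topology ?I X)" "?Q u = ?Q v" for u v
  proof -
    obtain t x y where "u = (t, x)" "v = (t, y)" "q x = q y" "0 \<le> t" "t \<le> 1"
        "x \<in> topspace X" "y \<in> topspace X"
      using uv by (cases u; cases v) auto
    then show ?thesis
      using fib[of x y] qA HA by auto
  qed
  with quotient_map_lift_exists[OF Quot contqH]
  obtain G where G: "continuous_map (prod_topology ?I W) W G"
      "\<And>u. u \<in> topspace (prod_topology ?I X) \<Longrightarrow> G (?Q u) = (q \<circ> H) u"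
    by metis
  have Gq: "G (t, q x) = q (H (t, x))" if "0 \<le> t" "t \<le> 1" "x \<in> topspace X" for t x
    using G(2)[of "(t, x)"] that by simp
  have "homotopic_with (\<lambda>x. True) X X id (r \<circ> q)"
    by (subst homotopic_with) (use H H0 r(2) in \<open>auto intro!: exI[of _ H]\<close>)
  then have rq: "homotopic_with (\<lambda>x. True) X X (r \<circ> q) id"
    by (rule homotopic_with_symD)
  have G0: "G (0, w) = w" and G1: "G (1, w) = q (r w)" if "w \<in> topspace W" for w
  proof -
    obtain x where "x \<in> topspace X" "w = q x"
      using \<open>w \<in> topspace W\<close> surj by blast
    then show "G (0, w) = w" "G (1, w) = q (r w)"
      using Gq[of 0 x] Gq[of 1 x] H0 r(2) by auto
  qed
  have "homotopic_with (\<lambda>x. True) W W id (q \<circ> r)"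
    by (subst homotopic_with) (use G G0 G1 in \<open>auto intro!: exI[of _ G]\<close>)
  then have qr: "homotopic_with (\<lambda>x. True) W W (q \<circ> r) id"
    by (rule homotopic_with_symD)
  show ?thesis
    unfolding homotopy_equivalent_space_def using cont r(1) rq qr by blast
qed

section \<open>Quotient topologies and the topology of a wedge\<close>

lemma openin_quotient_topology:
  "openin (quotient_topology X q) U \<longleftrightarrow>
    U \<subseteq> q ` topspace X \<and> openin X {x \<in> topspace X. q x \<in> U}"
proof -
  have "istopology (\<lambda>U. U \<subseteq> q ` topspace X \<and> openin X {x \<in> topspace X. q x \<in> U})"
    unfolding istopology_def
  proof (intro conjI allI impI; (elim conjE)?)
    fix S T assume "openin X {x \<in> topspace X. q x \<in> S}" "openin X {x \<in> topspace X. q x \<in> T}"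
    then have "openin X ({x \<in> topspace X. q x \<in> S} \<inter> {x \<in> topspace X. q x \<in> T})"
      by (rule openin_Int)
    then show "openin X {x \<in> topspace X. q x \<in> S \<inter> T}"
      by (rule back_subst[of "openin X"]) auto
  next
    fix \<K> assume "\<forall>K\<in>\<K>. K \<subseteq> q ` topspace X \<and> openin X {x \<in> topspace X. q x \<in> K}"
    then have "openin X (\<Union>K\<in>\<K>. {x \<in> topspace X. q x \<in> K})" "\<Union>\<K> \<subseteq> q ` topspace X"
      by auto
    moreover have "(\<Union>K\<in>\<K>. {x \<in> topspace X. q x \<in> K}) = {x \<in> topspace X. q x \<in> \<Union>\<K>}"
      by auto
    ultimately show "\<Union>\<K> \<subseteq> q ` topspace X" "openin X {x \<in> topspace X. q x \<in> \<Union>\<K>}"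
      by auto
  qed auto
  then show ?thesis
    by (simp add: quotient_topology_def)
qed

lemma topspace_quotient_topology [simp]: "topspace (quotient_topology X q) = q ` topspace X"
proof -
  have "{x \<in> topspace X. q x \<in> q ` topspace X} = topspace X"
    by auto
  then have "openin (quotient_topology X q) (q ` topspace X)"
    by (simp add: openin_quotient_topology)
  then show ?thesis
    by (meson openin_quotient_topology openin_subset openin_topspace subset_antisym)
qed

lemma quotient_map_quotient_topology: "quotient_map X (quotient_topology X q) q"
  by (auto simp: quotient_map_def openin_quotient_topology)

definition wedge_point :: "nat \<times> (nat \<Rightarrow> real) \<Rightarrow> (nat \<times> (nat \<Rightarrow> real)) option" where
  "wedge_point = (\<lambda>(i, x). if x = sphere_basepoint then None else Some (i, x))"

lemma wedge_spheres_alt: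
  "wedge_spheres d I = quotient_topology (sum_topology (\<lambda>i. nsphere (d i)) I) wedge_point"
  by (simp add: wedge_spheres_def wedge_point_def)

lemma continuous_map_wedge_point:
  assumes "i \<in> I"
  shows "continuous_map (nsphere (d i)) (wedge_spheres d I) (\<lambda>x. wedge_point (i, x))"
proof -
  have "continuous_map (nsphere (d i)) (sum_topology (\<lambda>i. nsphere (d i)) I) (\<lambda>x. (i, x))"
    by (rule continuous_map_component_injection[OF assms])
  from continuous_map_compose[OF this quotient_imp_continuous_map[OF quotient_map_quotient_topology]]
  show ?thesis by (simp add: wedge_spheres_alt o_def)
qed

lemma closedin_wedge_spheres:
  "closedin (wedge_spheres d I) S \<longleftrightarrow> S \<subseteq> topspace (wedge_spheres d I) \<and>
    (\<forall>i\<in>I. closedin (nsphere (d i)) {x \<in> topspace (nsphere (d i)). wedge_point (i, x) \<in> S})"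
proof (cases "S \<subseteq> topspace (wedge_spheres d I)")
  case True
  have *: "{x. (i, x) \<in> Sigma I (\<lambda>i. topspace (nsphere (d i))) \<and> wedge_point (i, x) \<in> S}
      = {x \<in> topspace (nsphere (d i)). wedge_point (i, x) \<in> S}" if "i \<in> I" for i
    using that by auto
  have "closedin (wedge_spheres d I) S \<longleftrightarrow>
      closedin (sum_topology (\<lambda>i. nsphere (d i)) I)
        {z \<in> topspace (sum_topology (\<lambda>i. nsphere (d i)) I). wedge_point z \<in> S}"
    using quotient_map_quotient_topology[of "sum_topology (\<lambda>i. nsphere (d i)) I" wedge_point] True
    unfolding wedge_spheres_alt quotient_map_closedin by blast
  also have "\<dots> \<longleftrightarrow> (\<forall>i\<in>I. closedin (nsphere (d i)) {x \<in> topspace (nsphere (d i)). wedge_point (i, x) \<in> S})"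
    using * by (auto simp: closedin_sum_topology o_def)
  finally show ?thesis
    using True by simp
next
  case False
  then show ?thesis
    using closedin_subset by blast
qed

section \<open>From the simplex to the sphere\<close>

text \<open>The inverse stereographic projection of the point \<open>((u k - u 0) / m)\<^sub>k\<close>, where \<open>m\<close> is the
  smallest barycentric coordinate, with denominators cleared so that it also makes sense on the
  boundary \<open>m = 0\<close>, which goes to the base point.\<close>

definition simplex_to_sphere :: "nat \<Rightarrow> (nat \<Rightarrow> real) \<Rightarrow> nat \<Rightarrow> real" where
  "simplex_to_sphere d u = (let m = Min (u ` {..d}); s = (\<Sum>k=1..d. (u k - u 0)\<^sup>2) in
     (\<lambda>k. if k = 0 then (s - m\<^sup>2) / (s + m\<^sup>2)
          else if k \<le> d then 2 * m * (u k - u 0) / (s + m\<^sup>2) else 0))"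

text \<open>Coordinates beyond d are left free, so that the coordinates of a point along an
  enumeration of a facet qualify, whatever the enumeration does beyond d.\<close>

definition std_simplex :: "nat \<Rightarrow> (nat \<Rightarrow> real) set" where
  "std_simplex d = {u. (\<forall>k\<le>d. 0 \<le> u k) \<and> (\<Sum>k\<le>d. u k) = 1}"

lemma sum_atMost_split_0: "(\<Sum>k\<le>d. f k) = f 0 + (\<Sum>k=1..d. f k)" for f :: "nat \<Rightarrow> real"
  by (simp add: atMost_atLeast0 sum.atLeast_Suc_atMost)

text \<open>The second claim says that the denominator in \<open>simplex_to_sphere\<close> is
  positive: if it vanished, all coordinates would equal u 0 and hence the minimum 0, against their
  sum being 1.\<close>

lemma simplex_Min:
  assumes "u \<in> std_simplex d"
  shows "0 \<le> Min (u ` {..d})" "(\<Sum>k=1..d. (u k - u 0)\<^sup>2) + (Min (u ` {..d}))\<^sup>2 > 0"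
proof -
  let ?m = "Min (u ` {..d})" and ?s = "\<Sum>k=1..d. (u k - u 0)\<^sup>2"
  show "0 \<le> ?m"
    using assms by (auto simp: std_simplex_def)
  have "?s \<ge> 0" by (rule sum_nonneg) simp
  moreover have False if "?s = 0" "?m = 0"
  proof -
    have const: "u k = u 0" if "k \<le> d" for k
      using \<open>?s = 0\<close> that by (cases "k = 0") (auto simp: sum_nonneg_eq_0_iff)
    have "?m \<in> u ` {..d}" by (rule Min_in) auto
    then obtain j where "?m = u j" "j \<in> {..d}"
      by (rule imageE)
    then have "u 0 = 0"
      using \<open>?m = 0\<close> const[of j] by simp
    then have "u k = 0" if "k \<le> d" for k
      using const[OF that] by simp
    then show False
      using assms by (simp add: std_simplex_def)
  qed
  ultimately show "?s + ?m\<^sup>2 > 0"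
    by (smt (verit) zero_le_power2 zero_eq_power2)
qed

lemma simplex_to_sphere_eq_basepoint_iff:
  assumes "u \<in> std_simplex d"
  shows "simplex_to_sphere d u = sphere_basepoint \<longleftrightarrow> Min (u ` {..d}) = 0"
proof -
  define m s where "m = Min (u ` {..d})" and "s = (\<Sum>k=1..d. (u k - u 0)\<^sup>2)"
  have pos: "s + m\<^sup>2 > 0" using simplex_Min[OF assms] by (simp add: m_def s_def)
  have val: "simplex_to_sphere d u k = (if k = 0 then (s - m\<^sup>2) / (s + m\<^sup>2)
          else if k \<le> d then 2 * m * (u k - u 0) / (s + m\<^sup>2) else 0)" for k
    by (simp add: simplex_to_sphere_def Let_def s_def m_def)
  show ?thesis
  proof
    assume "Min (u ` {..d}) = 0"
    then have "m = 0" by (simp add: m_def)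
    then have "simplex_to_sphere d u k = sphere_basepoint k" for k
      using pos by (simp add: val sphere_basepoint_def)
    then show "simplex_to_sphere d u = sphere_basepoint" by blast
  next
    assume "simplex_to_sphere d u = sphere_basepoint"
    then have "simplex_to_sphere d u 0 = 1"
      by (simp add: sphere_basepoint_def)
    then have "(s - m\<^sup>2) / (s + m\<^sup>2) = 1"
      by (simp only: val simp_thms if_True)
    then have "m\<^sup>2 = 0" using pos by (simp add: field_simps)
    then show "Min (u ` {..d}) = 0" by (simp add: m_def)
  qed
qed

lemma Min_pos_of_ne_basepoint:
  assumes "u \<in> std_simplex d" "simplex_to_sphere d u \<noteq> sphere_basepoint"
  shows "Min (u ` {..d}) > 0"
proof -
  have "Min (u ` {..d}) \<noteq> 0"
    using assms(2) unfolding simplex_to_sphere_eq_basepoint_iff[OF assms(1)] .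
  then show ?thesis
    using order_le_imp_less_or_eq[OF simplex_Min(1)[OF assms(1)]] by argo
qed

lemma simplex_to_sphere_in_nsphere:
  assumes "u \<in> std_simplex d"
  shows "simplex_to_sphere d u \<in> topspace (nsphere d)"
proof -
  define m s where "m = Min (u ` {..d})" and "s = (\<Sum>k=1..d. (u k - u 0)\<^sup>2)"
  have pos: "s + m\<^sup>2 > 0" using simplex_Min[OF assms] by (simp add: m_def s_def)
  have val: "simplex_to_sphere d u k = (if k = 0 then (s - m\<^sup>2) / (s + m\<^sup>2)
          else if k \<le> d then 2 * m * (u k - u 0) / (s + m\<^sup>2) else 0)" for k
    by (simp add: simplex_to_sphere_def Let_def s_def m_def)
  have "(\<Sum>k=1..d. (simplex_to_sphere d u k)\<^sup>2) = (\<Sum>k=1..d. (2 * m / (s + m\<^sup>2))\<^sup>2 * (u k - u 0)\<^sup>2)"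
    by (rule sum.cong) (auto simp: val power_mult_distrib power_divide)
  also have "\<dots> = (2 * m / (s + m\<^sup>2))\<^sup>2 * s"
    by (simp add: s_def sum_distrib_left)
  finally have "(\<Sum>k\<le>d. (simplex_to_sphere d u k)\<^sup>2)
      = ((s - m\<^sup>2) / (s + m\<^sup>2))\<^sup>2 + (2 * m / (s + m\<^sup>2))\<^sup>2 * s"
    by (simp add: sum_atMost_split_0 val)
  also have "\<dots> = ((s - m\<^sup>2)\<^sup>2 + 4 * m\<^sup>2 * s) / (s + m\<^sup>2)\<^sup>2"
    by (simp add: power_divide power_mult_distrib add_divide_distrib)
  also have "(s - m\<^sup>2)\<^sup>2 + 4 * m\<^sup>2 * s = (s + m\<^sup>2)\<^sup>2"
    by (simp add: power2_eq_square algebra_simps)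
  finally have "(\<Sum>k\<le>d. (simplex_to_sphere d u k)\<^sup>2) = 1"
    using pos by simp
  then show ?thesis
    by (auto simp: nsphere val)
qed

text \<open>Dividing coordinate k of the image by 1 minus its coordinate 0 undoes the stereographic
  projection and returns (u k - u 0) / m. This determines u / m up to an additive constant; the
  constant is fixed by the minimum of u / m being 1, and the scale by the sum of u being 1.\<close>

lemma simplex_to_sphere_inj:
  assumes u: "u \<in> std_simplex d" and v: "v \<in> std_simplex d"
    and ne: "simplex_to_sphere d u \<noteq> sphere_basepoint"
    and eq: "simplex_to_sphere d u = simplex_to_sphere d v" and "k \<le> d"
  shows "u k = v k"
proof -
  define M S where "M w = Min (w ` {..d})" and "S w = (\<Sum>k=1..d. (w k - w 0)\<^sup>2)" for w :: "nat \<Rightarrow> real"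
  have nev: "simplex_to_sphere d v \<noteq> sphere_basepoint"
    by (rule ne[unfolded eq])
  have M: "M u > 0" "M v > 0"
    unfolding M_def using Min_pos_of_ne_basepoint[OF u ne] Min_pos_of_ne_basepoint[OF v nev] .
  have rat: "simplex_to_sphere d w k / (1 - simplex_to_sphere d w 0) = (w k - w 0) / M w"
    if "M w > 0" "1 \<le> k" "k \<le> d" for w k
  proof -
    have "S w \<ge> 0" unfolding S_def by (rule sum_nonneg) simp
    then have pos: "S w + (M w)\<^sup>2 > 0"
      using that by (simp add: add_nonneg_pos)
    have "simplex_to_sphere d w 0 = (S w - (M w)\<^sup>2) / (S w + (M w)\<^sup>2)"
      by (simp add: simplex_to_sphere_def Let_def M_def S_def)
    then have "1 - simplex_to_sphere d w 0 = 2 * (M w)\<^sup>2 / (S w + (M w)\<^sup>2)"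
      using pos by (simp add: field_simps)
    moreover have "simplex_to_sphere d w k = 2 * M w * (w k - w 0) / (S w + (M w)\<^sup>2)"
      using that by (simp add: simplex_to_sphere_def Let_def M_def S_def)
    ultimately show ?thesis
      using pos that by (simp add: power2_eq_square)
  qed
  have diff: "u k / M u - u 0 / M u = v k / M v - v 0 / M v" if "k \<le> d" for k
  proof (cases "k = 0")
    case False
    then show ?thesis
      using rat[OF M(1), of k] rat[OF M(2), of k] that by (simp add: eq diff_divide_distrib)
  qed simp
  define c where "c = u 0 / M u - v 0 / M v"
  have uv: "u k / M u = v k / M v + c" if "k \<le> d" for k
    using diff[OF that] by (simp add: c_def)
  have ge: "w k / M w \<ge> 1" if "M w > 0" "k \<le> d" for w k
    using that by (simp add: M_def)
  have att: "\<exists>k\<le>d. w k / M w = 1" if "M w > 0" for w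
  proof -
    have "M w \<in> w ` {..d}" unfolding M_def by (rule Min_in) auto
    then show ?thesis using that by auto
  qed
  obtain i j where "i \<le> d" "u i / M u = 1" "j \<le> d" "v j / M v = 1"
    using att[OF M(1)] att[OF M(2)] by blast
  \<comment> \<open>At i the vector u / M u takes its minimum 1 while v / M v is at least 1, so c is
    at most 0; at j the roles are exchanged.\<close>
  then have "c = 0"
    using ge[OF M(2), of i] ge[OF M(1), of j] uv[of i] uv[of j] by simp
  then have quot: "u k / M u = v k / M v" if "k \<le> d" for k
    using uv[OF that] by simp
  have "1 / M u = (\<Sum>k\<le>d. u k / M u)" "1 / M v = (\<Sum>k\<le>d. v k / M v)"
    using u v by (simp_all add: std_simplex_def flip: sum_divide_distrib)
  then have "1 / M u = 1 / M v"
    using quot by simp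
  then have "M u = M v"
    by simp
  then show ?thesis
    using quot[OF \<open>k \<le> d\<close>] M by simp
qed

lemma simplex_to_sphere_surj:
  assumes y: "y \<in> topspace (nsphere d)" and ne: "y \<noteq> sphere_basepoint"
  obtains u where "u \<in> std_simplex d" "\<And>k. k > d \<Longrightarrow> u k = 0" "simplex_to_sphere d u = y"
proof -
  have y1: "(\<Sum>k\<le>d. (y k)\<^sup>2) = 1" and y0: "\<And>k. k > d \<Longrightarrow> y k = 0"
    using y by (auto simp: nsphere)
  then have sq: "(y 0)\<^sup>2 + (\<Sum>k=1..d. (y k)\<^sup>2) = 1"
    by (simp add: sum_atMost_split_0)
  have "(\<Sum>k=1..d. (y k)\<^sup>2) \<ge> 0" by (rule sum_nonneg) simp
  have "y 0 \<noteq> 1"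
  proof
    assume "y 0 = 1"
    then have "\<And>k. k \<in> {1..d} \<Longrightarrow> y k = 0"
      using sq by (auto simp: sum_nonneg_eq_0_iff)
    then have "y k = sphere_basepoint k" for k
      using y0[of k] \<open>y 0 = 1\<close> by (cases "k > d") (auto simp: sphere_basepoint_def)
    then show False using ne by blast
  qed
  moreover have "y 0 \<le> 1"
    using abs_square_le_1[of "y 0"] sq \<open>(\<Sum>k=1..d. (y k)\<^sup>2) \<ge> 0\<close> by linarith
  ultimately have lt: "y 0 < 1" by simp
  \<comment> \<open>s holds the stereographic coordinates, with s 0 = 0 as reference value; a shifts
    them to have minimum 1, and u rescales a to sum 1. The minimum of u is therefore 1 / T.\<close>
  define s where "s k = (if k = 0 then 0 else y k / (1 - y 0))" for k
  define a where "a k = s k - Min (s ` {..d}) + 1" for k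
  define T where "T = (\<Sum>k\<le>d. a k)"
  define u where "u k = (if k \<le> d then a k / T else 0)" for k
  have a1: "a k \<ge> 1" if "k \<le> d" for k
    using that by (simp add: a_def)
  have "T \<ge> (\<Sum>k\<le>d. 1)"
    unfolding T_def by (rule sum_mono) (use a1 in auto)
  then have T: "T > 0" by simp
  have us: "u \<in> std_simplex d"
  proof -
    have "u k \<ge> 0" if "k \<le> d" for k
      using a1[OF that] T that by (simp add: u_def)
    moreover have "(\<Sum>k\<le>d. u k) = (\<Sum>k\<le>d. a k) / T"
      by (simp add: u_def sum_divide_distrib)
    ultimately show ?thesis
      using T by (simp add: std_simplex_def T_def)
  qed
  have Minu: "Min (u ` {..d}) = 1 / T"
  proof (rule Min_eqI)
    show "1 / T \<le> x" if "x \<in> u ` {..d}" for x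
      using that a1 T by (auto simp: u_def divide_right_mono)
    have "Min (s ` {..d}) \<in> s ` {..d}" by (rule Min_in) auto
    then obtain k where "Min (s ` {..d}) = s k" "k \<in> {..d}"
      by (rule imageE)
    then have "k \<le> d" "a k = 1"
      by (simp_all add: a_def)
    then show "1 / T \<in> u ` {..d}"
      by (intro image_eqI[of _ _ k]) (auto simp: u_def)
  qed simp
  have diff: "u k - u 0 = s k / T" if "k \<le> d" for k
  proof -
    have "s 0 = 0" by (simp add: s_def)
    then have "a k - a 0 = s k" by (simp only: a_def)
    then show ?thesis
      using that by (simp add: u_def flip: diff_divide_distrib)
  qed
  define q where "q = (\<Sum>k=1..d. (s k)\<^sup>2)"
  have su: "(\<Sum>k=1..d. (u k - u 0)\<^sup>2) = q / T\<^sup>2"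
    unfolding q_def sum_divide_distrib by (rule sum.cong) (auto simp: diff power_divide)
  have "q = (\<Sum>k=1..d. (y k)\<^sup>2) / (1 - y 0)\<^sup>2"
    unfolding q_def sum_divide_distrib by (rule sum.cong) (auto simp: s_def power_divide)
  also have "\<dots> = (1 - (y 0)\<^sup>2) / (1 - y 0)\<^sup>2"
    using sq by (simp add: algebra_simps)
  also have "\<dots> = (1 + y 0) / (1 - y 0)"
    using lt by (simp add: power2_eq_square divide_simps) (simp add: algebra_simps)
  finally have q: "q = (1 + y 0) / (1 - y 0)" .
  then have q1: "q + 1 = 2 / (1 - y 0)" "q - 1 = 2 * y 0 / (1 - y 0)"
    using lt by (simp_all add: field_simps)
  have den: "q / T\<^sup>2 + (1 / T)\<^sup>2 = (q + 1) / T\<^sup>2" "q / T\<^sup>2 - (1 / T)\<^sup>2 = (q - 1) / T\<^sup>2"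
    by (simp_all add: power_divide add_divide_distrib diff_divide_distrib)
  have "simplex_to_sphere d u k = y k" for k
  proof -
    consider "k = 0" | "k \<noteq> 0" "k \<le> d" | "k > d" by linarith
    then show ?thesis
    proof cases
      case 1
      then have "simplex_to_sphere d u k = ((q - 1) / T\<^sup>2) / ((q + 1) / T\<^sup>2)"
        by (simp only: simplex_to_sphere_def Let_def su Minu den if_True refl)
      also have "\<dots> = (q - 1) / (q + 1)"
        using T by simp
      finally show ?thesis using lt 1 by (simp add: q1)
    next
      case 2
      then have "simplex_to_sphere d u k = 2 * (1 / T) * (s k / T) / ((q + 1) / T\<^sup>2)"
        by (simp only: simplex_to_sphere_def Let_def su Minu den diff if_False if_True)
      also have "\<dots> = 2 * s k / (q + 1)"
        using T by (simp add: power2_eq_square)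
      also have "\<dots> = y k"
        using lt 2 by (simp add: q1 s_def)
      finally show ?thesis .
    next
      case 3
      then show ?thesis by (simp add: simplex_to_sphere_def Let_def y0)
    qed
  qed
  then have "simplex_to_sphere d u = y" by blast
  with us that show thesis by (simp add: u_def)
qed

lemma continuous_on_Min_atMost:
  fixes f :: "nat \<Rightarrow> 'a::topological_space \<Rightarrow> real"
  assumes "\<And>k. k \<le> d \<Longrightarrow> continuous_on S (f k)"
  shows "continuous_on S (\<lambda>x. Min ((\<lambda>k. f k x) ` {..d}))"
  using assms
proof (induction d)
  case (Suc d)
  have "Min ((\<lambda>k. f k x) ` {..Suc d}) = min (f (Suc d) x) (Min ((\<lambda>k. f k x) ` {..d}))" for x
    by (simp add: atMost_Suc)
  then show ?case
    using Suc by (simp add: continuous_on_min)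
qed simp

lemma continuous_map_simplex_to_sphere:
  fixes f :: "nat \<Rightarrow> 'a::topological_space \<Rightarrow> real"
  assumes cont: "\<And>k. k \<le> d \<Longrightarrow> continuous_on S (f k)"
    and simplex: "\<And>x. x \<in> S \<Longrightarrow> (\<lambda>k. f k x) \<in> std_simplex d"
  shows "continuous_map (top_of_set S) (nsphere d) (\<lambda>x. simplex_to_sphere d (\<lambda>k. f k x))"
proof -
  have "continuous_on S (\<lambda>x. simplex_to_sphere d (\<lambda>k. f k x) j)" for j
  proof -
    define q m where "q x = (\<Sum>k=1..d. (f k x - f 0 x)\<^sup>2)" and "m x = Min ((\<lambda>k. f k x) ` {..d})" for x
    have ne: "q x + (m x)\<^sup>2 \<noteq> 0" if "x \<in> S" for x
      using simplex_Min(2)[OF simplex[OF that]] by (simp add: q_def m_def)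
    have c: "continuous_on S q" "continuous_on S m"
      unfolding q_def m_def by (intro continuous_on_Min_atMost continuous_intros cont; simp)+
    consider "j = 0" | "j \<noteq> 0" "j \<le> d" | "j > d" by linarith
    then show ?thesis
    proof cases
      case 1
      have "continuous_on S (\<lambda>x. (q x - (m x)\<^sup>2) / (q x + (m x)\<^sup>2))"
        by (intro continuous_intros c ballI ne)
      then show ?thesis
        using 1 by (simp add: simplex_to_sphere_def Let_def q_def m_def)
    next
      case 2
      have "continuous_on S (\<lambda>x. 2 * m x * (f j x - f 0 x) / (q x + (m x)\<^sup>2))"
        by (intro continuous_intros c ballI ne cont) (use 2 in auto)
      then show ?thesis
        using 2 by (simp add: simplex_to_sphere_def Let_def q_def m_def)
    qed (simp add: simplex_to_sphere_def Let_def)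
  qed
  then have "continuous_map (top_of_set S) (powertop_real UNIV) (\<lambda>x. simplex_to_sphere d (\<lambda>k. f k x))"
    by (simp add: continuous_map_componentwise_UNIV)
  moreover have "simplex_to_sphere d (\<lambda>k. f k x) \<in> topspace (nsphere d)" if "x \<in> S" for x
    using simplex_to_sphere_in_nsphere[OF simplex[OF that]] .
  ultimately show ?thesis
    by (auto simp: nsphere continuous_map_in_subtopology)
qed

lemma Hausdorff_nsphere: "Hausdorff_space (nsphere d)"
  unfolding nsphere_def by (intro Hausdorff_space_subtopology Hausdorff_Euclidean_space)

lemma sphere_basepoint_in_nsphere: "sphere_basepoint \<in> topspace (nsphere d)"
  by (auto simp: nsphere sphere_basepoint_def sum_atMost_split_0)

section \<open>Wedges of spheres\<close>

text \<open>The map q sends body C to the wedge point and each facet onto its own sphere,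
  injectively off the boundary. It is proper, so \<open>homotopy_equivalent_collapse\<close> applies
  with a contraction of body C extended over the whole body. A wedge of no spheres would be the
  empty space, hence the condition on I.\<close>

lemma homotopy_equivalent_wedge:
  fixes C :: "'n::finite set set" and F :: "nat \<Rightarrow> 'n set"
  assumes C: "down_closed C" "AR (body C)"
    and F: "\<And>i. i \<in> I \<Longrightarrow> expandable C (F i) (F i)" and inj: "inj_on F I" and "finite I" "I \<noteq> {}"
    and card: "\<And>i. i \<in> I \<Longrightarrow> card (F i) = Suc (d i)"
  shows "top_of_set (body (C \<union> F ` I)) homotopy_equivalent_space wedge_spheres d I"
proof -
  let ?X = "body (C \<union> F ` I)"
  let ?W = "wedge_spheres d I"
  have X: "?X = body C \<union> (\<Union>i\<in>I. face (F i))"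
    by (auto simp: body_def)
  have "\<exists>e. bij_betw e {..d i} (F i)" if "i \<in> I" for i
    using ex_bij_betw_nat_finite[of "F i"] card[OF that]
    by (simp add: lessThan_Suc_atMost atLeast0LessThan)
  then obtain e where e: "\<And>i. i \<in> I \<Longrightarrow> bij_betw (e i) {..d i} (F i)"
    by metis
  define g where "g i x = simplex_to_sphere (d i) (\<lambda>k. x $ e i k)" for i and x :: "real^'n"
  have coords: "(\<lambda>k. x $ e i k) ` {..d i} = ($) x ` F i" if "i \<in> I" for i and x :: "real^'n"
    using bij_betw_imp_surj_on[OF e[OF that]] by (metis image_image)
  have std: "(\<lambda>k. x $ e i k) \<in> std_simplex (d i)" if i: "i \<in> I" and x: "x \<in> face (F i)" for i x
  proof -
    have "(\<Sum>k\<le>d i. x $ e i k) = (\<Sum>v\<in>F i. x $ v)"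
      by (rule sum.reindex_bij_betw[OF e[OF i]])
    also have "\<dots> = (\<Sum>v\<in>UNIV. x $ v)"
      by (rule sum.mono_neutral_left) (use x in \<open>auto simp: face_def\<close>)
    finally show ?thesis
      using x by (simp add: std_simplex_def face_def)
  qed
  have gcont: "continuous_map (top_of_set (face (F i))) (nsphere (d i)) (g i)" if "i \<in> I" for i
    unfolding g_def
    by (rule continuous_map_simplex_to_sphere) (use std[OF that] in \<open>auto intro!: continuous_intros\<close>)
  \<comment> \<open>The smallest coordinate vanishes exactly on the boundary of the facet, and that
    boundary is exactly the part of the facet inside body C.\<close>
  have gbase: "g i x = sphere_basepoint \<longleftrightarrow> x \<in> body C" if i: "i \<in> I" and x: "x \<in> face (F i)" for i x
  proof -
    have "x \<in> body C \<longleftrightarrow> x \<in> face (F i) \<inter> body C"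
      using x by simp
    also have "\<dots> \<longleftrightarrow> (\<exists>w\<in>F i. x \<in> face (F i - {w}))"
      unfolding face_Int_body[OF C(1) F[OF i]] by (auto simp: body_def)
    also have "\<dots> \<longleftrightarrow> (\<exists>w\<in>F i. x $ w = 0)"
      using x by (auto simp: face_def)
    also have "\<dots> \<longleftrightarrow> Min (($) x ` F i) = 0"
    proof -
      have ne: "F i \<noteq> {}" using F[OF i] by (auto simp: expandable_def)
      have "\<And>w. 0 \<le> x $ w" using x by (simp add: face_def)
      then show ?thesis
        using ne by (subst Min_eq_iff) (auto simp: image_iff)
    qed
    also have "\<dots> \<longleftrightarrow> g i x = sphere_basepoint"
      unfolding g_def simplex_to_sphere_eq_basepoint_iff[OF std[OF i x]] coords[OF i] ..
    finally show ?thesis ..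
  qed
  \<comment> \<open>Distinct facets meet only inside body C: a facet contained in another one would
    be a proper face of it and so already belong to C.\<close>
  have disj: "x \<in> body C" if ij: "i \<in> I" "j \<in> I" "i \<noteq> j" and x: "x \<in> face (F i)" "x \<in> face (F j)" for i j x
  proof -
    have "\<not> F i \<subseteq> F j"
    proof
      assume "F i \<subseteq> F j"
      moreover have "F i \<noteq> F j" using inj ij by (auto dest: inj_onD)
      ultimately obtain w where "w \<in> F j" "F i \<subseteq> F j - {w}" by auto
      then have "F i \<in> C"
        using F[OF ij(2)] down_closedD[OF C(1)] by (auto simp: expandable_def)
      then show False using F[OF ij(1)] by (simp add: expandable_def)
    qed
    then obtain w where w: "w \<in> F i" "w \<notin> F j" by auto
    have "x \<in> face (F i - {w})"
      using x w by (auto simp: face_def)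
    then show ?thesis
      using F[OF ij(1)] w by (auto simp: expandable_def body_def)
  qed
  \<comment> \<open>By \<open>disj\<close> a point off body C lies in just one facet, so the choice
    of i is forced.\<close>
  define q where "q x = (if x \<in> body C then None
      else wedge_point (SOME i. i \<in> I \<and> x \<in> face (F i), g (SOME i. i \<in> I \<and> x \<in> face (F i)) x))" for x
  have qC: "q x = None" if "x \<in> body C" for x
    using that by (simp add: q_def)
  have qF: "q x = wedge_point (i, g i x)" if i: "i \<in> I" and x: "x \<in> face (F i)" for i x
  proof (cases "x \<in> body C")
    case True
    then show ?thesis
      using gbase[OF i x] by (simp add: q_def wedge_point_def)
  next
    case False
    have "(SOME i. i \<in> I \<and> x \<in> face (F i)) = i"
      by (rule some_equality) (use i x disj False in blast)+
    then show ?thesis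
      using False by (simp add: q_def)
  qed
  have q_Some: "q x = Some (i, g i x)" if "i \<in> I" "x \<in> face (F i)" "x \<notin> body C" for i x
    using qF[OF that(1,2)] gbase[OF that(1,2)] that(3) by (simp add: wedge_point_def)
  have q_None_iff: "q x = None \<longleftrightarrow> x \<in> body C" if "x \<in> ?X" for x
    using that qC q_Some unfolding X by (metis UN_iff Un_iff option.distinct(1))
  have topW: "topspace ?W = wedge_point ` (SIGMA i:I. topspace (nsphere (d i)))"
    by (simp add: wedge_spheres_alt o_def)
  have "body C \<noteq> {}" using C(2) by (simp add: AR_ANR)
  obtain i0 where "i0 \<in> I" using \<open>I \<noteq> {}\<close> by blast
  then have None_W: "None \<in> topspace ?W"
    unfolding topW using sphere_basepoint_in_nsphere
    by (force simp: wedge_point_def image_iff)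
  have qX: "q ` ?X = topspace ?W"
  proof (intro equalityI subsetI)
    fix w assume "w \<in> q ` ?X"
    then obtain x where x: "x \<in> ?X" "w = q x" by blast
    show "w \<in> topspace ?W"
    proof (cases "x \<in> body C")
      case True
      then show ?thesis
        using x qC None_W by simp
    next
      case False
      then obtain i where i: "i \<in> I" "x \<in> face (F i)"
        using x X by blast
      then have "g i x \<in> topspace (nsphere (d i))"
        using gcont[OF i(1)] by (auto simp: continuous_map_def)
      then show ?thesis
        using qF[OF i] x i unfolding topW by blast
    qed
  next
    fix w assume "w \<in> topspace ?W"
    then obtain i y where iy: "i \<in> I" "y \<in> topspace (nsphere (d i))" "w = wedge_point (i, y)"
      unfolding topW by blast
    show "w \<in> q ` ?X"
    proof (cases "y = sphere_basepoint")
      case True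
      obtain c where "c \<in> body C" using \<open>body C \<noteq> {}\<close> by blast
      moreover have "w = None" using True iy by (simp add: wedge_point_def)
      ultimately show ?thesis
        using qC X by (metis UnI1 image_eqI)
    next
      case False
      obtain u where u: "u \<in> std_simplex (d i)" "simplex_to_sphere (d i) u = y"
        using simplex_to_sphere_surj[OF iy(2) False] by metis
      define x :: "real^'n" where
        "x = (\<chi> v. if v \<in> F i then u (inv_into {..d i} (e i) v) else 0)"
      have xe: "x $ e i k = u k" if "k \<le> d i" for k
        using that e[OF iy(1)] bij_betw_inv_into_left[OF e[OF iy(1)], of k]
        by (auto simp: x_def bij_betw_def)
      have xF: "(\<Sum>v\<in>F i. x $ v) = 1"
        using u(1) sum.reindex_bij_betw[OF e[OF iy(1)], of "\<lambda>v. x $ v", symmetric] xe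
        by (simp add: std_simplex_def)
      have "x \<in> face (F i)"
      proof -
        have "0 \<le> x $ v" for v
        proof (cases "v \<in> F i")
          case True
          then obtain k where "k \<le> d i" "v = e i k"
            using bij_betw_imp_surj_on[OF e[OF iy(1)]] by blast
          then show ?thesis
            using u(1) xe by (simp add: std_simplex_def)
        qed (simp add: x_def)
        moreover have "(\<Sum>v\<in>UNIV. x $ v) = (\<Sum>v\<in>F i. x $ v)"
          by (rule sum.mono_neutral_right) (auto simp: x_def)
        ultimately show ?thesis
          using xF by (simp add: face_def) (simp add: x_def)
      qed
      moreover have "g i x = y"
      proof -
        have "(\<lambda>k. x $ e i k) ` {..d i} = u ` {..d i}"
          using xe by (intro image_cong) auto
        moreover have "(\<Sum>k=1..d i. (x $ e i k - x $ e i 0)\<^sup>2) = (\<Sum>k=1..d i. (u k - u 0)\<^sup>2)"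
          using xe by (intro sum.cong) auto
        ultimately have "g i x = simplex_to_sphere (d i) u"
          using xe unfolding g_def simplex_to_sphere_def by (auto simp: Let_def fun_eq_iff)
        then show ?thesis using u by simp
      qed
      ultimately have "w = q x" "x \<in> ?X"
        using qF[OF iy(1), of x] iy X by auto
      then show ?thesis by (rule image_eqI)
    qed
  qed
  have cl: "closed (body C)" "\<And>i. closed (face (F i))"
    by (auto intro: compact_imp_closed compact_body compact_face)
  \<comment> \<open>Pasting over a finite closed cover: index \<open>None\<close> stands for body C,
    index \<open>Some i\<close> for the facet i.\<close>
  have qcont: "continuous_map (top_of_set ?X) ?W q"
  proof (rule pasting_lemma_closed[where I = "insert None (Some ` I)"
        and T = "\<lambda>j. case j of None \<Rightarrow> body C | Some i \<Rightarrow> face (F i)" and f = "\<lambda>_. q"])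
    show "closedin (top_of_set ?X) (case j of None \<Rightarrow> body C | Some i \<Rightarrow> face (F i))"
      if "j \<in> insert None (Some ` I)" for j
      using that by (auto intro!: closed_subset cl simp: X)
    show "continuous_map (subtopology (top_of_set ?X) (case j of None \<Rightarrow> body C | Some i \<Rightarrow> face (F i))) ?W q"
      if j: "j \<in> insert None (Some ` I)" for j
    proof (cases j)
      case None
      have "continuous_map (top_of_set (body C)) ?W q"
        by (rule continuous_map_eq[of _ _ "\<lambda>_. None"]) (use None_W qC in auto)
      moreover have "?X \<inter> body C = body C" using X by blast
      ultimately show ?thesis
        using None by (simp add: subtopology_subtopology)
    next
      case (Some i)
      then have i: "i \<in> I" using j by auto
      have "continuous_map (top_of_set (face (F i))) ?W ((\<lambda>y. wedge_point (i, y)) \<circ> g i)"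
        by (rule continuous_map_compose[OF gcont[OF i] continuous_map_wedge_point[OF i, of d]])
      then have "continuous_map (top_of_set (face (F i))) ?W q"
        by (rule continuous_map_eq) (use qF[OF i] in simp)
      moreover have "?X \<inter> face (F i) = face (F i)" using X i by blast
      ultimately show ?thesis
        using Some by (simp add: subtopology_subtopology)
    qed
    show "\<exists>j. j \<in> insert None (Some ` I) \<and> x \<in> (case j of None \<Rightarrow> body C | Some i \<Rightarrow> face (F i)) \<and> q x = q x"
      if "x \<in> topspace (top_of_set ?X)" for x
    proof (cases "x \<in> body C")
      case True
      then show ?thesis by (intro exI[of _ None]) simp
    next
      case False
      then obtain i where "i \<in> I" "x \<in> face (F i)" using \<open>x \<in> topspace (top_of_set ?X)\<close> X by auto
      then show ?thesis by (intro exI[of _ "Some i"]) simp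
    qed
  qed (use \<open>finite I\<close> in auto)
  have q_inj: "x = y \<or> x \<in> body C \<and> y \<in> body C" if x: "x \<in> ?X" and y: "y \<in> ?X" and eq: "q x = q y" for x y
  proof (cases "x \<in> body C")
    case True
    then show ?thesis
      using q_None_iff[OF x] q_None_iff[OF y] eq by simp
  next
    case False
    then have "y \<notin> body C"
      using q_None_iff[OF x] q_None_iff[OF y] eq by simp
    obtain i j where ij: "i \<in> I" "x \<in> face (F i)" "j \<in> I" "y \<in> face (F j)"
      using x y False \<open>y \<notin> body C\<close> unfolding X by blast
    then have "j = i" and gg: "g i x = g i y"
      using q_Some[of i x] q_Some[of j y] False \<open>y \<notin> body C\<close> eq by auto
    have y: "y \<in> face (F i)" using ij \<open>j = i\<close> by simp
    have "x $ v = y $ v" for v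
    proof (cases "v \<in> F i")
      case True
      then obtain k where "k \<le> d i" "v = e i k"
        using bij_betw_imp_surj_on[OF e[OF ij(1)]] by blast
      then show ?thesis
        using simplex_to_sphere_inj[OF std[OF ij(1,2)] std[OF ij(1) y] _ gg[unfolded g_def] \<open>k \<le> d i\<close>]
          gbase[OF ij(1,2)] False by (simp add: g_def)
    next
      case False
      then show ?thesis using ij(2) y by (simp add: face_def)
    qed
    then show ?thesis by (simp add: vec_eq_iff)
  qed
  have "closed_map (top_of_set ?X) ?W q"
    unfolding closed_map_def
  proof (intro allI impI)
    fix K assume "closedin (top_of_set ?X) K"
    then have K: "compact K" "K \<subseteq> ?X"
      using compact_body closedin_compact closedin_imp_subset by blast+
    show "closedin ?W (q ` K)"
      unfolding closedin_wedge_spheres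
    proof (intro conjI ballI)
      show "q ` K \<subseteq> topspace ?W" using K(2) qX by blast
      fix i assume i: "i \<in> I"
      have gi: "g i ` (K \<inter> face (F i)) \<subseteq> topspace (nsphere (d i))"
        using gcont[OF i] by (auto simp: continuous_map_def)
      have "compactin (top_of_set (face (F i))) (K \<inter> face (F i))"
        using K by (simp add: compactin_subtopology compact_Int_closed cl)
      then have 1: "closedin (nsphere (d i)) (g i ` (K \<inter> face (F i)))"
        using gcont[OF i] Hausdorff_nsphere compactin_imp_closedin image_compactin by blast
      have 2: "closedin (nsphere (d i)) {sphere_basepoint}"
        by (simp add: Hausdorff_nsphere closedin_Hausdorff_singleton sphere_basepoint_in_nsphere)
      \<comment> \<open>Only the base point can be contributed by points outside the facet i: it
        belongs to the preimage as soon as K meets body C anywhere.\<close>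
      have "{y \<in> topspace (nsphere (d i)). wedge_point (i, y) \<in> q ` K}
          = g i ` (K \<inter> face (F i)) \<union> (if None \<in> q ` K then {sphere_basepoint} else {})" (is "?L = ?R")
      proof (intro equalityI subsetI)
        fix y assume y: "y \<in> ?L"
        show "y \<in> ?R"
        proof (cases "y = sphere_basepoint")
          case True
          then show ?thesis using y by (auto simp: wedge_point_def)
        next
          case False
          then obtain x where x: "x \<in> K" "q x = Some (i, y)"
            using y by (auto simp: wedge_point_def)
          then have "x \<notin> body C" using qC by auto
          then obtain j where j: "j \<in> I" "x \<in> face (F j)"
            using x K(2) X by blast
          then have "q x = Some (j, g j x)" using q_Some \<open>x \<notin> body C\<close> by blast
          then have "j = i" "y = g i x" using x by auto
          then show ?thesis using x j by blast
        qed
      next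
        fix y assume "y \<in> ?R"
        then consider x where "x \<in> K" "x \<in> face (F i)" "y = g i x" | "None \<in> q ` K" "y = sphere_basepoint"
          by (auto split: if_splits)
        then show "y \<in> ?L"
        proof cases
          case 1
          then have "wedge_point (i, y) = q x" using qF[OF i] by simp
          then show ?thesis using 1 gi by (auto intro: image_eqI[of _ _ x])
        next
          case 2
          then show ?thesis using sphere_basepoint_in_nsphere by (auto simp: wedge_point_def)
        qed
      qed
      then show "closedin (nsphere (d i)) {y \<in> topspace (nsphere (d i)). wedge_point (i, y) \<in> q ` K}"
        using 1 2 by (simp add: closedin_Un)
    qed
  qed
  \<comment> \<open>The fibre over the wedge point is body C; every other fibre has at most one
    point.\<close>
  moreover have "compactin (top_of_set ?X) {x \<in> topspace (top_of_set ?X). q x = w}" for w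
  proof (cases w)
    case None
    have "{x \<in> topspace (top_of_set ?X). q x = w} = body C"
      using q_None_iff X None by auto
    then show ?thesis
      using X by (simp add: compactin_subtopology compact_body)
  next
    case (Some z)
    define S where "S = {x \<in> topspace (top_of_set ?X). q x = w}"
    have "x = y" if "x \<in> S" "y \<in> S" for x y
      using q_inj[of x y] that qC Some by (auto simp: S_def)
    then have "S = {} \<or> (\<exists>x. S = {x})"
      by blast
    then have "finite S"
      by auto
    moreover have "S \<subseteq> ?X"
      by (auto simp: S_def)
    ultimately have "compactin (top_of_set ?X) S"
      by (intro finite_imp_compactin) auto
    then show ?thesis
      by (simp only: S_def)
  qed
  ultimately have "proper_map (top_of_set ?X) ?W q"
    unfolding proper_map_def by blast
  moreover have "closedin (top_of_set ?X) (body C)"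
    by (rule closed_subset) (auto simp: X cl)
  then obtain H a where H: "continuous_on ({0..1::real} \<times> ?X) H" "H \<in> {0..1} \<times> ?X \<rightarrow> ?X"
    "\<And>x. x \<in> ?X \<Longrightarrow> H (0, x) = x" "H ` ({0..1} \<times> body C) \<subseteq> body C" "a \<in> body C"
    "\<And>x. x \<in> body C \<Longrightarrow> H (1, x) = a"
    by (rule contraction_extends) (use C(2) in \<open>auto simp: AR_ANR ANR_body\<close>)
  moreover have "continuous_map (prod_topology (top_of_set {0..1::real}) (top_of_set ?X)) (top_of_set ?X) H"
    using H(1,2) by (simp only: prod_topology_subtopology_eu continuous_map_subtopology_eu)
  ultimately show ?thesis
    using qcont qX qC q_inj by (intro homotopy_equivalent_collapse[where q = q and A = "body C" and H = H and a = a])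
      (auto simp: image_subset_iff)
qed

section \<open>Acyclic matchings\<close>

text \<open>One round of a gradient path, recorded between matching edges: from \<open>snd e\<close>
  down the reversed edge to \<open>fst e\<close>, then up to \<open>snd e'\<close>.\<close>

definition gradient_steps :: "('a set \<times> 'a set) set \<Rightarrow> (('a set \<times> 'a set) \<times> ('a set \<times> 'a set)) set" where
  "gradient_steps W = {(e, e'). e \<in> W \<and> e' \<in> W \<and> e \<noteq> e' \<and> fst e \<subset> snd e' \<and> card (snd e') = Suc (card (fst e))}"

lemma matching_unique:
  assumes "is_matching K W" "e \<in> W" "e' \<in> W" "{fst e, snd e} \<inter> {fst e', snd e'} \<noteq> {}"
  shows "e = e'"
  using assms by (auto simp: is_matching_def)

text \<open>The rank counts predecessors: those of x are predecessors of y, and x itself is one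
  more, since by acyclicity it does not precede itself.\<close>

lemma acyclic_rank:
  assumes "finite r" "acyclic r"
  obtains f :: "'a \<Rightarrow> nat" where "\<And>x y. (x, y) \<in> r \<Longrightarrow> f x < f y"
proof
  fix x y assume xy: "(x, y) \<in> r"
  have "finite (r\<^sup>+)" using assms(1) by simp
  then have "finite (fst ` (r\<^sup>+))" by simp
  then have "finite {z. (z, y) \<in> r\<^sup>+}"
    by (rule rev_finite_subset) force
  moreover have "{z. (z, x) \<in> r\<^sup>+} \<subset> {z. (z, y) \<in> r\<^sup>+}"
    using xy assms(2) by (auto simp: acyclic_def intro: trancl_into_trancl)
  ultimately show "card {z. (z, x) \<in> r\<^sup>+} < card {z. (z, y) \<in> r\<^sup>+}"
    by (rule psubset_card_mono)
qed

text \<open>Each gradient step is a path of two edges in the modified diagram. Its ascending edge is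
  not reversed: as a member of W it would share a cell with both e and e' and make them
  equal.\<close>

lemma acyclic_gradient_steps:
  assumes W: "is_matching K W" and acyc: "acyclic (reversed_hasse K W)"
  shows "acyclic (gradient_steps W)"
proof -
  let ?G = "reversed_hasse K W"
  have step: "(snd e, snd e') \<in> ?G\<^sup>+" if "(e, e') \<in> gradient_steps W" for e e'
  proof -
    have e: "e \<in> W" "e' \<in> W" "e \<noteq> e'" "fst e \<subset> snd e'" "card (snd e') = Suc (card (fst e))"
      using that by (auto simp: gradient_steps_def)
    then have "(fst e, snd e') \<in> hasse_edges K"
      using W by (auto simp: is_matching_def hasse_edges_def)
    moreover have "(fst e, snd e') \<notin> W"
      using matching_unique[OF W, of e "(fst e, snd e')"] matching_unique[OF W, of e' "(fst e, snd e')"] e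
      by auto
    moreover have "(snd e, fst e) \<in> ?G"
      using e(1) by (cases e) (auto simp: reversed_hasse_def)
    ultimately have "(snd e, fst e) \<in> ?G" "(fst e, snd e') \<in> ?G"
      by (auto simp: reversed_hasse_def)
    then show ?thesis
      by (rule trancl_into_trancl[OF r_into_trancl])
  qed
  have "(snd e, snd e') \<in> ?G\<^sup>+" if "(e, e') \<in> (gradient_steps W)\<^sup>+" for e e'
    using that by induction (auto intro: step trancl_trans)
  then show ?thesis
    using acyc unfolding acyclic_def by blast
qed

text \<open>A path of the modified Hasse diagram never descends twice in a row, so it can only return to
  its starting level by following gradient steps: order the cells lexicographically by level,
  then by the rank of their matching edge.\<close>

lemma acyclic_reversed_hasse:
  assumes W: "is_matching K W" and fin: "finite W" and acyc: "acyclic (gradient_steps W)"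
  shows "acyclic (reversed_hasse K W)"
proof -
  have "finite (gradient_steps W)"
    by (rule finite_subset[of _ "W \<times> W"]) (auto simp: gradient_steps_def fin)
  then obtain \<rho> :: "'a set \<times> 'a set \<Rightarrow> nat" where \<rho>: "\<And>e e'. (e, e') \<in> gradient_steps W \<Longrightarrow> \<rho> e < \<rho> e'"
    using acyclic_rank[OF _ acyc] by metis
  define partner where "partner x = (THE e. e \<in> W \<and> x \<in> {fst e, snd e})" for x
  have partner: "partner (fst e) = e" "partner (snd e) = e" if "e \<in> W" for e
    unfolding partner_def using that matching_unique[OF W, of _ e]
    by (auto intro!: the_equality)
  define cells where "cells = fst ` W \<union> snd ` W"
  \<comment> \<open>A matched pair sits at the level of its lower cell. Within a level unmatched
    cells come first, at 0; a pair of rank r puts its upper cell at 2 r + 1 and its lower cell at 2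
    r + 2. So a reversed edge increases the position, and so does the ascent to a pair of larger
    rank.\<close>
  define lev where "lev x = (if x \<in> cells then card (fst (partner x)) else card x)" for x
  define pos where "pos x = (if x \<in> cells then 2 * \<rho> (partner x) + (if x \<in> fst ` W then 2 else 1) else 0)" for x
  have matched: "lev (fst e) = card (fst e)" "pos (fst e) = 2 * \<rho> e + 2"
      "lev (snd e) = card (fst e)" "pos (snd e) = 2 * \<rho> e + 1" if e: "e \<in> W" for e
  proof -
    have "snd e \<notin> fst ` W"
    proof
      assume "snd e \<in> fst ` W"
      then obtain e' where "e' \<in> W" "fst e' = snd e" by (metis imageE)
      then have "e' = e" using matching_unique[OF W, of e' e] e by auto
      then show False using W e \<open>fst e' = snd e\<close> by (auto simp: is_matching_def hasse_edges_def)
    qed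
    then show "lev (fst e) = card (fst e)" "pos (fst e) = 2 * \<rho> e + 2"
      "lev (snd e) = card (fst e)" "pos (snd e) = 2 * \<rho> e + 1"
      using e by (auto simp: lev_def pos_def cells_def partner)
  qed
  have unmatched: "lev x = card x" "pos x = 0" if "x \<notin> cells" for x
    using that by (auto simp: lev_def pos_def)
  have cases: thesis
    if "x \<notin> cells \<Longrightarrow> thesis" "\<And>e. e \<in> W \<Longrightarrow> x = fst e \<Longrightarrow> thesis" "\<And>e. e \<in> W \<Longrightarrow> x = snd e \<Longrightarrow> thesis"
    for x thesis
    using that unfolding cells_def by blast
  have card_W: "card (snd e) = Suc (card (fst e))" if "e \<in> W" for e
    using W that by (auto simp: is_matching_def hasse_edges_def)
  define below where "below x y \<longleftrightarrow> lev x < lev y \<or> lev x = lev y \<and> pos x < pos y" for x y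
  have down: "below (snd e) (fst e)" if "e \<in> W" for e
    using matched[OF that] by (simp add: below_def)
  have up: "below x y" if xy: "(x, y) \<in> hasse_edges K" "(x, y) \<notin> W" for x y
  proof -
    have c: "card y = Suc (card x)" "x \<subset> y" using xy by (auto simp: hasse_edges_def)
    have ly: "lev y = card y \<or> (\<exists>e'\<in>W. y = snd e' \<and> lev y = card x \<and> pos y = 2 * \<rho> e' + 1)"
      by (rule cases[of y]) (use unmatched matched c card_W in auto)
    have lx: "lev x \<le> card x"
      by (rule cases[of x]) (use unmatched matched card_W in auto)
    show ?thesis
    proof (cases "lev y = card y")
      case True
      then show ?thesis using lx c by (simp add: below_def)
    next
      case False
      then obtain e' where e': "e' \<in> W" "y = snd e'" "lev y = card x" "pos y = 2 * \<rho> e' + 1"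
        using ly by blast
      show ?thesis
      proof (rule cases[of x])
        assume "x \<notin> cells"
        then show ?thesis using unmatched e' by (simp add: below_def)
      next
        fix e assume e: "e \<in> W" "x = fst e"
        then have "e \<noteq> e'" using xy(2) e' by auto
        then have "(e, e') \<in> gradient_steps W"
          using e e' c by (auto simp: gradient_steps_def)
        then show ?thesis
          using \<rho>[of e e'] e e' matched[OF e(1)] by (simp add: below_def)
      next
        fix e assume "e \<in> W" "x = snd e"
        then show ?thesis using matched e' card_W by (simp add: below_def)
      qed
    qed
  qed
  have step: "below x y" if "(x, y) \<in> reversed_hasse K W" for x y
    using that up down by (auto simp: reversed_hasse_def)
  have "below x y" if "(x, y) \<in> (reversed_hasse K W)\<^sup>+" for x y
    using that
  proof induction
    case (step y z)
    then show ?case using \<open>\<And>x y. (x, y) \<in> reversed_hasse K W \<Longrightarrow> below x y\<close>[of y z]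
      by (auto simp: below_def)
  qed (rule step)
  then show ?thesis
    by (auto simp: acyclic_def below_def)
qed

text \<open>A single-valued relation on at most four points has at most four pairs, so a cycle
  yields a closed walk of length at most four. Without loops and 2-cycles the points of such a walk
  are distinct.\<close>

lemma acyclic_if_no_short_cycles:
  assumes sub: "r \<subseteq> V \<times> V" and V: "finite V" "card V \<le> 4" and sv: "single_valued r"
    and 1: "\<And>x. (x, x) \<notin> r"
    and 2: "\<And>x y. (x, y) \<in> r \<Longrightarrow> (y, x) \<notin> r"
    and 3: "\<And>x y z. distinct [x, y, z] \<Longrightarrow> (x, y) \<in> r \<Longrightarrow> (y, z) \<in> r \<Longrightarrow> (z, x) \<notin> r"
    and 4: "\<And>x y z w. distinct [x, y, z, w] \<Longrightarrow> (x, y) \<in> r \<Longrightarrow> (y, z) \<in> r \<Longrightarrow> (z, w) \<in> r \<Longrightarrow> (w, x) \<notin> r"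
  shows "acyclic r"
proof -
  have "finite r"
    by (rule finite_subset[OF sub]) (simp add: V)
  have "inj_on fst r"
    using sv by (auto simp: inj_on_def single_valued_def)
  then have "card r = card (fst ` r)" by (simp add: card_image)
  also have "\<dots> \<le> card V" by (rule card_mono) (use sub V in auto)
  finally have card: "card r \<le> 4" using V by simp
  have "(x, x) \<notin> r\<^sup>+" for x
  proof
    assume "(x, x) \<in> r\<^sup>+"
    then obtain n where n: "0 < n" "n \<le> card r" "(x, x) \<in> r ^^ n"
      unfolding trancl_finite_eq_relpow[OF \<open>finite r\<close>] by blast
    then consider "n = 1" | "n = Suc 1" | "n = Suc (Suc 1)" | "n = Suc (Suc (Suc 1))"
      using card by linarith
    then show False
    proof cases
      case 1
      then show False using n assms(5) by simp
    next
      case 2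
      then show False using n assms(6) by auto
    next
      case 3
      then obtain y z where "(x, y) \<in> r" "(y, z) \<in> r" "(z, x) \<in> r" using n by auto
      then show False using assms(5) assms(7)[of x y z] by auto
    next
      case 4
      then obtain y z w where "(x, y) \<in> r" "(y, z) \<in> r" "(z, w) \<in> r" "(w, x) \<in> r" using n by auto
      moreover from this have "x \<noteq> z" "y \<noteq> w" using assms(6) by blast+
      ultimately show False using assms(5) assms(8)[of x y z w] by auto
    qed
  qed
  then show ?thesis by (simp add: acyclic_def)
qed

section \<open>Acyclic matchings on the boundary of the tetrahedron\<close>

text \<open>For a matching this is a partial function on the four vertices. Gradient paths between
  vertex-edge pairs run against its arrows.\<close>

definition vertex_flow :: "(nat set \<times> nat set) set \<Rightarrow> (nat \<times> nat) set" where
  "vertex_flow W = {(a, b). ({a}, {a, b}) \<in> W}"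

text \<open>The dual picture: a triangle is named by the vertex it misses, and an arrow from c to d
  matches triangle c with the edge it shares with triangle d. Here gradient paths run along the
  arrows.\<close>

definition triangle_flow :: "(nat set \<times> nat set) set \<Rightarrow> (nat \<times> nat) set" where
  "triangle_flow W = {(c, d). ({0,1,2,3} - {c, d}, {0,1,2,3} - {c}) \<in> W}"

lemma Diff_pair_cancel: "b \<in> V \<Longrightarrow> b \<noteq> a \<Longrightarrow> V - {a, b} = V - {a, c} \<Longrightarrow> b = c"
  by blast

lemma Diff_singleton_cancel: "c \<in> V \<Longrightarrow> V - {c} = V - {d} \<Longrightarrow> c = d"
  by blast

lemma Diff_pair_psubset: "c \<in> V \<Longrightarrow> c \<noteq> d \<Longrightarrow> V - {c, d} \<subset> V - {d}"
  by blast

lemma Diff_pair_subset_Diff_singleton: "c' \<in> V \<Longrightarrow> V - {c, d} \<subseteq> V - {c'} \<Longrightarrow> c' = c \<or> c' = d"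
  by blast

lemma Diff_psubset_Diff_singletonD:
  "V - {c, d} \<subset> V - {c} \<Longrightarrow> d \<in> V \<and> c \<noteq> d" "V - {c} \<subset> V \<Longrightarrow> c \<in> V"
  by blast+

text \<open>The second form names cells by complements, as \<open>triangle_flow\<close> does: c is
  the vertex outside the triangle, d the further vertex outside the edge.\<close>

lemma hasse_edges_tetrahedron_cases:
  assumes "e \<in> hasse_edges boundary_tetrahedron"
  obtains a b where "a \<in> {0,1,2,3}" "b \<in> {0,1,2,3}" "a \<noteq> b" "e = ({a}, {a, b})"
  | c d where "c \<in> {0,1,2,3}" "d \<in> {0,1,2,3}" "c \<noteq> d" "e = ({0,1,2,3} - {c, d}, {0,1,2,3} - {c})"
proof -
  let ?V = "{0,1,2,3::nat}"
  obtain \<sigma> \<tau> where e: "e = (\<sigma>, \<tau>)" "\<sigma> \<noteq> {}" "\<sigma> \<subset> \<tau>" "\<tau> \<subset> ?V" "card \<tau> = Suc (card \<sigma>)"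
    using assms by (cases e) (auto simp: hasse_edges_def boundary_tetrahedron_def)
  have fin: "finite \<tau>" "finite \<sigma>"
    using e(3,4) by (meson finite.emptyI finite_insert finite_subset psubset_imp_subset)+
  have "card \<tau> < card ?V" by (rule psubset_card_mono) (use e in auto)
  moreover have "card \<sigma> > 0" using e(2) fin by (simp add: card_gt_0_iff)
  ultimately consider "card \<sigma> = 1" | "card \<sigma> = 2" using e(5) by fastforce
  then show thesis
  proof cases
    case 1
    then obtain a where a: "\<sigma> = {a}" by (auto simp: card_1_singleton_iff)
    have "card (\<tau> - {a}) = 1" using e(3,5) fin a by (subst card_Diff_subset) auto
    then obtain b where "\<tau> - {a} = {b}" by (auto simp: card_1_singleton_iff)
    then have "\<tau> = {a, b}" "a \<noteq> b" using e(3) a by auto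
    then show thesis using that(1)[of a b] e a by auto
  next
    case 2
    have "card (?V - \<tau>) = 1" using e fin 2 by (subst card_Diff_subset) auto
    then obtain c where c: "?V - \<tau> = {c}" by (auto simp: card_1_singleton_iff)
    have "card (\<tau> - \<sigma>) = 1" using e fin by (subst card_Diff_subset) auto
    then obtain d where d: "\<tau> - \<sigma> = {d}" by (auto simp: card_1_singleton_iff)
    have "c \<in> ?V" "c \<notin> \<tau>" "d \<in> \<tau>" using c d by blast+
    have \<tau>: "\<tau> = ?V - {c}"
      using double_diff[of \<tau> ?V ?V] c e(4) by (simp add: psubset_eq)
    have "\<sigma> = \<tau> - {d}"
      using double_diff[of \<sigma> \<tau> \<tau>] d e(3) by (simp add: psubset_eq)
    then have "\<sigma> = ?V - {c, d}"
      by (simp only: \<tau> Diff_insert2[of ?V c "{d}"])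
    moreover have "d \<in> ?V" "c \<noteq> d"
      using \<open>d \<in> \<tau>\<close> \<open>c \<notin> \<tau>\<close> subsetD[OF psubset_imp_subset[OF e(4)]] by blast+
    ultimately show thesis using that(2)[of c d] e(1) \<tau> \<open>c \<in> ?V\<close> by simp
  qed
qed

section \<open>The two flows compared with gradient paths\<close>

lemma vertex_flow_subset:
  assumes "W \<subseteq> hasse_edges boundary_tetrahedron" "(a, b) \<in> vertex_flow W"
  shows "a \<in> {0,1,2,3}" "b \<in> {0,1,2,3}" "a \<noteq> b"
  using assms by (auto simp: vertex_flow_def hasse_edges_def boundary_tetrahedron_def)

lemma triangle_flow_subset:
  assumes "W \<subseteq> hasse_edges boundary_tetrahedron" "(c, d) \<in> triangle_flow W"
  shows "c \<in> {0,1,2,3}" "d \<in> {0,1,2,3}" "c \<noteq> d"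
proof -
  let ?V = "{0,1,2,3::nat}"
  have "(?V - {c, d}, ?V - {c}) \<in> hasse_edges boundary_tetrahedron"
    using assms by (simp only: triangle_flow_def mem_Collect_eq prod.case subset_iff)
  then have 1: "?V - {c, d} \<subset> ?V - {c}" and "?V - {c} \<in> boundary_tetrahedron"
    by (simp_all only: hasse_edges_def mem_Collect_eq prod.case)
  then have 2: "?V - {c} \<subset> ?V"
    by (simp only: boundary_tetrahedron_def mem_Collect_eq)
  show "c \<in> ?V"
    by (rule Diff_psubset_Diff_singletonD(2)[OF 2])
  show "d \<in> ?V" "c \<noteq> d"
    by (rule conjunct1[OF Diff_psubset_Diff_singletonD(1)[OF 1]],
        rule conjunct2[OF Diff_psubset_Diff_singletonD(1)[OF 1]])
qed

lemma single_valued_vertex_flow: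
  assumes "is_matching boundary_tetrahedron W"
  shows "single_valued (vertex_flow W)"
proof (rule single_valuedI)
  fix a b c assume ab: "(a, b) \<in> vertex_flow W" "(a, c) \<in> vertex_flow W"
  then have "({a}, {a, b}) = ({a}, {a, c})"
    by (intro matching_unique[OF assms]) (auto simp: vertex_flow_def)
  then show "b = c" by (auto simp: doubleton_eq_iff)
qed

lemma single_valued_triangle_flow:
  assumes "is_matching boundary_tetrahedron W"
  shows "single_valued (triangle_flow W)"
proof (rule single_valuedI)
  let ?V = "{0,1,2,3::nat}"
  fix a b c assume ab: "(a, b) \<in> triangle_flow W" "(a, c) \<in> triangle_flow W"
  then have "(?V - {a, b}, ?V - {a}) = (?V - {a, c}, ?V - {a})"
    by (intro matching_unique[OF assms]) (auto simp: triangle_flow_def)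
  moreover have "W \<subseteq> hasse_edges boundary_tetrahedron"
    using assms by (simp add: is_matching_def)
  ultimately show "b = c"
    using triangle_flow_subset[OF _ ab(1)] by (intro Diff_pair_cancel[of b ?V a c]) auto
qed

lemma vertex_flow_step:
  assumes "W \<subseteq> hasse_edges boundary_tetrahedron" "(c, a) \<in> vertex_flow W" "(a, b) \<in> vertex_flow W"
  shows "(({a}, {a, b}), ({c}, {c, a})) \<in> gradient_steps W"
proof -
  have "c \<noteq> a" by (rule vertex_flow_subset(3)[OF assms(1,2)])
  then show ?thesis
    using assms(2,3) by (auto simp: gradient_steps_def vertex_flow_def)
qed

lemma card_tetrahedron_Diff:
  assumes "c \<in> {0,1,2,3::nat}" "d \<in> {0,1,2,3}" "c \<noteq> d"
  shows "card ({0,1,2,3} - {c, d}) = 2" "card ({0,1,2,3} - {c}) = 3"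
proof -
  let ?V = "{0,1,2,3::nat}"
  have "card (?V - {c, d}) = card ?V - card {c, d}" "card (?V - {c}) = card ?V - card {c}"
    using assms by (intro card_Diff_subset; simp)+
  then show "card (?V - {c, d}) = 2" "card (?V - {c}) = 3"
    using assms(3) by simp_all
qed

lemma triangle_flow_step:
  assumes "W \<subseteq> hasse_edges boundary_tetrahedron" "(c, d) \<in> triangle_flow W" "(d, b) \<in> triangle_flow W"
  shows "(({0,1,2,3} - {c, d}, {0,1,2,3} - {c}), ({0,1,2,3} - {d, b}, {0,1,2,3} - {d})) \<in> gradient_steps W"
proof -
  let ?V = "{0,1,2,3::nat}"
  have cd: "c \<in> ?V" "d \<in> ?V" "c \<noteq> d" and db: "b \<in> ?V" "d \<noteq> b"
    using triangle_flow_subset[OF assms(1,2)] triangle_flow_subset[OF assms(1,3)] by blast+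
  have "?V - {c} \<noteq> ?V - {d}" "?V - {c, d} \<subset> ?V - {d}"
    using Diff_singleton_cancel[OF cd(1)] cd(3) Diff_pair_psubset[OF cd(1,3)] by metis+
  then show ?thesis
    using assms(2,3) card_tetrahedron_Diff(1)[OF cd] card_tetrahedron_Diff(2)[OF cd(2) db]
    unfolding gradient_steps_def triangle_flow_def mem_Collect_eq prod.case fst_conv snd_conv
    by (simp only: prod.inject simp_thms)
qed

text \<open>A cycle of the flow lifts to a closed gradient path. The lift does close up because the
  flow is single-valued: x has only one matching edge at which it can start and end.\<close>

lemma acyclic_vertex_flow:
  assumes W: "is_matching boundary_tetrahedron W" and acyc: "acyclic (gradient_steps W)"
  shows "acyclic (vertex_flow W)"
proof -
  have sub: "W \<subseteq> hasse_edges boundary_tetrahedron" using W by (simp add: is_matching_def)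
  \<comment> \<open>As gradient paths reverse the arrows, the lift of a walk from x to y starts at
    the matching edge of y and arrives at that of x.\<close>
  have *: "\<exists>b'. (x, b') \<in> vertex_flow W \<and> (({y}, {y, b}), ({x}, {x, b'})) \<in> (gradient_steps W)\<^sup>+"
    if "(x, y) \<in> (vertex_flow W)\<^sup>+" "(y, b) \<in> vertex_flow W" for x y b
    using that
  proof (induction arbitrary: b)
    case (base y)
    then show ?case using vertex_flow_step[OF sub] by blast
  next
    case (step y z)
    then show ?case using vertex_flow_step[OF sub, of y z b] by (meson trancl_into_trancl2)
  qed
  have "(x, x) \<notin> (vertex_flow W)\<^sup>+" for x
  proof
    assume x: "(x, x) \<in> (vertex_flow W)\<^sup>+"
    then obtain b where b: "(x, b) \<in> vertex_flow W" by (meson tranclD)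
    obtain b' where "(x, b') \<in> vertex_flow W" "(({x}, {x, b}), ({x}, {x, b'})) \<in> (gradient_steps W)\<^sup>+"
      using *[OF x b] by blast
    moreover from this have "b = b'"
      using b single_valued_vertex_flow[OF W] by (auto dest: single_valuedD)
    ultimately show False using acyc by (auto simp: acyclic_def)
  qed
  then show ?thesis by (simp add: acyclic_def)
qed

lemma acyclic_triangle_flow:
  assumes W: "is_matching boundary_tetrahedron W" and acyc: "acyclic (gradient_steps W)"
  shows "acyclic (triangle_flow W)"
proof -
  let ?e = "\<lambda>x y. ({0,1,2,3::nat} - {x, y}, {0,1,2,3} - {x})"
  have sub: "W \<subseteq> hasse_edges boundary_tetrahedron" using W by (simp add: is_matching_def)
  have *: "\<exists>b'. (x, b') \<in> triangle_flow W \<and> (?e x b', ?e y b) \<in> (gradient_steps W)\<^sup>+"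
    if "(x, y) \<in> (triangle_flow W)\<^sup>+" "(y, b) \<in> triangle_flow W" for x y b
    using that
  proof (induction arbitrary: b)
    case (base y)
    then show ?case using triangle_flow_step[OF sub] by blast
  next
    case (step y z)
    then show ?case using triangle_flow_step[OF sub, of y z b] by (meson trancl_into_trancl)
  qed
  have "(x, x) \<notin> (triangle_flow W)\<^sup>+" for x
  proof
    assume x: "(x, x) \<in> (triangle_flow W)\<^sup>+"
    then obtain b where b: "(x, b) \<in> triangle_flow W" by (meson tranclD)
    obtain b' where "(x, b') \<in> triangle_flow W" "(?e x b', ?e x b) \<in> (gradient_steps W)\<^sup>+"
      using *[OF x b] by blast
    moreover from this have "b = b'"
      using b single_valued_triangle_flow[OF W] by (auto dest: single_valuedD)
    ultimately show False using acyc unfolding acyclic_def by blast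
  qed
  then show ?thesis by (simp add: acyclic_def)
qed

lemma finite_vertex_flow:
  assumes "W \<subseteq> hasse_edges boundary_tetrahedron"
  shows "finite (vertex_flow W)"
proof (rule finite_subset)
  show "vertex_flow W \<subseteq> {0,1,2,3} \<times> {0,1,2,3}"
    by (intro subrelI SigmaI) (fact vertex_flow_subset(1,2)[OF assms])+
qed simp

lemma finite_triangle_flow:
  assumes "W \<subseteq> hasse_edges boundary_tetrahedron"
  shows "finite (triangle_flow W)"
proof (rule finite_subset)
  show "triangle_flow W \<subseteq> {0,1,2,3} \<times> {0,1,2,3}"
    by (intro subrelI SigmaI) (fact triangle_flow_subset(1,2)[OF assms])+
qed simp

lemma acyclic_if_increasing:
  fixes f :: "'a \<Rightarrow> nat"
  assumes "\<And>x y. (x, y) \<in> r \<Longrightarrow> f x < f y"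
  shows "acyclic r"
proof -
  have "f x < f y" if "(x, y) \<in> r\<^sup>+" for x y
    using that by induction (auto intro: assms less_trans)
  then show ?thesis unfolding acyclic_def by blast
qed

text \<open>A gradient step never changes dimension: it joins two vertex-edge pairs or two
  edge-triangle pairs. So ranks for the two flows combine into one function h that increases along
  every step.\<close>

lemma acyclic_gradient_steps_tetrahedron:
  assumes W: "is_matching boundary_tetrahedron W"
    and v: "acyclic (vertex_flow W)" and t: "acyclic (triangle_flow W)"
  shows "acyclic (gradient_steps W)"
proof -
  let ?V = "{0,1,2,3::nat}"
  have sub: "W \<subseteq> hasse_edges boundary_tetrahedron" using W by (simp add: is_matching_def)
  \<comment> \<open>The rank belongs to the converse of the vertex flow, since gradient steps
    reverse its arrows.\<close>
  obtain f :: "nat \<Rightarrow> nat" where f: "\<And>x y. (x, y) \<in> (vertex_flow W)\<inverse> \<Longrightarrow> f x < f y"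
    using acyclic_rank[of "(vertex_flow W)\<inverse>"] finite_vertex_flow[OF sub] v by auto
  obtain g :: "nat \<Rightarrow> nat" where g: "\<And>x y. (x, y) \<in> triangle_flow W \<Longrightarrow> g x < g y"
    using acyclic_rank[of "triangle_flow W"] finite_triangle_flow[OF sub] t by auto
  define h where "h e = (if card (fst e) = 1 then f (the_elem (fst e)) else g (the_elem (?V - snd e)))" for e
  have hv: "h ({a}, {a, b}) = f a" for a b by (simp add: h_def)
  have ht: "h (?V - {c, d}, ?V - {c}) = g c" if "c \<in> ?V" "d \<in> ?V" "c \<noteq> d" for c d
  proof -
    have "?V - (?V - {c}) = {c}" using that(1) by (simp add: double_diff Diff_Diff_Int)
    then show ?thesis using card_tetrahedron_Diff[OF that] by (simp add: h_def)
  qed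
  show ?thesis
  proof (rule acyclic_if_increasing[of _ h])
    fix e e' assume ee: "(e, e') \<in> gradient_steps W"
    then have W2: "e \<in> W" "e' \<in> W" "e \<noteq> e'" "fst e \<subset> snd e'" "card (snd e') = Suc (card (fst e))"
      by (auto simp: gradient_steps_def)
    have neq: "fst e \<noteq> fst e'" "snd e \<noteq> snd e'"
      using W2(3) matching_unique[OF W W2(1,2)] by blast+
    show "h e < h e'"
      using subsetD[OF sub W2(1)]
    proof (cases rule: hasse_edges_tetrahedron_cases)
      case (1 a b)
      show ?thesis
        using subsetD[OF sub W2(2)]
      proof (cases rule: hasse_edges_tetrahedron_cases)
        case e': (1 c d)
        have "{a} \<subseteq> {c, d}" "c \<noteq> a"
          using psubset_imp_subset[OF W2(4)] neq(1) unfolding 1(4) e'(4) by auto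
        then have "a = d" by simp
        then have "(c, a) \<in> vertex_flow W"
          using W2(2) e'(4) by (simp add: vertex_flow_def)
        then show ?thesis using f[of a c] unfolding 1(4) e'(4) hv by simp
      next
        case (2 c d)
        then show ?thesis
          using W2(5) card_tetrahedron_Diff(2)[OF 2(1-3)] unfolding 1(4) 2(4) by simp
      qed
    next
      case (2 c d)
      show ?thesis
        using subsetD[OF sub W2(2)]
      proof (cases rule: hasse_edges_tetrahedron_cases)
        case (1 a b)
        have "card {a, b} \<le> 2" by (simp add: card_insert_if)
        then show ?thesis
          using W2(5) card_tetrahedron_Diff(1)[OF 2(1-3)] unfolding 1(4) 2(4) by simp
      next
        case e': (2 c' d')
        have "c' \<noteq> c"
          using neq(2) unfolding e'(4) 2(4) snd_conv by metis
        moreover have "?V - {c, d} \<subseteq> ?V - {c'}"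
          using psubset_imp_subset[OF W2(4)] unfolding e'(4) 2(4) fst_conv snd_conv .
        ultimately have "c' = d"
          using Diff_pair_subset_Diff_singleton[OF e'(1)] by blast
        then have "(c, c') \<in> triangle_flow W"
          using W2(1) unfolding 2(4) triangle_flow_def by (simp only: mem_Collect_eq prod.case)
        then show ?thesis
          unfolding 2(4) e'(4) ht[OF 2(1-3)] ht[OF e'(1-3)] by (rule g)
      qed
    qed
  qed
qed

text \<open>Lengths 1 and 2 are absent because the flows of a matching have no such cycles: a
  2-cycle would match one tetrahedron edge twice.\<close>

definition short_cycle :: "(nat \<times> nat) set \<Rightarrow> bool" where
  "short_cycle r \<longleftrightarrow>
     (\<exists>x y z. distinct [x, y, z] \<and> {(x, y), (y, z), (z, x)} \<subseteq> r) \<or>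
     (\<exists>x y z w. distinct [x, y, z, w] \<and> {(x, y), (y, z), (z, w), (w, x)} \<subseteq> r)"

lemma acyclic_imp_not_short_cycle: "acyclic r \<Longrightarrow> \<not> short_cycle r"
  unfolding acyclic_def short_cycle_def by (meson insert_subset r_into_trancl trancl_into_trancl)

lemma acyclic_matching_tetrahedron_iff:
  "acyclic_matching boundary_tetrahedron W \<longleftrightarrow> is_matching boundary_tetrahedron W \<and>
     \<not> short_cycle (vertex_flow W) \<and> \<not> short_cycle (triangle_flow W)"
proof (cases "is_matching boundary_tetrahedron W")
  case W: True
  let ?V = "{0,1,2,3::nat}"
  have sub: "W \<subseteq> hasse_edges boundary_tetrahedron" using W by (simp add: is_matching_def)
  have "finite (hasse_edges boundary_tetrahedron)"
    by (rule finite_subset[of _ "Pow ?V \<times> Pow ?V"]) (auto simp: hasse_edges_def boundary_tetrahedron_def)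
  then have fin: "finite W" using sub by (rule rev_finite_subset)
  have v: "acyclic (vertex_flow W)" if not_short: "\<not> short_cycle (vertex_flow W)"
  proof (rule acyclic_if_no_short_cycles[of _ ?V])
    show "(y, x) \<notin> vertex_flow W" if "(x, y) \<in> vertex_flow W" for x y
    proof
      assume "(y, x) \<in> vertex_flow W"
      then have "({x}, {x, y}) = ({y}, {y, x})"
        using that by (intro matching_unique[OF W]) (auto simp: vertex_flow_def)
      then show False using vertex_flow_subset[OF sub that] by simp
    qed
    show "vertex_flow W \<subseteq> ?V \<times> ?V"
      by (intro subrelI SigmaI) (fact vertex_flow_subset(1,2)[OF sub])+
    show "(x, x) \<notin> vertex_flow W" for x
      using vertex_flow_subset(3)[OF sub, of x x] by auto
    show "(z, x) \<notin> vertex_flow W"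
      if "distinct [x, y, z]" "(x, y) \<in> vertex_flow W" "(y, z) \<in> vertex_flow W" for x y z
      using not_short that unfolding short_cycle_def insert_subset by blast
    show "(w, x) \<notin> vertex_flow W"
      if "distinct [x, y, z, w]" "(x, y) \<in> vertex_flow W" "(y, z) \<in> vertex_flow W" "(z, w) \<in> vertex_flow W" for x y z w
      using not_short that unfolding short_cycle_def insert_subset by blast
  qed (simp_all add: single_valued_vertex_flow[OF W])
  have t: "acyclic (triangle_flow W)" if not_short: "\<not> short_cycle (triangle_flow W)"
  proof (rule acyclic_if_no_short_cycles[of _ ?V])
    show "(y, x) \<notin> triangle_flow W" if "(x, y) \<in> triangle_flow W" for x y
    proof
      assume "(y, x) \<in> triangle_flow W"
      then have "(?V - {x, y}, ?V - {x}) = (?V - {y, x}, ?V - {y})"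
        using that by (intro matching_unique[OF W]) (auto simp: triangle_flow_def insert_commute)
      then show False
        using triangle_flow_subset[OF sub that] Diff_singleton_cancel[of x ?V y] by blast
    qed
    show "triangle_flow W \<subseteq> ?V \<times> ?V"
      by (intro subrelI SigmaI) (fact triangle_flow_subset(1,2)[OF sub])+
    show "(x, x) \<notin> triangle_flow W" for x
      using triangle_flow_subset(3)[OF sub, of x x] by auto
    show "(z, x) \<notin> triangle_flow W"
      if "distinct [x, y, z]" "(x, y) \<in> triangle_flow W" "(y, z) \<in> triangle_flow W" for x y z
      using not_short that unfolding short_cycle_def insert_subset by blast
    show "(w, x) \<notin> triangle_flow W"
      if "distinct [x, y, z, w]" "(x, y) \<in> triangle_flow W" "(y, z) \<in> triangle_flow W" "(z, w) \<in> triangle_flow W" for x y z w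
      using not_short that unfolding short_cycle_def insert_subset by blast
  qed (simp_all add: single_valued_triangle_flow[OF W])
  have "acyclic (reversed_hasse boundary_tetrahedron W) \<longleftrightarrow> acyclic (gradient_steps W)"
    using acyclic_gradient_steps[OF W] acyclic_reversed_hasse[OF W fin] by blast
  also have "\<dots> \<longleftrightarrow> acyclic (vertex_flow W) \<and> acyclic (triangle_flow W)"
    using acyclic_gradient_steps_tetrahedron[OF W] acyclic_vertex_flow[OF W] acyclic_triangle_flow[OF W] by blast
  also have "\<dots> \<longleftrightarrow> \<not> short_cycle (vertex_flow W) \<and> \<not> short_cycle (triangle_flow W)"
    using v t acyclic_imp_not_short_cycle by blast
  finally show ?thesis using W by (simp add: acyclic_matching_def)
qed (simp add: acyclic_matching_def)

section \<open>Complexes as tries\<close>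

text \<open>A simplex is a word with one digit for each edge of the tetrahedron, \<open>Z\<close> marking an edge that does
  not occur. In a word that describes an interval of simplices, \<open>E, F, G, H\<close> stand for an optional
  \<open>A, B, C, D\<close>.\<close>

datatype digit = Z | A | B | C | D | E | F | G | H

text \<open>The subtries of a node belong to the letters Z, A, B, C, D, in this order.\<close>

datatype complex_trie = Empty | Leaf
  | Node complex_trie complex_trie complex_trie complex_trie complex_trie

primrec lower :: "digit \<Rightarrow> digit" where
  "lower Z = Z" | "lower A = A" | "lower B = B" | "lower C = C" | "lower D = D"
| "lower E = Z" | "lower F = Z" | "lower G = Z" | "lower H = Z"

primrec upper :: "digit \<Rightarrow> digit" where
  "upper Z = Z" | "upper A = A" | "upper B = B" | "upper C = C" | "upper D = D"
| "upper E = A" | "upper F = B" | "upper G = C" | "upper H = D"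

text \<open>An optional letter reads the subtrie of the letter it may take, so following a word
  through a trie follows the upper end of its interval.\<close>

primrec select :: "digit \<Rightarrow> 'a \<Rightarrow> 'a \<Rightarrow> 'a \<Rightarrow> 'a \<Rightarrow> 'a \<Rightarrow> 'a" where
  "select Z a b c d e = a" | "select A a b c d e = b" | "select B a b c d e = c"
| "select C a b c d e = d" | "select D a b c d e = e" | "select E a b c d e = b"
| "select F a b c d e = c" | "select G a b c d e = d" | "select H a b c d e = e"

primrec modify :: "digit \<Rightarrow> (complex_trie \<Rightarrow> complex_trie) \<Rightarrow> complex_trie \<Rightarrow> complex_trie \<Rightarrow>
    complex_trie \<Rightarrow> complex_trie \<Rightarrow> complex_trie \<Rightarrow> complex_trie" where
  "modify Z f a b c d e = Node (f a) b c d e"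
| "modify A f a b c d e = Node a (f b) c d e"
| "modify B f a b c d e = Node a b (f c) d e"
| "modify C f a b c d e = Node a b c (f d) e"
| "modify D f a b c d e = Node a b c d (f e)"
| "modify E f a b c d e = Node (f a) (f b) c d e"
| "modify F f a b c d e = Node (f a) b (f c) d e"
| "modify G f a b c d e = Node (f a) b c (f d) e"
| "modify H f a b c d e = Node (f a) b c d (f e)"

primrec child :: "digit \<Rightarrow> complex_trie \<Rightarrow> complex_trie" where
  "child x Empty = Empty" | "child x Leaf = Empty"
| "child x (Node a b c d e) = select x a b c d e"

primrec letter :: "digit \<Rightarrow> bool" where
  "letter Z = True" | "letter A = True" | "letter B = True" | "letter C = True" | "letter D = True"
| "letter E = False" | "letter F = False" | "letter G = False" | "letter H = False"

primrec mem :: "digit list \<Rightarrow> complex_trie \<Rightarrow> bool" where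
  "mem [] t = (case t of Leaf \<Rightarrow> True | _ \<Rightarrow> False)"
| "mem (d # w) t = mem w (child d t)"

text \<open>While descending along the upper end \<tau> of the interval, this looks up, at every
  obligatory letter, the word with that letter erased. These are the simplices \<tau> - {w}, with w
  in the lower end, that \<open>expandable\<close> asks for.\<close>

primrec faces_mem :: "digit list \<Rightarrow> complex_trie \<Rightarrow> bool" where
  "faces_mem [] t = True"
| "faces_mem (d # w) t =
    ((if lower d = Z then True else mem w (child Z t)) \<and> faces_mem w (child d t))"

primrec add :: "digit list \<Rightarrow> complex_trie \<Rightarrow> complex_trie" where
  "add [] t = Leaf"
| "add (d # w) t = (case t of Node u v x y z \<Rightarrow> modify d (add w) u v x y z
    | _ \<Rightarrow> modify d (add w) Empty Empty Empty Empty Empty)"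

primrec well_shaped :: "nat \<Rightarrow> complex_trie \<Rightarrow> bool" where
  "well_shaped 0 t \<longleftrightarrow> (\<forall>u v x y z. t \<noteq> Node u v x y z)"
| "well_shaped (Suc n) t \<longleftrightarrow> t \<noteq> Leaf \<and> (\<forall>d. well_shaped n (child d t))"

definition simplex_of :: "'e list \<Rightarrow> digit list \<Rightarrow> ('e \<times> digit) set" where
  "simplex_of es w = {(es ! i, w ! i) | i. i < length es \<and> w ! i \<noteq> Z}"

definition words :: "'e list \<Rightarrow> digit list set" where
  "words es = {w. length w = length es \<and> (\<forall>d\<in>set w. letter d)}"

definition complex_of :: "'e list \<Rightarrow> complex_trie \<Rightarrow> ('e \<times> digit) set set" where
  "complex_of es t = simplex_of es ` {w \<in> words es. mem w t}"

section \<open>Trie operations\<close>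

lemma letter_lower_upper [simp]: "letter (lower d)" "letter (upper d)"
  by (cases d; simp)+

lemma lower_upper_letter: "letter d \<Longrightarrow> lower d = d \<and> upper d = d"
  by (cases d; simp)

lemma lower_eq: "lower d \<noteq> Z \<Longrightarrow> lower d = d \<and> upper d = d"
  by (cases d; simp)

lemma lower_Z_or_upper: "lower d = Z \<or> lower d = upper d"
  by (cases d; simp)

lemma child_upper [simp]: "child (upper d) t = child d t"
  by (cases t; cases d; simp)

lemma mem_map_upper: "mem (map upper w) t = mem w t"
  by (induction w arbitrary: t) auto

lemma faces_memD:
  "faces_mem w t \<Longrightarrow> i < length w \<Longrightarrow> lower (w ! i) \<noteq> Z \<Longrightarrow> mem (w[i := Z]) t"
proof (induction w arbitrary: t i)
  case (Cons d w)
  then show ?case by (cases i) (auto split: if_splits)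
qed simp

lemma mem_Empty [simp]: "\<not> mem w Empty"
  by (induction w) auto

lemma well_shaped_Empty [simp]: "well_shaped n Empty"
  by (induction n) auto

lemma child_modify:
  "letter x \<Longrightarrow> child x (modify d f a b c e g) =
    (if x = lower d \<or> x = upper d then f (select x a b c e g) else select x a b c e g)"
  by (cases d; cases x; simp)

lemma add_Cons:
  assumes "t \<noteq> Leaf" "letter x"
  shows "child x (add (d # w) t) = (if x = lower d \<or> x = upper d then add w (child x t) else child x t)"
proof (cases t)
  case Empty
  have "select x Empty Empty Empty Empty Empty = Empty" by (cases x) auto
  then show ?thesis using Empty assms by (simp add: child_modify)
next
  case (Node a b c e g)
  then show ?thesis using assms by (simp add: child_modify)
qed (use assms in simp)

lemma add_not_Leaf: "add (d # w) t \<noteq> Leaf"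
  by (cases d; cases t) auto

declare add.simps(2) [simp del]

lemma well_shaped_Suc_letters:
  "well_shaped (Suc n) t \<longleftrightarrow> t \<noteq> Leaf \<and> (\<forall>d. letter d \<longrightarrow> well_shaped n (child d t))"
  by simp (metis child_upper letter_lower_upper(2))

lemma well_shaped_add: "well_shaped (length w) t \<Longrightarrow> well_shaped (length w) (add w t)"
proof (induction w arbitrary: t)
  case (Cons d w)
  then show ?case
    using add_not_Leaf[of d w t]
    unfolding list.size(4) add_0_right add_Suc_right well_shaped_Suc_letters by (auto simp: add_Cons)
qed simp

lemma mem_add:
  "well_shaped (length w) t \<Longrightarrow> length u = length w \<Longrightarrow> \<forall>d\<in>set u. letter d \<Longrightarrow>
    mem u (add w t) \<longleftrightarrow> mem u t \<or> list_all2 (\<lambda>x d. x = lower d \<or> x = upper d) u w"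
proof (induction w arbitrary: t u)
  case (Cons d w)
  then obtain x u' where "u = x # u'" by (cases u) auto
  with Cons show ?case by (auto simp: add_Cons)
qed (simp split: complex_trie.splits)

section \<open>Words as simplices, words with optional letters as intervals\<close>

context
  fixes es :: "'e list"
  assumes dist: "distinct es"
begin

lemma nth_in_simplex_of:
  "i < length es \<Longrightarrow> (es ! i, d) \<in> simplex_of es w \<longleftrightarrow> d = w ! i \<and> d \<noteq> Z"
  using dist by (auto simp: simplex_of_def nth_eq_iff_index_eq)

lemma in_simplex_ofE:
  assumes "p \<in> simplex_of es w"
  obtains i where "i < length es" "p = (es ! i, w ! i)" "w ! i \<noteq> Z"
  using assms by (auto simp: simplex_of_def)

lemma simplex_of_subset_iff:
  "simplex_of es u \<subseteq> simplex_of es w \<longleftrightarrow> (\<forall>i<length es. u ! i = Z \<or> u ! i = w ! i)"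
proof
  assume "simplex_of es u \<subseteq> simplex_of es w"
  then show "\<forall>i<length es. u ! i = Z \<or> u ! i = w ! i"
    using nth_in_simplex_of[of _ _ u] nth_in_simplex_of[of _ _ w] by blast
next
  assume r: "\<forall>i<length es. u ! i = Z \<or> u ! i = w ! i"
  show "simplex_of es u \<subseteq> simplex_of es w"
  proof
    fix p assume "p \<in> simplex_of es u"
    then obtain i where i: "i < length es" "p = (es ! i, u ! i)" "u ! i \<noteq> Z"
      by (rule in_simplex_ofE)
    then show "p \<in> simplex_of es w"
      using r by (auto simp: nth_in_simplex_of)
  qed
qed

lemma simplex_of_inject:
  assumes "simplex_of es u = simplex_of es w" "length u = length es" "length w = length es"
  shows "u = w"
proof (rule nth_equalityI)
  fix i assume "i < length u"
  then have "i < length es" using assms(2) by simp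
  then show "u ! i = w ! i"
    using simplex_of_subset_iff[of u w] simplex_of_subset_iff[of w u] assms(1) by auto metis
qed (use assms in simp)

lemma simplex_of_in_complex_of:
  "w \<in> words es \<Longrightarrow> simplex_of es w \<in> complex_of es t \<longleftrightarrow> mem w t"
  unfolding complex_of_def words_def by (auto dest: simplex_of_inject)

lemma subset_simplex_ofE:
  assumes "\<rho> \<subseteq> simplex_of es w" "w \<in> words es"
  obtains u where "u \<in> words es" "simplex_of es u = \<rho>"
proof
  define u where "u = map (\<lambda>i. if (es ! i, w ! i) \<in> \<rho> then w ! i else Z) [0..<length es]"
  have nth: "u ! i = (if (es ! i, w ! i) \<in> \<rho> then w ! i else Z)" if "i < length es" for i
    using that by (simp add: u_def)
  show "u \<in> words es"
    using assms(2) by (auto simp: words_def u_def)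
  show "simplex_of es u = \<rho>"
  proof (intro equalityI subsetI)
    fix p assume "p \<in> simplex_of es u"
    then show "p \<in> \<rho>" by (elim in_simplex_ofE) (auto simp: nth split: if_splits)
  next
    fix p assume p: "p \<in> \<rho>"
    then have "p \<in> simplex_of es w" using assms(1) by blast
    then obtain i where i: "i < length es" "p = (es ! i, w ! i)" "w ! i \<noteq> Z"
      by (rule in_simplex_ofE)
    then show "p \<in> simplex_of es u"
      using p nth[OF i(1)] by (simp add: nth_in_simplex_of)
  qed
qed

lemma words_map_lower_upper: "length w = length es \<Longrightarrow> map lower w \<in> words es \<and> map upper w \<in> words es"
  by (auto simp: words_def)

text \<open>A lower digit is either Z or equal to the upper digit, so lying between the two leaves
  no third choice at any place.\<close>

lemma between_iff:
  assumes "length w = length es" "u \<in> words es"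
  shows "list_all2 (\<lambda>x d. x = lower d \<or> x = upper d) u w \<longleftrightarrow>
    simplex_of es u \<in> {simplex_of es (map lower w)..simplex_of es (map upper w)}"
proof -
  have "x = lower d \<or> x = upper d \<longleftrightarrow> (lower d = Z \<or> lower d = x) \<and> (x = Z \<or> x = upper d)" for x d
    by (cases d) auto
  then show ?thesis
    using assms by (auto simp: list_all2_conv_all_nth simplex_of_subset_iff words_def)
qed

text \<open>The interval is taken among all sets of pairs, not only among coded ones; this makes no
  difference, because every subset of a coded simplex is coded, by overwriting letters with
  Z.\<close>

lemma complex_of_add:
  assumes "well_shaped (length es) t" "length w = length es"
  shows "complex_of es (add w t) =
    complex_of es t \<union> {simplex_of es (map lower w)..simplex_of es (map upper w)}"
proof -
  have *: "mem u (add w t) \<longleftrightarrow> mem u t \<or>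
      simplex_of es u \<in> {simplex_of es (map lower w)..simplex_of es (map upper w)}" if "u \<in> words es" for u
    using mem_add[of w t u] between_iff[OF assms(2) that] that assms by (simp add: words_def)
  show ?thesis
  proof (intro equalityI subsetI)
    fix \<rho> assume "\<rho> \<in> complex_of es (add w t)"
    then obtain u where "u \<in> words es" "mem u (add w t)" "\<rho> = simplex_of es u"
      by (auto simp: complex_of_def)
    then show "\<rho> \<in> complex_of es t \<union> {simplex_of es (map lower w)..simplex_of es (map upper w)}"
      using * by (auto simp: complex_of_def)
  next
    fix \<rho> assume r: "\<rho> \<in> complex_of es t \<union> {simplex_of es (map lower w)..simplex_of es (map upper w)}"
    obtain u where u: "u \<in> words es" "simplex_of es u = \<rho>"
    proof (cases "\<rho> \<in> complex_of es t")
      case True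
      then show ?thesis using that by (auto simp: complex_of_def)
    next
      case False
      then have "\<rho> \<subseteq> simplex_of es (map upper w)" using r by simp
      then show ?thesis
        using subset_simplex_ofE[OF _ conjunct2[OF words_map_lower_upper[OF assms(2)]]] that by metis
    qed
    then have "mem u (add w t)"
      using r *[OF u(1)] simplex_of_in_complex_of[OF u(1), of t] by blast
    then show "\<rho> \<in> complex_of es (add w t)"
      using u by (auto simp: complex_of_def)
  qed
qed

text \<open>That the lower end is nonempty, as \<open>expandable\<close> demands, follows from the
  empty simplex being in the complex and the lower end not.\<close>

lemma expandable_complex_of:
  assumes "length w = length es" "\<not> mem (map lower w) t" "faces_mem w t"
    and "{} \<in> complex_of es t"
  shows "expandable (complex_of es t) (simplex_of es (map lower w)) (simplex_of es (map upper w))"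
proof -
  have lw: "map lower w \<in> words es" and uw: "map upper w \<in> words es"
    using words_map_lower_upper[OF assms(1)] by auto
  have sub: "simplex_of es (map lower w) \<subseteq> simplex_of es (map upper w)"
    using lower_Z_or_upper assms(1) by (auto simp: simplex_of_subset_iff)
  have notin: "simplex_of es (map lower w) \<notin> complex_of es t"
    using assms(2) simplex_of_in_complex_of[OF lw] by blast
  have "simplex_of es (map upper w) - {p} \<in> complex_of es t" if p: "p \<in> simplex_of es (map lower w)" for p
  proof -
    obtain i where i: "i < length es" "p = (es ! i, lower (w ! i))" "lower (w ! i) \<noteq> Z"
      using in_simplex_ofE[OF p] assms(1) by (metis nth_map)
    let ?u = "map upper (w[i := Z])"
    have "mem ?u t"
      unfolding mem_map_upper by (rule faces_memD[OF assms(3) _ i(3)]) (use i(1) assms(1) in simp)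
    moreover have "?u \<in> words es"
      using assms(1) by (auto simp: words_def)
    moreover have "simplex_of es ?u = simplex_of es (map upper w) - {p}"
    proof -
      have "(es ! j, d) \<in> simplex_of es ?u \<longleftrightarrow> (es ! j, d) \<in> simplex_of es (map upper w) - {p}"
        if "j < length es" for j d
        using that i assms(1) dist lower_eq[OF i(3)]
        by (auto simp: nth_in_simplex_of nth_list_update nth_eq_iff_index_eq)
      moreover have "\<exists>j d. j < length es \<and> q = (es ! j, d)"
        if "q \<in> simplex_of es ?u \<union> (simplex_of es (map upper w) - {p})" for q
        using that by (auto simp: simplex_of_def)
      ultimately show ?thesis
        by blast
    qed
    ultimately show ?thesis
      using simplex_of_in_complex_of by metis
  qed
  then show ?thesis
    using sub notin assms(4) by (auto simp: expandable_def)
qed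

end

section \<open>Checking expansions\<close>

text \<open>Pairs of an edge and a digit index the coordinates of the Euclidean space that contains
  \<open>body\<close>.\<close>

instance digit :: finite
proof
  have "d \<in> set [Z, A, B, C, D, E, F, G, H]" for d
    by (cases d) auto
  then show "finite (UNIV :: digit set)"
    by (intro finite_subset[OF _ finite_set[of "[Z, A, B, C, D, E, F, G, H]"]]) blast
qed

primrec loose :: "digit \<Rightarrow> bool" where
  "loose Z = False" | "loose A = False" | "loose B = False" | "loose C = False" | "loose D = False"
| "loose E = True" | "loose F = True" | "loose G = True" | "loose H = True"

text \<open>The test with \<open>list_all2\<close> compares lengths; a loose digit makes the lower
  end of the interval differ from the upper end.\<close>

primrec expand :: "'e list \<Rightarrow> digit list list \<Rightarrow> complex_trie \<Rightarrow> complex_trie option" where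
  "expand es [] t = Some t"
| "expand es (w # ws) t =
    (if list_all2 (\<lambda>_ _. True) es w \<and> list_ex loose w \<and> \<not> mem (map lower w) t \<and> faces_mem w t
     then expand es ws (add w t) else None)"

primrec expands :: "'e list \<Rightarrow> digit list list list \<Rightarrow> complex_trie \<Rightarrow> complex_trie option" where
  "expands es [] t = Some t"
| "expands es (ws # wss) t =
    (case expand es ws t of None \<Rightarrow> None | Some t' \<Rightarrow> expands es wss t')"

definition admissible :: "'e list \<Rightarrow> complex_trie \<Rightarrow> bool" where
  "admissible es t \<longleftrightarrow>
    well_shaped (length es) t \<and> down_closed (complex_of es t) \<and> {} \<in> complex_of es t"

text \<open>Both halves matter: the first carries contractibility through the core, the second
  carries the homotopy type from the wedge to the whole complex.\<close>

definition grows_to :: "'n::finite set set \<Rightarrow> 'n set set \<Rightarrow> bool" where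
  "grows_to L L' \<longleftrightarrow> (AR (body L) \<longrightarrow> AR (body L')) \<and>
    (top_of_set (body L') homotopy_equivalent_space top_of_set (body L))"

lemma grows_to_refl: "grows_to L L"
  by (simp add: grows_to_def homotopy_equivalent_space_refl)

lemma grows_to_trans: "grows_to L L' \<Longrightarrow> grows_to L' L'' \<Longrightarrow> grows_to L L''"
  unfolding grows_to_def using homotopy_eqv_trans by blast

lemma loose_lower_upper: "loose d \<Longrightarrow> lower d \<noteq> upper d"
  by (cases d) auto

lemma expand_sound:
  fixes es :: "'e::finite list"
  assumes "distinct es"
  shows "admissible es t \<Longrightarrow> expand es ws t = Some t' \<Longrightarrow>
    admissible es t' \<and> grows_to (complex_of es t) (complex_of es t')"
proof (induction ws arbitrary: t)
  case (Cons w ws)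
  let ?s = "simplex_of es (map lower w)" and ?t = "simplex_of es (map upper w)"
  have ok: "length w = length es" "list_ex loose w" "\<not> mem (map lower w) t" "faces_mem w t"
    and rest: "expand es ws (add w t) = Some t'"
    using Cons.prems(2) by (auto split: if_splits simp: list_all2_conv_all_nth)
  have adm: "well_shaped (length es) t" "down_closed (complex_of es t)" "{} \<in> complex_of es t"
    using Cons.prems(1) by (auto simp: admissible_def)
  have ex: "expandable (complex_of es t) ?s ?t"
    by (rule expandable_complex_of[OF assms ok(1,3,4) adm(3)])
  obtain i where i: "i < length es" "loose (w ! i)"
    using ok(1,2) by (auto simp: list_ex_length)
  have "?s \<noteq> ?t"
  proof
    assume "?s = ?t"
    then have "map lower w = map upper w"
      using ok(1) by (intro simplex_of_inject[OF assms]) auto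
    then show False
      using i ok(1) loose_lower_upper[of "w ! i"] by (simp add: list_eq_iff_nth_eq)
  qed
  have cx: "complex_of es (add w t) = complex_of es t \<union> {?s..?t}"
    by (rule complex_of_add[OF assms adm(1) ok(1)])
  have "admissible es (add w t)"
    using adm well_shaped_add[of w t] ok(1) down_closed_expand[OF adm(2) ex]
    by (simp add: admissible_def cx)
  then have "admissible es t' \<and> grows_to (complex_of es (add w t)) (complex_of es t')"
    by (rule Cons.IH[OF _ rest])
  moreover have "grows_to (complex_of es t) (complex_of es (add w t))"
    unfolding cx grows_to_def
    using AR_expand[OF adm(2) ex \<open>?s \<noteq> ?t\<close>] homotopy_equivalent_expand[OF adm(2) ex \<open>?s \<noteq> ?t\<close>] by blast
  ultimately show ?case
    using grows_to_trans by blast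
qed (simp add: grows_to_refl)

lemma expands_sound:
  fixes es :: "'e::finite list"
  assumes "distinct es"
  shows "admissible es t \<Longrightarrow> expands es wss t = Some t' \<Longrightarrow>
    admissible es t' \<and> grows_to (complex_of es t) (complex_of es t')"
proof (induction wss arbitrary: t)
  case (Cons ws wss)
  then obtain s where s: "expand es ws t = Some s" "expands es wss s = Some t'"
    by (auto split: option.splits)
  then show ?case
    using expand_sound[OF assms Cons.prems(1) s(1)] Cons.IH[OF _ s(2)] grows_to_trans by blast
qed (simp add: grows_to_refl)

section \<open>Attaching the facets that become spheres\<close>

lemma card_simplex_of:
  assumes "distinct es" "length w = length es"
  shows "card (simplex_of es w) = length (filter (\<lambda>d. d \<noteq> Z) w)"
proof -
  have "simplex_of es w = (\<lambda>i. (es ! i, w ! i)) ` {i. i < length w \<and> w ! i \<noteq> Z}"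
    using assms(2) by (auto simp: simplex_of_def)
  moreover have "inj_on (\<lambda>i. (es ! i, w ! i)) {i. i < length w \<and> w ! i \<noteq> Z}"
    using assms by (auto simp: inj_on_def nth_eq_iff_index_eq)
  ultimately show ?thesis
    by (simp add: card_image length_filter_conv_card)
qed

lemma map_letters:
  assumes "w \<in> words es"
  shows "map lower w = w" "map upper w = w"
  using assms lower_upper_letter by (auto simp: words_def intro!: map_idI)

lemma complex_of_fold_add:
  assumes "distinct es"
  shows "well_shaped (length es) t \<Longrightarrow> set fs \<subseteq> words es \<Longrightarrow>
    well_shaped (length es) (fold add fs t) \<and>
    complex_of es (fold add fs t) = complex_of es t \<union> simplex_of es ` set fs"
proof (induction fs arbitrary: t)
  case (Cons f fs)
  have f: "f \<in> words es" "length f = length es"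
    using Cons.prems by (auto simp: words_def)
  have "complex_of es (add f t) = complex_of es t \<union> {simplex_of es f}"
    using complex_of_add[OF assms Cons.prems(1) f(2)] map_letters[OF f(1)] by simp
  then show ?case
    using Cons.IH[of "add f t"] Cons.prems well_shaped_add[of f t] f(2) by auto
qed simp

text \<open>Every facet is tested against t itself, not against the partly extended trie, so all
  boundaries lie in the contractible part. Proper faces of a facet lie in its boundary, which keeps
  the result down closed and lets further expansions follow.\<close>

lemma attach_facets:
  fixes es :: "'e::finite list"
  assumes "distinct es" and t: "admissible es t" "AR (body (complex_of es t))"
    and fs: "\<And>f. f \<in> set fs \<Longrightarrow> f \<in> words es \<and> \<not> mem f t \<and> faces_mem f t" "distinct fs" "fs \<noteq> []"
    and d: "\<And>i. i < length fs \<Longrightarrow> length (filter (\<lambda>d. d \<noteq> Z) (fs ! i)) = Suc (d i)"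
  shows "admissible es (fold add fs t)"
    and "top_of_set (body (complex_of es (fold add fs t))) homotopy_equivalent_space
      wedge_spheres d {..<length fs}"
proof -
  let ?C = "complex_of es t" and ?F = "\<lambda>i. simplex_of es (fs ! i)"
  have adm: "well_shaped (length es) t" "down_closed ?C" "{} \<in> ?C"
    using t(1) by (auto simp: admissible_def)
  have cx: "well_shaped (length es) (fold add fs t)"
      "complex_of es (fold add fs t) = ?C \<union> ?F ` {..<length fs}"
  proof -
    have "set fs = (!) fs ` {..<length fs}"
      by (auto simp: set_conv_nth)
    then have "simplex_of es ` set fs = ?F ` {..<length fs}"
      by (simp add: image_image)
    then show "well_shaped (length es) (fold add fs t)"
      "complex_of es (fold add fs t) = ?C \<union> ?F ` {..<length fs}"
      using complex_of_fold_add[OF assms(1) adm(1), of fs] fs(1) by auto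
  qed
  have ex: "expandable ?C (?F i) (?F i)" if "i < length fs" for i
  proof -
    have f: "fs ! i \<in> words es" "\<not> mem (fs ! i) t" "faces_mem (fs ! i) t"
      using fs(1) that by auto
    then show ?thesis
      using expandable_complex_of[OF assms(1) _ _ f(3) adm(3)] map_letters[OF f(1)] by (simp add: words_def)
  qed
  have "down_closed (?C \<union> ?F ` {..<length fs})"
    unfolding down_closed_def
  proof (intro ballI allI impI)
    fix \<sigma> \<rho> assume \<sigma>: "\<sigma> \<in> ?C \<union> ?F ` {..<length fs}" and "\<rho> \<subseteq> \<sigma>"
    show "\<rho> \<in> ?C \<union> ?F ` {..<length fs}"
    proof (cases "\<rho> = \<sigma> \<or> \<sigma> \<in> ?C")
      case True
      then show ?thesis using \<sigma> down_closedD[OF adm(2) _ \<open>\<rho> \<subseteq> \<sigma>\<close>] by blast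
    next
      case False
      then obtain i where i: "i < length fs" "\<sigma> = ?F i" using \<sigma> by blast
      obtain p where "p \<in> \<sigma>" "\<rho> \<subseteq> \<sigma> - {p}" using False \<open>\<rho> \<subseteq> \<sigma>\<close> by blast
      then show ?thesis
        using ex[OF i(1)] i(2) down_closedD[OF adm(2)] by (auto simp: expandable_def)
    qed
  qed
  then show "admissible es (fold add fs t)"
    using cx adm by (simp add: admissible_def)
  have "inj_on ?F {..<length fs}"
  proof (rule inj_onI)
    fix i j assume ij: "i \<in> {..<length fs}" "j \<in> {..<length fs}" "?F i = ?F j"
    then have "fs ! i = fs ! j"
      using fs(1)[of "fs ! i"] fs(1)[of "fs ! j"]
      by (intro simplex_of_inject[OF assms(1)]) (auto simp: words_def)
    then show "i = j" using ij fs(2) by (simp add: nth_eq_iff_index_eq)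
  qed
  moreover have "card (?F i) = Suc (d i)" if "i < length fs" for i
    using card_simplex_of[OF assms(1), of "fs ! i"] d[OF that] fs(1)[of "fs ! i"] that by (simp add: words_def)
  ultimately show "top_of_set (body (complex_of es (fold add fs t))) homotopy_equivalent_space
      wedge_spheres d {..<length fs}"
    unfolding cx(2) using adm(2) t(2) ex fs(3) by (intro homotopy_equivalent_wedge) auto
qed

section \<open>Tries from forbidden words\<close>

definition restrict_words :: "digit \<Rightarrow> digit list list \<Rightarrow> digit list list" where
  "restrict_words d Ns = map tl (filter (\<lambda>N. hd N = Z \<or> hd N = d) Ns)"

text \<open>Subtries without words are pruned to \<^term>\<open>Empty\<close>, as in the tries built by \<^term>\<open>add\<close>, so that
  tries for the same complex are equal.\<close>

primrec avoiding :: "nat \<Rightarrow> digit list list \<Rightarrow> complex_trie" where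
  "avoiding 0 Ns = (case Ns of [] \<Rightarrow> Leaf | _ \<Rightarrow> Empty)"
| "avoiding (Suc n) Ns = (if list_ex (list_all (\<lambda>d. d = Z)) Ns then Empty
    else Node (avoiding n (restrict_words Z Ns)) (avoiding n (restrict_words A Ns))
      (avoiding n (restrict_words B Ns)) (avoiding n (restrict_words C Ns)) (avoiding n (restrict_words D Ns)))"

text \<open>A forbidden word with only Z left is contained in every continuation, hence the cut to
  \<open>Empty\<close>. The others are followed digit by digit, and those that disagree with the
  digit just read can no longer be contained.\<close>

lemma mem_avoiding:
  "\<forall>d\<in>set u. letter d \<Longrightarrow> \<forall>N\<in>set Ns. length N = length u \<Longrightarrow>
    mem u (avoiding (length u) Ns) \<longleftrightarrow> (\<forall>N\<in>set Ns. \<not> list_all2 (\<lambda>x y. x = Z \<or> x = y) N u)"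
proof (induction u arbitrary: Ns)
  case Nil
  then show ?case by (auto split: list.splits)
next
  case (Cons d u)
  show ?case
  proof (cases "\<exists>N\<in>set Ns. list_all (\<lambda>d. d = Z) N")
    case True
    then obtain N where N: "N \<in> set Ns" "list_all (\<lambda>d. d = Z) N" by blast
    then have "list_all2 (\<lambda>x y. x = Z \<or> x = y) N (d # u)"
      using Cons.prems(2) by (auto simp: list_all2_conv_all_nth list_all_length)
    then show ?thesis using N True by (auto simp: list_ex_iff)
  next
    case False
    then have "child d (avoiding (length (d # u)) Ns) = avoiding (length u) (restrict_words d Ns)"
      using Cons.prems(1) by (cases d) (auto simp: list_ex_iff)
    then have "mem (d # u) (avoiding (length (d # u)) Ns) \<longleftrightarrow>
        (\<forall>N\<in>set (restrict_words d Ns). \<not> list_all2 (\<lambda>x y. x = Z \<or> x = y) N u)"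
      using Cons.IH[of "restrict_words d Ns"] Cons.prems by (auto simp: restrict_words_def)
    also have "\<dots> \<longleftrightarrow> (\<forall>N\<in>set Ns. \<not> list_all2 (\<lambda>x y. x = Z \<or> x = y) N (d # u))"
    proof -
      have "list_all2 (\<lambda>x y. x = Z \<or> x = y) N (d # u) \<longleftrightarrow>
          (hd N = Z \<or> hd N = d) \<and> list_all2 (\<lambda>x y. x = Z \<or> x = y) (tl N) u" if "N \<in> set Ns" for N
        using Cons.prems(2) that by (cases N) auto
      then show ?thesis by (auto simp: restrict_words_def)
    qed
    finally show ?thesis .
  qed
qed

section \<open>The complex of discrete Morse matchings as a trie\<close>

datatype edge = E01 | E02 | E03 | E12 | E13 | E23

instance edge :: finite
proof
  have "e \<in> set [E01, E02, E03, E12, E13, E23]" for e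
    by (cases e) auto
  then show "finite (UNIV :: edge set)"
    by (intro finite_subset[OF _ finite_set[of "[E01, E02, E03, E12, E13, E23]"]]) blast
qed

definition edges :: "edge list" where
  "edges = [E01, E02, E03, E12, E13, E23]"

text \<open>An edge is listed with its end points \<open>a < b\<close> and the two remaining vertices \<open>c < d\<close>. The digits
  \<open>A, B, C, D\<close> say whether it is matched with \<open>a\<close>, \<open>b\<close>, or the triangle containing \<open>c\<close>, \<open>d\<close>.\<close>

primrec ends :: "edge \<Rightarrow> nat \<times> nat \<times> nat \<times> nat" where
  "ends E01 = (0, 1, 2, 3)" | "ends E02 = (0, 2, 1, 3)" | "ends E03 = (0, 3, 1, 2)"
| "ends E12 = (1, 2, 0, 3)" | "ends E13 = (1, 3, 0, 2)" | "ends E23 = (2, 3, 0, 1)"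

text \<open>A tetrahedron edge has four partners, its two ends and the two triangles through it. The
  value at Z is a dummy, and \<open>hasse_codes\<close> leaves Z out.\<close>

definition hasse_edge :: "edge \<times> digit \<Rightarrow> nat set \<times> nat set" where
  "hasse_edge = (\<lambda>(e, x). case ends e of (a, b, c, d) \<Rightarrow>
     select x ({}, {}) ({a}, {a, b}) ({b}, {a, b}) ({a, b}, {a, b, c}) ({a, b}, {a, b, d}))"

definition hasse_codes :: "(edge \<times> digit) list" where
  "hasse_codes = List.product edges [A, B, C, D]"

definition conflict :: "edge \<times> digit \<Rightarrow> edge \<times> digit \<Rightarrow> bool" where
  "conflict p q \<longleftrightarrow> (case (hasse_edge p, hasse_edge q) of ((s, t), (s', t')) \<Rightarrow>
     s = s' \<or> s = t' \<or> t = s' \<or> t = t')"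

definition successors :: "nat list \<Rightarrow> (nat \<times> nat) list" where
  "successors l = zip l (rotate1 l)"

text \<open>One representative up to rotation of each directed cycle on four points: eight of length
  3 and six of length 4.\<close>

definition cycles :: "nat list list" where
  "cycles = [[0,1,2], [0,2,1], [0,1,3], [0,3,1], [0,2,3], [0,3,2], [1,2,3], [1,3,2],
     [0,1,2,3], [0,3,2,1], [0,1,3,2], [0,2,3,1], [0,2,1,3], [0,3,1,2]]"

text \<open>The three blocks are pairs of Hasse edges sharing a cell, cycles of the vertex flow and
  cycles of the triangle flow. The filters recover the codes of the Hasse edges in a cycle. Pairs on
  one tetrahedron edge are absent because a word has a single digit there.\<close>

definition forbidden :: "(edge \<times> digit) list list" where
  "forbidden =
     [[p, q]. p \<leftarrow> hasse_codes, q \<leftarrow> hasse_codes, fst p \<noteq> fst q \<and> conflict p q] @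
     map (\<lambda>l. filter (\<lambda>p. hasse_edge p \<in> set (map (\<lambda>(a, b). ({a}, {a, b})) (successors l))) hasse_codes) cycles @
     map (\<lambda>l. filter (\<lambda>p. hasse_edge p \<in> set (map (\<lambda>(c, d). ({0,1,2,3} - {c, d}, {0,1,2,3} - {c})) (successors l))) hasse_codes) cycles"

definition word_of :: "(edge \<times> digit) list \<Rightarrow> digit list" where
  "word_of ps = map (\<lambda>e. case map_of ps e of None \<Rightarrow> Z | Some x \<Rightarrow> x) edges"

definition morse_trie :: complex_trie where
  "morse_trie = avoiding 6 (map word_of forbidden)"

section \<open>Finite checks on codes and cycles\<close>

lemma distinct_edges: "distinct edges"
  by (simp add: edges_def)

lemma set_edges: "e \<in> set edges"
  by (cases e) (simp_all add: edges_def)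

lemma hasse_codes_iff: "p \<in> set hasse_codes \<longleftrightarrow> letter (snd p) \<and> snd p \<noteq> Z"
  using set_edges by (cases p; cases "snd p") (auto simp: hasse_codes_def)

lemma distinct_hasse_edges: "distinct (map hasse_edge hasse_codes)"
  by code_simp

lemma distinct_forbidden: "list_all (\<lambda>ps. distinct (map fst ps)) forbidden"
  by code_simp

text \<open>Both Hasse edges contain the tetrahedron edge itself. Hence a matching uses each
  tetrahedron edge at most once and fits into a word.\<close>

lemma conflict_same_edge: "list_all (\<lambda>p. list_all (\<lambda>q. fst p = fst q \<longrightarrow> conflict p q) hasse_codes) hasse_codes"
  by code_simp

lemma hasse_edges_coded: "list_all (\<lambda>(a, b). a \<noteq> b \<longrightarrow> ({a}, {a, b}) \<in> set (map hasse_edge hasse_codes) \<and>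
   ({0,1,2,3} - {a, b}, {0,1,2,3} - {a}) \<in> set (map hasse_edge hasse_codes)) (List.product [0,1,2,3] [0,1,2,3])"
  by code_simp

lemma hasse_codes_sound: "list_all (\<lambda>p. case hasse_edge p of (s, t) \<Rightarrow>
    s \<noteq> {} \<and> s \<subset> t \<and> t \<subset> {0,1,2,3} \<and> card t = Suc (card s)) hasse_codes"
  by code_simp

text \<open>Rotating a list does not change its set of successors, so each list of three or four
  distinct points is covered by a representative.\<close>

lemma cycles_complete: "list_all (\<lambda>l. distinct l \<longrightarrow>
    list_ex (\<lambda>c. set (successors c) \<subseteq> set (successors l)) cycles)
   (List.n_lists 3 [0,1,2,3] @ List.n_lists 4 [0,1,2,3])"
  by code_simp

lemma cycles_sound: "list_all (\<lambda>l. distinct l \<and> (length l = 3 \<or> length l = 4)) cycles"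
  by code_simp

lemma successors_3: "successors [x, y, z] = [(x, y), (y, z), (z, x)]"
  by (simp add: successors_def)

lemma successors_4: "successors [x, y, z, w] = [(x, y), (y, z), (z, w), (w, x)]"
  by (simp add: successors_def)

lemma short_cycle_iff:
  assumes "r \<subseteq> {0,1,2,3} \<times> {0,1,2,3}"
  shows "short_cycle r \<longleftrightarrow> (\<exists>c\<in>set cycles. set (successors c) \<subseteq> r)"
proof
  assume "short_cycle r"
  then obtain l where l: "distinct l" "length l = 3 \<or> length l = 4" "set (successors l) \<subseteq> r"
    unfolding short_cycle_def
  proof (elim disjE exE conjE)
    fix x y z assume "distinct [x, y, z]" "{(x, y), (y, z), (z, x)} \<subseteq> r"
    then show thesis by (intro that[of "[x, y, z]"]) (simp_all add: successors_3)
  next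
    fix x y z w assume "distinct [x, y, z, w]" "{(x, y), (y, z), (z, w), (w, x)} \<subseteq> r"
    then show thesis by (intro that[of "[x, y, z, w]"]) (simp_all add: successors_4)
  qed
  have "set l = fst ` set (successors l)"
    by (simp add: successors_def flip: set_map)
  also have "\<dots> \<subseteq> set [0,1,2,3]"
    using l(3) assms by force
  finally have "l \<in> set (List.n_lists 3 [0,1,2,3] @ List.n_lists 4 [0,1,2,3])"
    using l(2) by (auto simp only: set_append set_n_lists)
  then show "\<exists>c\<in>set cycles. set (successors c) \<subseteq> r"
    using cycles_complete l(1,3) unfolding list_all_iff list_ex_iff by blast
next
  assume "\<exists>c\<in>set cycles. set (successors c) \<subseteq> r"
  then obtain c where c: "distinct c" "length c = 3 \<or> length c = 4" "set (successors c) \<subseteq> r"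
    using cycles_sound unfolding list_all_iff by blast
  from c(2) show "short_cycle r"
  proof
    assume "length c = 3"
    then obtain x y z where "c = [x, y, z]"
      by (auto simp: numeral_eq_Suc length_Suc_conv)
    then show ?thesis using c(1,3) unfolding short_cycle_def by (simp add: successors_3) blast
  next
    assume "length c = 4"
    then obtain x y z w where "c = [x, y, z, w]"
      by (auto simp: numeral_eq_Suc length_Suc_conv)
    then show ?thesis using c(1,3) unfolding short_cycle_def by (simp add: successors_4) blast
  qed
qed

lemma cycle_successors:
  assumes "l \<in> set cycles" "(a, b) \<in> set (successors l)"
  shows "a \<in> {0,1,2,3}" "b \<in> {0,1,2,3}" "a \<noteq> b"
proof -
  have all: "list_all (\<lambda>l. list_all (\<lambda>(a, b).
      a \<in> set [0,1,2,3] \<and> b \<in> set [0,1,2,3] \<and> a \<noteq> b) (successors l)) cycles"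
    by code_simp
  have conj: "a \<in> {0,1,2,3} \<and> b \<in> {0,1,2,3} \<and> a \<noteq> b"
    using bspec[OF bspec[OF all[unfolded list_all_iff] assms(1)] assms(2)] unfolding prod.case list.set .
  show "a \<in> {0,1,2,3}" "b \<in> {0,1,2,3}" "a \<noteq> b"
    by (rule conjunct1[OF conj], rule conjunct1[OF conjunct2[OF conj]], rule conjunct2[OF conjunct2[OF conj]])
qed

lemma inj_on_hasse_edge: "inj_on hasse_edge (set hasse_codes)"
  using distinct_hasse_edges by (simp add: distinct_map)

lemma hasse_edge_codes:
  assumes "a \<in> {0,1,2,3}" "b \<in> {0,1,2,3}" "a \<noteq> b"
  shows "({a}, {a, b}) \<in> hasse_edge ` set hasse_codes"
    "({0,1,2,3} - {a, b}, {0,1,2,3} - {a}) \<in> hasse_edge ` set hasse_codes"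
proof -
  have "(a, b) \<in> set (List.product [0,1,2,3] [0,1,2,3])"
    unfolding set_product list.set using assms(1,2) by (rule SigmaI)
  note both = bspec[OF hasse_edges_coded[unfolded list_all_iff] this, unfolded prod.case set_map, THEN mp, OF assms(3)]
  show "({a}, {a, b}) \<in> hasse_edge ` set hasse_codes"
    "({0,1,2,3} - {a, b}, {0,1,2,3} - {a}) \<in> hasse_edge ` set hasse_codes"
    by (rule conjunct1[OF both], rule conjunct2[OF both])
qed

lemma hasse_edges_tetrahedron: "hasse_edges boundary_tetrahedron = hasse_edge ` set hasse_codes"
proof (intro equalityI subsetI)
  fix e assume "e \<in> hasse_edges boundary_tetrahedron"
  then show "e \<in> hasse_edge ` set hasse_codes"
    by (cases rule: hasse_edges_tetrahedron_cases) (use hasse_edge_codes in simp_all)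
next
  fix e assume "e \<in> hasse_edge ` set hasse_codes"
  then obtain p where p: "p \<in> set hasse_codes" "e = hasse_edge p" by blast
  obtain s t where st: "hasse_edge p = (s, t)" by (cases "hasse_edge p")
  have "s \<noteq> {} \<and> s \<subset> t \<and> t \<subset> {0,1,2,3} \<and> card t = Suc (card s)"
    using bspec[OF hasse_codes_sound[unfolded list_all_iff] p(1)] unfolding st prod.case .
  then have "s \<noteq> {}" "s \<subset> t" "t \<subset> {0,1,2,3}" "card t = Suc (card s)"
    by simp_all
  moreover have "t \<noteq> {}" "s \<subset> {0,1,2,3}"
    using psubset_trans[OF \<open>s \<subset> t\<close> \<open>t \<subset> {0,1,2,3}\<close>] \<open>s \<subset> t\<close> by (auto simp only: psubset_eq)
  ultimately show "e \<in> hasse_edges boundary_tetrahedron"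
    unfolding p(2) st hasse_edges_def boundary_tetrahedron_def mem_Collect_eq prod.case by blast
qed

lemma is_matching_hasse_edge_image:
  assumes "X \<subseteq> set hasse_codes"
  shows "is_matching boundary_tetrahedron (hasse_edge ` X) \<longleftrightarrow>
    (\<forall>p\<in>X. \<forall>q\<in>X. p \<noteq> q \<longrightarrow> \<not> conflict p q)"
proof -
  have "hasse_edge ` X \<subseteq> hasse_edges boundary_tetrahedron"
    using assms by (auto simp: hasse_edges_tetrahedron)
  moreover have "hasse_edge p \<noteq> hasse_edge q \<longleftrightarrow> p \<noteq> q" if "p \<in> X" "q \<in> X" for p q
    using that assms inj_on_hasse_edge by (auto dest: inj_onD)
  moreover have "conflict p q \<longleftrightarrow>
      {fst (hasse_edge p), snd (hasse_edge p)} \<inter> {fst (hasse_edge q), snd (hasse_edge q)} \<noteq> {}" for p q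
    by (auto simp: conflict_def split: prod.splits)
  ultimately show ?thesis
    unfolding is_matching_def by simp
qed

text \<open>As h is injective on the list, the filter returns exactly the preimage of T. This turns
  a cycle contained in a flow into a forbidden list contained in a set of codes.\<close>

lemma subset_image_iff_filter:
  assumes "inj_on h (set xs)" "X \<subseteq> set xs" "T \<subseteq> h ` set xs"
  shows "T \<subseteq> h ` X \<longleftrightarrow> set (filter (\<lambda>p. h p \<in> T) xs) \<subseteq> X"
proof
  assume T: "T \<subseteq> h ` X"
  show "set (filter (\<lambda>p. h p \<in> T) xs) \<subseteq> X"
  proof
    fix p assume p: "p \<in> set (filter (\<lambda>p. h p \<in> T) xs)"
    then obtain q where "q \<in> X" "h p = h q" using T by auto
    then show "p \<in> X" using p assms(1,2) by (auto dest: inj_onD)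
  qed
next
  assume F: "set (filter (\<lambda>p. h p \<in> T) xs) \<subseteq> X"
  show "T \<subseteq> h ` X"
  proof
    fix t assume "t \<in> T"
    then obtain p where "p \<in> set xs" "t = h p" using assms(3) by blast
    then show "t \<in> h ` X" using F \<open>t \<in> T\<close> by auto
  qed
qed

text \<open>Conflicts on one tetrahedron edge account for \<open>inj_on fst X\<close>; the remaining
  conflicts and the short cycles of the two flows are the three blocks of
  \<open>forbidden\<close>.\<close>

lemma acyclic_matching_hasse_edge_image:
  assumes X: "X \<subseteq> set hasse_codes"
  shows "acyclic_matching boundary_tetrahedron (hasse_edge ` X) \<longleftrightarrow>
    inj_on fst X \<and> (\<forall>ps\<in>set forbidden. \<not> set ps \<subseteq> X)"
proof -
  let ?W = "hasse_edge ` X" and ?V = "{0,1,2,3::nat}"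
  have sub: "?W \<subseteq> hasse_edges boundary_tetrahedron"
    using X by (auto simp: hasse_edges_tetrahedron)
  have same: "conflict p q" if "p \<in> X" "q \<in> X" "fst p = fst q" for p q
    using conflict_same_edge that X unfolding list_all_iff by blast
  have matching: "is_matching boundary_tetrahedron ?W \<longleftrightarrow> inj_on fst X \<and>
      (\<forall>ps\<in>set [[p, q]. p \<leftarrow> hasse_codes, q \<leftarrow> hasse_codes, fst p \<noteq> fst q \<and> conflict p q]. \<not> set ps \<subseteq> X)"
    (is "?l \<longleftrightarrow> _ \<and> ?r")
  proof -
    have "?r \<longleftrightarrow> (\<forall>p\<in>X. \<forall>q\<in>X. fst p \<noteq> fst q \<longrightarrow> \<not> conflict p q)"
      using X by fastforce
    moreover have "(\<forall>p\<in>X. \<forall>q\<in>X. p \<noteq> q \<longrightarrow> \<not> conflict p q) \<longleftrightarrow>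
        inj_on fst X \<and> (\<forall>p\<in>X. \<forall>q\<in>X. fst p \<noteq> fst q \<longrightarrow> \<not> conflict p q)"
    proof (intro iffI conjI ballI impI inj_onI)
      fix p q assume all: "\<forall>p\<in>X. \<forall>q\<in>X. p \<noteq> q \<longrightarrow> \<not> conflict p q" and pq: "p \<in> X" "q \<in> X"
      show "p = q" if "fst p = fst q"
        using bspec[OF bspec[OF all pq(1)] pq(2)] same[OF pq that] by argo
      show "\<not> conflict p q" if "fst p \<noteq> fst q"
        using bspec[OF bspec[OF all pq(1)] pq(2)] that by auto
    next
      fix p q assume all: "inj_on fst X \<and> (\<forall>p\<in>X. \<forall>q\<in>X. fst p \<noteq> fst q \<longrightarrow> \<not> conflict p q)"
        and pq: "p \<in> X" "q \<in> X" "p \<noteq> q"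
      then have "fst p \<noteq> fst q" by (meson inj_onD)
      then show "\<not> conflict p q"
        using bspec[OF bspec[OF conjunct2[OF all] pq(1)] pq(2)] by argo
    qed
    ultimately show ?thesis
      by (simp only: is_matching_hasse_edge_image[OF X])
  qed
  have vertex: "\<not> short_cycle (vertex_flow ?W) \<longleftrightarrow> (\<forall>ps\<in>set (map (\<lambda>l. filter (\<lambda>p. hasse_edge p \<in>
      set (map (\<lambda>(a, b). ({a}, {a, b})) (successors l))) hasse_codes) cycles). \<not> set ps \<subseteq> X)"
  proof -
    have "set (successors l) \<subseteq> vertex_flow ?W \<longleftrightarrow> set (filter (\<lambda>p. hasse_edge p \<in>
        set (map (\<lambda>(a, b). ({a}, {a, b})) (successors l))) hasse_codes) \<subseteq> X" if l: "l \<in> set cycles" for l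
    proof -
      let ?T = "set (map (\<lambda>(a, b). ({a}, {a, b})) (successors l))"
      have "?T \<subseteq> hasse_edge ` set hasse_codes"
      proof
        fix e assume "e \<in> ?T"
        then obtain z where z: "e = (case z of (a, b) \<Rightarrow> ({a}, {a, b}))" "z \<in> set (successors l)"
          unfolding set_map by (rule imageE)
        obtain a b where "z = (a, b)" by (rule prod.exhaust)
        then have ab: "(a, b) \<in> set (successors l)" "e = ({a}, {a, b})"
          using z by (simp_all only: prod.case)
        show "e \<in> hasse_edge ` set hasse_codes"
          unfolding ab(2) by (rule hasse_edge_codes(1)) (fact cycle_successors[OF l ab(1)])+
      qed
      moreover have "set (successors l) \<subseteq> vertex_flow ?W \<longleftrightarrow> ?T \<subseteq> ?W"
        unfolding set_map image_subset_iff
        by (simp only: vertex_flow_def subset_iff mem_Collect_eq split_beta Ball_def)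
      ultimately show ?thesis
        by (simp only: subset_image_iff_filter[OF inj_on_hasse_edge X])
    qed
    moreover have "vertex_flow ?W \<subseteq> ?V \<times> ?V"
      by (intro subrelI SigmaI) (fact vertex_flow_subset(1,2)[OF sub])+
    ultimately show ?thesis
      by (simp add: short_cycle_iff)
  qed
  have triangle: "\<not> short_cycle (triangle_flow ?W) \<longleftrightarrow> (\<forall>ps\<in>set (map (\<lambda>l. filter (\<lambda>p. hasse_edge p \<in>
      set (map (\<lambda>(c, d). (?V - {c, d}, ?V - {c})) (successors l))) hasse_codes) cycles). \<not> set ps \<subseteq> X)"
  proof -
    have "set (successors l) \<subseteq> triangle_flow ?W \<longleftrightarrow> set (filter (\<lambda>p. hasse_edge p \<in>
        set (map (\<lambda>(c, d). (?V - {c, d}, ?V - {c})) (successors l))) hasse_codes) \<subseteq> X" if l: "l \<in> set cycles" for l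
    proof -
      let ?T = "set (map (\<lambda>(c, d). (?V - {c, d}, ?V - {c})) (successors l))"
      have "?T \<subseteq> hasse_edge ` set hasse_codes"
      proof
        fix e assume "e \<in> ?T"
        then obtain z where z: "e = (case z of (c, d) \<Rightarrow> (?V - {c, d}, ?V - {c}))" "z \<in> set (successors l)"
          unfolding set_map by (rule imageE)
        obtain c d where "z = (c, d)" by (rule prod.exhaust)
        then have cd: "(c, d) \<in> set (successors l)" "e = (?V - {c, d}, ?V - {c})"
          using z by (simp_all only: prod.case)
        show "e \<in> hasse_edge ` set hasse_codes"
          unfolding cd(2) by (rule hasse_edge_codes(2)) (fact cycle_successors[OF l cd(1)])+
      qed
      moreover have "set (successors l) \<subseteq> triangle_flow ?W \<longleftrightarrow> ?T \<subseteq> ?W"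
        unfolding set_map image_subset_iff
        by (simp only: triangle_flow_def subset_iff mem_Collect_eq split_beta Ball_def)
      ultimately show ?thesis
        by (simp only: subset_image_iff_filter[OF inj_on_hasse_edge X])
    qed
    moreover have "triangle_flow ?W \<subseteq> ?V \<times> ?V"
      by (intro subrelI SigmaI) (fact triangle_flow_subset(1,2)[OF sub])+
    ultimately show ?thesis
      by (simp add: short_cycle_iff)
  qed
  show ?thesis
    unfolding acyclic_matching_tetrahedron_iff matching vertex triangle forbidden_def set_append by blast
qed

section \<open>Sets of codes as words, and the passage to the realization\<close>

lemma simplex_of_word_of:
  assumes "distinct (map fst ps)" "set ps \<subseteq> set hasse_codes"
  shows "word_of ps \<in> words edges" "simplex_of edges (word_of ps) = set ps"
proof -
  have letters: "letter x" "x \<noteq> Z" if "map_of ps e = Some x" for e x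
    using map_of_SomeD[OF that] assms(2) hasse_codes_iff[of "(e, x)"] by auto
  then show "word_of ps \<in> words edges"
    by (auto simp: words_def word_of_def split: option.splits)
  have "(e, x) \<in> simplex_of edges (word_of ps) \<longleftrightarrow> (e, x) \<in> set ps" for e x
  proof -
    obtain i where i: "i < length edges" "e = edges ! i"
      using set_edges[of e] by (metis in_set_conv_nth)
    have "(e, x) \<in> simplex_of edges (word_of ps) \<longleftrightarrow> map_of ps e = Some x"
      unfolding i(2) nth_in_simplex_of[OF distinct_edges i(1)]
      using i(1) letters by (auto simp: word_of_def split: option.splits)
    then show ?thesis using assms(1) by simp
  qed
  then show "simplex_of edges (word_of ps) = set ps" by auto
qed

lemma forbidden_subset:
  assumes "ps \<in> set forbidden"
  shows "set ps \<subseteq> set hasse_codes"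
  using assms unfolding forbidden_def set_append
proof (elim UnE)
  assume "ps \<in> set [[p, q]. p \<leftarrow> hasse_codes, q \<leftarrow> hasse_codes, fst p \<noteq> fst q \<and> conflict p q]"
  then show ?thesis by auto
qed (unfold set_map, (elim imageE, simp only: filter_is_subset)+)

lemma complex_of_morse_trie:
  "complex_of edges morse_trie =
    {X. X \<subseteq> set hasse_codes \<and> inj_on fst X \<and> (\<forall>ps\<in>set forbidden. \<not> set ps \<subseteq> X)}"
proof -
  have mem: "mem u morse_trie \<longleftrightarrow> (\<forall>ps\<in>set forbidden. \<not> set ps \<subseteq> simplex_of edges u)"
    if u: "u \<in> words edges" for u
  proof -
    have len: "length edges = 6" "length u = 6" using u by (auto simp: words_def edges_def)
    have "mem u morse_trie \<longleftrightarrow>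
        (\<forall>ps\<in>set forbidden. \<not> list_all2 (\<lambda>x y. x = Z \<or> x = y) (word_of ps) u)"
      using mem_avoiding[of u "map word_of forbidden"] u len
      by (simp add: morse_trie_def words_def word_of_def)
    also have "\<dots> \<longleftrightarrow> (\<forall>ps\<in>set forbidden. \<not> set ps \<subseteq> simplex_of edges u)"
    proof (intro ball_cong refl arg_cong[of _ _ Not])
      fix ps assume ps: "ps \<in> set forbidden"
      then have "distinct (map fst ps)"
        using distinct_forbidden by (simp add: list_all_iff)
      from simplex_of_word_of[OF this forbidden_subset[OF ps]]
      show "list_all2 (\<lambda>x y. x = Z \<or> x = y) (word_of ps) u \<longleftrightarrow> set ps \<subseteq> simplex_of edges u"
        using simplex_of_subset_iff[OF distinct_edges, of "word_of ps" u] len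
        by (auto simp: list_all2_conv_all_nth words_def)
    qed
    finally show ?thesis .
  qed
  have codes: "simplex_of edges u \<subseteq> set hasse_codes" "inj_on fst (simplex_of edges u)"
    if u: "u \<in> words edges" for u
  proof -
    show "simplex_of edges u \<subseteq> set hasse_codes"
      using u by (auto simp: simplex_of_def hasse_codes_iff words_def)
    show "inj_on fst (simplex_of edges u)"
      using distinct_edges by (auto simp: inj_on_def simplex_of_def nth_eq_iff_index_eq)
  qed
  show ?thesis
  proof (intro equalityI subsetI)
    fix X assume "X \<in> complex_of edges morse_trie"
    then show "X \<in> {X. X \<subseteq> set hasse_codes \<and> inj_on fst X \<and> (\<forall>ps\<in>set forbidden. \<not> set ps \<subseteq> X)}"
      using mem codes unfolding complex_of_def by blast
  next
    fix X assume "X \<in> {X. X \<subseteq> set hasse_codes \<and> inj_on fst X \<and> (\<forall>ps\<in>set forbidden. \<not> set ps \<subseteq> X)}"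
    then have X: "X \<subseteq> set hasse_codes" "inj_on fst X" "\<forall>ps\<in>set forbidden. \<not> set ps \<subseteq> X"
      by auto
    obtain ps where ps: "set ps = X" "distinct ps"
      using finite_distinct_list[OF finite_subset[OF X(1)]] by auto
    then have "distinct (map fst ps)"
      using X(2) by (simp add: distinct_map)
    from simplex_of_word_of[OF this] have "word_of ps \<in> words edges" "simplex_of edges (word_of ps) = X"
      using X(1) ps by auto
    then show "X \<in> complex_of edges morse_trie"
      using mem X(3) unfolding complex_of_def by blast
  qed
qed

text \<open>A function with empty support cannot have sum 1. This reconciles the tries, which
  contain the empty simplex, with \<open>morse_complex\<close>, which omits it.\<close>

lemma geometric_realization_insert_empty:
  "geometric_realization (insert {} L) = geometric_realization L"
  unfolding geometric_realization_def by (rule arg_cong[of _ _ "subtopology _"]) auto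

lemma morse_complex_tetrahedron:
  "insert {} (morse_complex boundary_tetrahedron) = insert {} ((`) hasse_edge ` complex_of edges morse_trie)"
proof -
  have "{W. acyclic_matching boundary_tetrahedron W} = (`) hasse_edge ` complex_of edges morse_trie"
  proof (intro equalityI subsetI)
    fix W assume "W \<in> {W. acyclic_matching boundary_tetrahedron W}"
    moreover from this have "W \<subseteq> hasse_edge ` set hasse_codes"
      by (simp add: acyclic_matching_def is_matching_def hasse_edges_tetrahedron)
    then obtain X where "X \<subseteq> set hasse_codes" "W = hasse_edge ` X"
      by (meson subset_imageE)
    ultimately show "W \<in> (`) hasse_edge ` complex_of edges morse_trie"
      using acyclic_matching_hasse_edge_image by (auto simp: complex_of_morse_trie)
  next
    fix W assume "W \<in> (`) hasse_edge ` complex_of edges morse_trie"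
    then show "W \<in> {W. acyclic_matching boundary_tetrahedron W}"
      using acyclic_matching_hasse_edge_image by (auto simp: complex_of_morse_trie)
  qed
  then show ?thesis
    by (auto simp: morse_complex_def)
qed

lemma geometric_realization_morse_complex:
  assumes "down_closed (complex_of edges morse_trie)"
  shows "geometric_realization (morse_complex boundary_tetrahedron) homeomorphic_space
    top_of_set (body (complex_of edges morse_trie))"
proof -
  have "inj_on hasse_edge (\<Union> (complex_of edges morse_trie))"
    by (rule inj_on_subset[OF inj_on_hasse_edge]) (auto simp: complex_of_morse_trie)
  from geometric_realization_homeomorphic_body[OF assms this] show ?thesis
    by (metis geometric_realization_insert_empty morse_complex_tetrahedron)
qed

section \<open>The certificate\<close>

text \<open>The first entry has lower end {(E03, A)} and upper end {(E03, A), (E23, A)}: it joins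
  the new vertex (E03, A) by an edge to the starting vertex (E23, A). The order matters, since each
  entry is checked against the complex reached so far.\<close>

definition core_steps_1 :: "digit list list" where
  "core_steps_1 = [
    [Z,Z,A,Z,Z,E], [Z,D,E,Z,Z,E], [Z,H,Z,D,Z,E], [Z,H,E,Z,D,Z], [Z,H,B,Z,H,Z], [Z,H,C,H,Z,E],
    [B,Z,G,H,Z,E], [B,D,G,H,Z,Z], [B,H,B,Z,Z,Z], [B,D,G,Z,Z,A], [F,H,F,Z,C,Z], [F,H,Z,Z,C,A],
    [F,Z,B,Z,G,A], [Z,D,B,Z,G,A], [A,H,F,Z,G,Z], [B,H,F,Z,D,Z], [E,H,F,B,Z,Z], [Z,H,F,B,D,Z],
    [A,Z,F,F,D,Z], [F,C,F,Z,Z,E], [F,C,F,Z,D,Z], [A,C,F,Z,H,Z], [Z,C,F,Z,C,E], [B,H,A,Z,Z,E],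
    [A,C,F,Z,C,Z], [Z,H,A,B,H,Z], [F,Z,A,Z,C,E], [Z,C,A,Z,G,E], [A,H,F,Z,Z,A], [B,H,A,Z,D,Z],
    [B,Z,E,B,H,Z], [B,C,Z,Z,C,E], [B,C,A,Z,G,Z], [A,H,C,Z,Z,E], [E,C,Z,B,H,Z], [B,C,Z,B,H,Z],
    [E,H,C,B,Z,Z], [F,C,A,B,Z,Z], [Z,H,G,Z,A,E], [Z,H,G,B,A,Z], [Z,A,G,Z,E,E], [C,Z,G,F,E,Z],
    [C,A,G,Z,E,Z], [G,E,G,Z,B,Z], [Z,E,G,Z,B,A], [A,Z,G,Z,B,E], [G,Z,G,B,B,Z], [A,Z,G,B,B,Z],
    [Z,H,A,F,A,Z], [Z,H,A,Z,A,A], [G,Z,Z,F,E,D], [G,A,Z,Z,E,D], [G,E,Z,A,F,Z], [G,E,Z,A,Z,D],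
    [G,Z,Z,F,B,D], [G,Z,Z,A,B,D], [Z,A,Z,E,B,D], [A,D,F,Z,D,Z], [F,H,Z,D,C,Z], [A,H,Z,D,G,Z],
    [E,C,Z,F,B,Z], [D,G,E,Z,Z,E], [D,G,E,B,Z,Z], [D,Z,E,Z,A,E], [Z,Z,A,F,E,D], [D,G,Z,F,B,Z],
    [D,Z,E,Z,E,D], [E,C,Z,D,G,Z], [D,Z,E,B,Z,D], [D,Z,Z,F,B,D], [B,C,Z,D,G,Z], [A,H,Z,D,Z,A],
    [D,A,Z,Z,E,E], [D,A,Z,Z,E,D], [D,A,Z,Z,B,H], [F,H,Z,Z,H,B], [A,H,Z,Z,H,B], [F,Z,Z,B,H,B],
    [A,Z,Z,B,H,B], [E,G,Z,D,B,Z], [E,H,C,Z,Z,B], [E,Z,Z,D,B,A], [B,Z,G,Z,B,E], [D,E,Z,Z,B,A],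
    [B,H,C,Z,Z,B], [B,A,G,Z,F,Z], [F,G,Z,B,C,Z], [F,E,G,C,Z,Z], [Z,E,G,C,A,Z], [F,Z,Z,F,C,B],
    [Z,C,Z,F,G,B], [A,C,Z,F,Z,B], [B,Z,Z,D,B,E], [F,Z,G,C,Z,B], [Z,B,G,G,Z,F], [Z,B,G,G,A,Z],
    [A,Z,G,Z,A,E], [A,B,G,Z,Z,F], [H,C,Z,Z,B,A], [Z,F,Z,G,A,B]]"

definition core_steps_2 :: "digit list list" where
  "core_steps_2 = [
    [A,B,G,Z,A,Z], [Z,Z,D,G,E,F], [Z,B,D,Z,E,F], [A,F,D,Z,E,Z], [Z,A,D,G,E,Z], [Z,E,D,Z,E,A],
    [A,Z,D,Z,E,A], [Z,G,A,Z,G,B], [B,Z,A,Z,G,B], [B,C,E,Z,Z,B], [A,F,D,Z,Z,B], [B,C,Z,H,B,Z],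
    [A,C,F,Z,Z,A], [F,E,Z,C,B,Z], [Z,E,D,G,B,Z], [B,Z,D,G,F,Z], [B,Z,D,G,Z,B], [E,C,D,Z,Z,F],
    [Z,E,D,Z,B,A], [B,C,D,Z,Z,F], [E,C,D,Z,Z,A], [Z,C,D,Z,B,E], [F,Z,Z,Z,D,A], [Z,A,Z,Z,D,E],
    [A,G,Z,Z,C,A], [F,Z,G,C,Z,A], [Z,E,Z,A,D,Z], [F,Z,Z,C,D,F], [F,Z,Z,C,D,A], [A,Z,G,C,Z,F],
    [A,Z,Z,C,D,F], [A,Z,G,C,Z,A], [F,C,Z,Z,D,A], [A,Z,Z,G,D,A], [A,Z,Z,A,H,Z], [E,Z,Z,A,Z,A],
    [E,Z,D,Z,D,E], [E,Z,Z,A,C,E], [E,C,B,B,Z,Z], [Z,A,D,Z,D,E], [Z,D,Z,A,G,E], [E,Z,B,A,G,Z],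
    [Z,D,B,A,G,Z], [D,G,B,F,Z,Z], [F,C,Z,Z,D,B], [D,G,B,Z,Z,A], [E,Z,D,Z,D,B], [D,G,Z,F,D,Z],
    [D,G,Z,Z,D,A], [D,D,F,Z,Z,E], [D,H,Z,A,Z,E], [D,Z,B,F,D,Z], [D,H,B,A,Z,Z], [E,Z,B,A,D,Z],
    [D,Z,F,A,D,Z], [H,Z,Z,A,D,A], [E,C,Z,A,H,Z], [Z,G,Z,A,H,B], [Z,Z,D,A,H,F], [Z,A,D,A,H,Z],
    [Z,A,Z,A,H,A], [Z,E,D,A,B,Z], [Z,C,D,A,Z,F], [Z,C,H,A,B,Z], [A,G,Z,A,B,Z], [E,Z,C,A,Z,E],
    [E,Z,C,A,B,Z], [Z,A,C,A,F,Z], [D,A,Z,Z,D,E], [D,A,Z,A,H,Z], [Z,Z,C,G,A,B], [Z,A,G,Z,E,B],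
    [Z,A,D,Z,E,B], [E,Z,C,B,Z,B], [D,E,Z,A,Z,D], [C,Z,G,F,Z,B], [C,A,G,Z,Z,B], [Z,Z,D,B,Z,F],
    [C,Z,D,F,Z,F], [C,A,D,Z,Z,F], [Z,A,Z,B,E,H], [C,A,Z,B,Z,H], [G,A,D,B,Z,Z], [Z,C,D,B,Z,F],
    [Z,E,D,B,A,Z], [A,Z,Z,F,F,D], [A,Z,Z,A,F,D], [A,G,D,B,Z,Z], [Z,C,B,A,H,Z], [D,C,F,A,Z,Z],
    [A,Z,H,B,A,Z], [H,G,A,A,Z,Z], [H,Z,A,A,Z,D], [E,Z,B,E,Z,D], [Z,G,E,E,Z,C], [C,Z,B,E,Z,H],
    [C,Z,A,E,Z,H], [C,Z,E,E,Z,C], [Z,G,B,E,Z,C], [C,Z,B,E,Z,C]]"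

definition core_steps_3 :: "digit list list" where
  "core_steps_3 = [
    [A,Z,Z,F,A,D], [Z,G,A,B,C,Z], [Z,Z,E,F,C,D], [C,Z,E,Z,C,H], [C,Z,Z,B,C,H], [C,B,G,Z,E,Z],
    [G,B,Z,Z,E,D], [A,B,Z,Z,E,D], [B,Z,B,B,H,Z], [G,B,B,Z,Z,H], [A,B,B,Z,Z,H], [B,G,F,Z,Z,C],
    [B,G,A,Z,Z,C], [E,B,F,Z,C,Z], [F,Z,F,B,Z,C], [A,Z,F,F,Z,C], [F,Z,A,B,Z,C], [E,Z,F,Z,C,C],
    [G,Z,C,Z,F,D], [Z,B,F,Z,G,C], [G,B,C,Z,Z,D], [A,B,Z,Z,G,C], [C,Z,A,B,G,Z], [C,B,F,Z,Z,C],
    [G,B,Z,Z,B,H], [Z,B,C,Z,B,H], [G,F,Z,Z,B,C], [C,Z,E,B,Z,C], [G,Z,Z,B,B,C], [E,F,C,Z,Z,C],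
    [Z,F,C,Z,B,C], [A,Z,Z,F,B,C], [B,D,Z,B,H,Z], [D,Z,B,E,Z,D], [H,C,F,Z,Z,D], [H,C,Z,B,Z,D],
    [Z,G,B,B,Z,D], [F,D,Z,B,C,Z], [Z,H,B,B,C,Z], [Z,Z,B,F,C,D], [Z,D,E,F,Z,D], [Z,D,Z,F,C,D],
    [Z,Z,F,A,C,D], [Z,D,Z,A,G,D], [Z,D,A,A,Z,H], [C,Z,A,Z,A,H], [C,E,Z,E,Z,A], [C,E,Z,Z,A,A],
    [C,D,Z,Z,E,E], [C,D,A,Z,E,Z], [C,D,E,A,Z,Z], [Z,C,E,B,Z,C], [Z,C,Z,F,B,C], [B,G,Z,Z,B,C],
    [B,Z,C,Z,F,C], [Z,A,G,Z,F,C], [B,A,G,Z,Z,C], [G,Z,E,Z,A,C], [G,B,Z,Z,A,C], [Z,B,A,Z,E,G],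
    [D,G,E,Z,Z,C], [D,B,E,Z,E,Z], [D,B,E,Z,Z,C], [C,A,Z,Z,F,C], [Z,A,H,Z,D,B], [D,F,Z,Z,A,C],
    [G,A,Z,Z,A,C], [D,G,Z,B,Z,C], [Z,E,C,Z,D,F], [Z,Z,C,C,D,F], [F,Z,Z,F,D,C], [D,Z,Z,F,D,C],
    [D,A,Z,Z,E,C], [H,A,Z,Z,D,C], [Z,A,G,C,D,Z], [F,E,Z,C,Z,C], [Z,E,Z,C,D,C], [D,G,Z,A,Z,C],
    [D,Z,B,E,Z,C], [D,E,Z,C,E,Z], [D,E,Z,C,Z,C], [D,Z,E,B,A,Z], [C,Z,B,B,Z,H], [H,Z,B,F,A,Z],
    [C,Z,B,F,A,Z], [H,Z,B,C,E,Z], [H,Z,B,C,Z,C], [G,B,B,Z,A,Z], [Z,B,B,C,E,Z], [F,Z,G,D,Z,B],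
    [F,Z,D,D,Z,F], [Z,Z,G,D,A,F], [Z,Z,G,D,A,A], [Z,B,F,C,Z,C], [D,B,Z,C,Z,G], [Z,H,A,D,Z,E],
    [Z,B,H,D,Z,F], [Z,Z,A,D,A,E], [B,H,A,D,Z,Z], [Z,B,Z,D,A,F]]"

definition core_steps_4 :: "digit list list" where
  "core_steps_4 = [
    [Z,Z,G,C,A,A], [Z,B,A,D,E,Z], [B,B,E,H,Z,Z], [B,B,D,H,Z,Z], [H,Z,A,C,E,Z], [Z,Z,A,C,E,A],
    [H,B,A,C,Z,Z], [Z,B,D,C,Z,F], [B,B,H,C,Z,Z], [B,F,A,C,Z,Z], [E,C,Z,Z,A,E], [E,C,Z,B,A,Z],
    [D,C,Z,F,A,Z], [H,C,Z,A,Z,D], [A,C,Z,E,Z,D], [B,B,C,G,Z,Z], [B,B,G,Z,Z,C], [Z,D,G,D,Z,B],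
    [A,H,Z,D,Z,B], [A,B,Z,D,Z,F], [E,B,Z,D,C,Z], [B,B,Z,H,C,Z], [C,E,C,Z,Z,C], [G,Z,C,B,Z,D],
    [G,Z,B,Z,A,D], [G,Z,C,B,Z,C], [G,A,C,Z,Z,D], [Z,Z,F,C,E,D], [Z,A,Z,C,E,D], [Z,E,C,C,Z,D],
    [B,Z,C,B,Z,G], [Z,F,F,C,C,Z], [B,F,Z,C,C,Z], [B,Z,B,C,G,Z], [B,Z,G,G,Z,D], [B,Z,B,G,Z,D],
    [B,Z,G,B,Z,D], [B,Z,F,Z,C,D], [Z,D,C,F,Z,D], [Z,D,B,E,Z,D], [Z,D,G,Z,B,H], [Z,D,G,Z,B,A],
    [D,D,F,Z,Z,D], [D,D,Z,Z,B,H], [Z,C,F,Z,C,C], [Z,G,A,Z,C,C], [A,G,Z,Z,C,B], [C,Z,E,Z,C,C],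
    [C,B,Z,Z,C,G], [F,D,Z,B,Z,B], [F,D,A,Z,Z,B], [Z,H,A,B,Z,B], [C,Z,A,F,Z,B], [C,Z,E,Z,C,B],
    [E,B,Z,Z,C,B], [C,B,Z,Z,G,B], [C,E,Z,Z,A,B], [H,Z,Z,A,D,C], [C,Z,Z,E,D,G], [C,A,Z,E,D,Z],
    [C,E,Z,Z,D,B], [D,Z,A,F,D,Z], [F,Z,A,Z,D,B], [H,Z,A,Z,D,C], [C,Z,A,Z,D,G], [C,D,E,Z,Z,B],
    [C,Z,Z,D,E,F], [Z,D,E,D,A,Z], [C,D,Z,D,E,Z], [Z,A,Z,C,E,A], [F,Z,Z,C,C,A], [D,E,Z,C,Z,A],
    [H,Z,B,C,Z,A], [D,E,Z,Z,H,B], [D,E,Z,Z,A,B], [D,Z,A,Z,H,B], [Z,H,A,D,Z,B], [D,Z,E,D,E,Z],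
    [D,Z,Z,D,E,B], [Z,F,Z,D,E,C], [Z,F,B,D,Z,G], [Z,F,B,D,C,Z], [H,Z,B,Z,A,C], [Z,Z,B,D,A,G],
    [Z,D,B,D,G,Z], [Z,D,B,H,A,Z], [B,Z,F,Z,C,C], [B,A,Z,G,Z,D], [Z,A,G,C,Z,B], [B,A,Z,G,Z,B],
    [F,A,Z,Z,C,F], [F,A,Z,Z,C,D], [C,A,Z,Z,C,H], [G,E,D,Z,C,Z], [Z,E,D,Z,C,B], [Z,C,D,Z,C,F],
    [G,Z,D,B,C,Z], [Z,B,Z,G,D,G], [Z,B,C,G,D,Z], [C,E,C,Z,D,Z]]"

definition core_steps_5 :: "digit list list" where
  "core_steps_5 = [
    [C,B,G,Z,D,Z], [D,B,Z,Z,E,D], [C,B,Z,D,E,Z], [D,B,Z,Z,B,H], [A,B,G,Z,B,Z], [D,Z,Z,D,E,A],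
    [C,E,D,Z,A,Z], [G,A,B,Z,Z,G], [A,B,Z,C,Z,F], [D,A,B,Z,Z,G], [Z,D,A,F,C,H], [Z,H,A,A,C,H],
    [C,Z,B,F,C,H], [C,Z,F,A,C,H], [C,Z,A,A,C,H], [C,D,E,E,C,Z], [C,D,E,E,Z,D], [C,D,B,E,Z,H],
    [C,D,B,E,C,Z], [C,Z,A,B,G,D], [Z,D,B,E,C,D], [C,D,E,B,G,Z], [C,D,B,B,G,Z], [C,D,E,B,Z,D],
    [Z,D,B,B,G,D], [A,Z,C,G,D,F], [F,D,G,C,Z,F], [F,D,G,C,Z,A], [A,D,G,C,Z,E], [E,D,C,Z,D,F],
    [B,Z,C,G,D,F], [B,D,C,Z,D,F], [A,D,G,C,Z,B], [E,Z,C,G,D,A], [B,Z,C,G,D,A], [F,D,G,Z,D,A],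
    [A,D,G,Z,D,A], [F,D,Z,C,D,E], [F,D,Z,C,D,B], [A,D,Z,C,D,F], [B,G,A,B,C,Z], [F,D,A,Z,D,B],
    [B,D,A,B,H,Z], [F,C,A,Z,D,F], [F,C,A,B,D,Z], [B,D,A,F,C,Z], [F,D,Z,F,C,B], [F,D,A,Z,C,B],
    [Z,H,A,B,C,B], [B,C,E,Z,C,B], [B,C,Z,B,G,B], [F,C,Z,B,D,B], [F,D,Z,B,D,B], [Z,C,A,B,G,B],
    [Z,H,A,B,D,B], [Z,A,G,C,A,B], [B,D,B,Z,G,A], [Z,B,D,C,A,F], [A,H,C,D,Z,E], [A,H,C,D,Z,B],
    [A,G,B,Z,C,A], [E,C,B,B,D,Z], [A,D,F,B,D,Z], [Z,B,C,G,A,B], [Z,A,D,C,E,B], [B,A,C,G,Z,B],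
    [E,B,C,D,Z,F], [Z,B,C,D,A,F], [B,D,B,B,H,Z], [A,Z,G,D,A,E], [B,C,B,B,H,Z], [A,B,G,D,A,Z],
    [A,F,D,D,Z,F], [B,D,G,D,Z,A], [E,F,D,D,A,Z], [Z,F,D,D,A,B], [Z,A,H,D,E,F], [Z,A,C,D,E,F],
    [Z,A,G,D,E,A], [E,Z,D,D,E,A], [Z,A,D,D,E,A], [A,D,Z,B,H,B], [B,H,B,B,C,Z], [B,C,B,Z,C,E],
    [B,A,D,G,Z,F], [B,A,H,D,Z,F], [B,A,C,D,Z,F], [F,C,B,B,C,Z], [A,G,Z,B,C,F], [A,G,B,B,C,Z],
    [F,G,B,Z,D,A], [B,D,G,D,Z,B], [F,D,B,Z,D,A], [A,F,D,C,Z,F], [A,B,C,C,Z,F], [A,F,H,C,A,Z],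
    [A,F,C,C,A,Z], [A,D,F,B,C,Z], [A,H,B,Z,D,A], [A,Z,G,C,A,A]]"

definition core_steps_6 :: "digit list list" where
  "core_steps_6 = [
    [A,D,F,Z,C,A], [A,D,Z,F,C,B], [E,Z,D,C,D,F], [F,H,Z,D,C,A], [E,Z,D,C,H,A], [A,H,Z,D,C,A],
    [E,H,Z,D,C,B], [E,Z,D,C,A,A], [B,H,Z,D,C,B], [Z,A,C,C,E,A], [F,C,Z,D,G,A], [B,A,G,H,Z,A],
    [Z,A,D,C,E,A], [A,C,Z,D,G,A], [B,A,G,C,Z,A], [E,C,Z,D,G,B], [B,C,Z,D,G,B], [F,C,D,D,Z,F],
    [A,C,D,D,Z,F], [B,E,D,G,Z,A], [E,C,D,D,Z,A], [B,E,D,D,Z,A], [A,C,Z,F,D,B], [A,C,F,Z,D,A],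
    [A,G,Z,A,H,B], [A,G,D,A,Z,F], [A,Z,D,A,D,F], [B,Z,D,G,D,E], [E,C,D,Z,D,E], [E,C,D,A,D,Z],
    [B,Z,D,G,D,B], [Z,C,D,E,D,B], [B,C,D,Z,D,F], [B,C,D,H,Z,A], [F,D,Z,C,C,E], [F,H,Z,C,C,B],
    [B,G,D,Z,C,F], [A,G,D,Z,C,F], [A,H,Z,C,C,F], [E,Z,D,C,C,F], [B,Z,D,C,C,F], [E,G,D,Z,C,A],
    [B,G,D,Z,C,A], [F,Z,D,C,C,A], [A,H,Z,C,C,A], [D,C,B,F,D,Z], [D,C,A,F,D,Z], [H,C,B,A,Z,D],
    [H,C,A,F,Z,D], [D,D,F,A,Z,D], [Z,C,E,F,C,D], [Z,C,B,F,C,D], [D,G,B,B,Z,D], [D,G,B,Z,D,A],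
    [D,D,A,E,Z,H], [H,C,A,A,Z,D], [D,D,F,B,Z,H], [F,D,A,Z,C,A], [D,D,F,F,D,Z], [D,D,A,B,Z,H],
    [D,D,F,Z,D,A], [Z,C,F,A,C,H], [Z,C,A,A,C,H], [D,D,A,F,D,Z], [Z,H,B,A,G,A], [D,H,B,A,Z,A],
    [Z,C,F,A,G,A], [D,C,F,A,Z,A], [B,C,A,Z,G,A], [H,G,A,A,Z,A], [Z,G,A,A,C,A], [Z,D,A,A,G,A],
    [H,D,Z,A,D,E], [H,H,A,A,D,Z], [Z,H,A,E,D,A], [D,Z,A,E,D,A], [H,C,A,Z,D,A], [B,G,A,Z,D,A],
    [B,C,E,B,Z,C], [D,C,B,E,Z,C], [B,C,F,Z,C,C], [G,Z,B,B,A,D], [D,F,A,Z,A,C], [F,C,B,B,Z,C],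
    [B,G,A,Z,C,C], [C,Z,A,B,A,H], [Z,G,E,A,C,C], [Z,G,B,A,C,C], [G,Z,E,B,C,C], [B,Z,E,B,C,C],
    [D,G,B,B,Z,C], [G,B,B,Z,A,D], [D,G,A,B,Z,C], [C,Z,E,A,C,C], [D,G,A,A,Z,C], [C,B,A,Z,E,G],
    [D,Z,E,B,A,D], [G,B,A,Z,E,D], [D,B,A,Z,E,D], [C,Z,B,E,C,C]]"

definition core_steps_7 :: "digit list list" where
  "core_steps_7 = [
    [G,F,A,Z,B,H], [G,Z,A,A,B,H], [G,F,A,Z,B,C], [G,Z,E,A,B,C], [D,F,A,Z,B,H], [D,Z,E,A,B,H],
    [D,F,E,Z,B,C], [D,Z,E,A,B,C], [F,Z,B,B,C,C], [G,B,F,A,Z,H], [G,B,Z,A,B,H], [G,B,Z,A,F,C],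
    [G,B,B,A,Z,C], [G,Z,E,B,A,C], [D,B,Z,A,F,G], [D,Z,E,B,A,C], [C,Z,B,B,G,C], [D,B,Z,A,F,D],
    [H,Z,B,B,A,C], [D,Z,B,F,A,D], [C,Z,B,F,A,C], [G,B,B,Z,A,C], [D,B,B,Z,E,G], [D,B,B,Z,E,D],
    [D,B,B,A,Z,G], [G,Z,C,F,A,C], [G,A,C,Z,A,C], [G,E,C,Z,A,D], [G,Z,C,B,A,D], [G,A,C,B,Z,H],
    [H,Z,F,C,A,C], [Z,A,C,B,A,H], [G,A,G,B,Z,C], [D,Z,F,C,E,D], [Z,A,G,B,A,C], [D,A,Z,C,E,D],
    [D,A,Z,B,E,G], [G,A,B,Z,A,G], [H,A,Z,C,A,C], [D,A,Z,B,E,D], [H,A,B,C,Z,G], [G,A,B,Z,E,D],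
    [Z,A,B,C,A,G], [G,A,B,B,Z,H], [G,A,B,B,Z,C], [D,A,B,B,Z,G], [Z,A,B,C,E,D], [D,A,B,F,Z,D],
    [H,Z,A,B,D,C], [H,A,Z,A,H,C], [H,A,B,A,Z,G], [H,Z,A,A,D,C], [C,Z,A,A,D,G], [H,A,Z,B,D,G],
    [H,A,B,F,D,Z], [H,A,B,A,D,Z], [H,D,B,A,D,Z], [Z,E,B,F,D,C], [C,D,E,E,D,Z], [C,H,E,B,D,Z],
    [Z,E,B,A,D,C], [C,H,B,F,D,Z], [C,H,B,A,D,Z], [C,Z,E,B,D,C], [C,Z,B,F,D,C], [E,Z,D,D,C,E],
    [B,Z,D,D,C,E], [E,Z,D,D,C,B], [C,A,Z,E,B,D], [H,A,B,A,Z,D], [G,Z,A,B,B,H], [H,A,Z,B,B,H],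
    [C,A,Z,B,B,H], [G,Z,A,B,B,C], [D,Z,A,B,B,H], [C,A,B,A,Z,H], [G,A,Z,B,B,C], [D,A,Z,A,B,H],
    [D,Z,E,B,B,C], [D,A,Z,F,B,C], [C,A,F,A,Z,C], [H,A,Z,A,B,C], [A,Z,H,H,A,B], [A,Z,H,C,A,B],
    [A,Z,C,G,A,B], [E,Z,C,D,B,E], [Z,E,H,C,B,A], [Z,E,C,C,B,E], [A,Z,G,C,B,E], [A,Z,D,G,B,E],
    [E,Z,D,D,B,E], [Z,A,G,D,B,E], [Z,A,D,D,B,E], [E,B,G,D,B,Z], [G,A,C,Z,B,D], [E,B,D,H,B,Z],
    [G,B,C,Z,A,D], [E,B,G,C,B,Z], [E,B,D,C,B,Z], [C,B,C,Z,B,H]]"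

definition core_steps_8 :: "digit list list" where
  "core_steps_8 = [
    [C,F,C,D,E,Z], [C,F,G,D,B,Z], [C,A,G,D,E,Z], [Z,E,C,C,A,D], [Z,B,G,C,E,D], [C,A,G,D,B,Z],
    [Z,F,G,C,B,D], [Z,A,G,C,B,D], [C,E,D,D,E,Z], [C,E,D,H,B,Z], [Z,E,D,G,F,D], [C,E,D,Z,F,D],
    [C,B,D,H,F,Z], [Z,E,D,G,A,D], [C,B,D,H,A,Z], [Z,B,D,G,F,D], [Z,B,D,G,A,D], [C,B,D,Z,F,D],
    [C,F,D,Z,A,D], [B,A,G,Z,B,C], [C,F,Z,D,E,C], [G,F,Z,D,B,C], [G,A,Z,D,F,C], [Z,F,C,D,F,C],
    [Z,A,C,D,F,C], [G,A,Z,D,A,C], [Z,B,F,C,A,C], [Z,E,C,D,A,C], [Z,B,C,H,A,C], [Z,F,C,C,E,C],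
    [D,E,Z,C,B,E], [H,E,Z,C,B,C], [Z,A,C,C,E,C], [B,E,Z,C,B,C], [B,E,C,C,B,Z], [B,B,G,Z,B,G],
    [B,B,G,C,B,Z], [B,E,C,C,Z,C], [D,B,B,C,Z,G], [D,B,F,C,A,Z], [B,B,G,C,Z,C], [F,B,Z,C,B,C],
    [D,B,Z,C,B,G], [D,E,Z,C,A,A], [D,A,Z,D,E,E], [D,F,D,G,E,Z], [D,F,D,G,B,Z], [D,Z,D,G,F,A],
    [D,Z,D,G,A,A], [D,E,Z,D,B,E], [D,Z,D,D,E,E], [D,Z,D,D,B,E], [D,A,D,H,E,Z], [D,A,D,H,B,Z],
    [D,E,D,Z,F,D], [D,E,D,Z,A,D], [D,B,D,Z,E,D], [C,B,C,Z,E,C], [C,F,C,Z,B,C], [B,B,D,G,B,Z],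
    [B,Z,G,C,B,A], [E,B,Z,D,C,B], [B,Z,D,G,B,A], [F,B,D,G,C,Z], [F,B,D,D,C,Z], [A,B,D,H,C,Z],
    [A,B,H,C,C,Z], [E,B,Z,C,C,B], [B,Z,D,D,B,E], [B,B,Z,H,G,B], [B,Z,C,D,B,E], [B,B,Z,C,G,B],
    [B,B,H,D,B,Z], [B,B,C,G,Z,B], [B,B,C,D,F,Z], [G,B,Z,A,C,G], [G,B,A,Z,C,G], [G,B,Z,E,C,D],
    [G,B,A,Z,C,D], [Z,B,A,A,G,G], [Z,B,A,A,G,D], [D,B,A,A,Z,G], [A,C,B,A,H,Z], [Z,C,E,F,D,C],
    [Z,C,B,F,D,C], [A,D,F,A,H,Z], [Z,C,F,A,D,C], [A,D,F,A,C,Z], [Z,C,A,A,D,G], [A,C,F,A,C,Z],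
    [A,D,Z,A,G,A], [A,H,Z,A,D,A], [Z,C,E,A,D,A], [E,G,D,A,C,Z], [E,Z,D,A,H,A], [Z,C,D,A,H,A],
    [E,Z,D,A,C,A], [D,C,F,A,D,Z], [B,A,D,G,B,Z], [B,A,H,D,B,Z]]"

definition core_steps_9 :: "digit list list" where
  "core_steps_9 = [
    [D,B,H,D,F,Z], [D,B,H,D,A,Z], [D,E,Z,D,E,C], [D,E,Z,D,B,C], [D,B,Z,D,F,C], [D,E,Z,C,B,D],
    [Z,B,B,C,E,D], [D,B,F,C,Z,D], [E,C,C,H,Z,F], [E,C,C,Z,D,F], [B,C,C,H,Z,F], [F,C,C,H,Z,A],
    [A,C,C,H,Z,A], [E,C,C,Z,D,A], [B,C,C,Z,D,F], [Z,G,A,A,H,B], [Z,G,E,A,C,B], [A,G,Z,A,C,B],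
    [Z,D,E,A,G,B], [A,D,Z,A,G,B], [E,D,Z,A,D,B]]"

text \<open>The smaller simplices come first, to agree with the dimension function of the theorem,
  which switches at index 21.\<close>

definition facets :: "digit list list" where
  "facets = [
    [C,B,Z,Z,D,C], [Z,C,D,B,C,Z], [B,B,Z,Z,C,C], [Z,D,B,B,A,Z], [D,Z,A,D,Z,B], [Z,Z,B,C,C,A],
    [C,D,Z,D,Z,B], [C,Z,A,Z,D,B], [C,B,Z,Z,A,B], [D,D,Z,Z,B,A], [B,Z,Z,B,C,D], [B,B,A,Z,Z,C],
    [A,C,Z,B,Z,D], [D,C,Z,Z,A,A], [A,Z,C,B,A,Z], [B,Z,A,C,Z,A], [B,Z,Z,C,D,C], [C,D,Z,A,Z,A],
    [A,Z,C,Z,B,C], [Z,A,C,A,Z,A], [B,C,D,Z,B,Z], [Z,D,A,A,D,B], [B,C,C,Z,D,A], [D,B,Z,C,B,D],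
    [D,B,Z,D,A,C], [B,A,C,D,B,Z], [D,C,Z,A,D,A], [Z,C,D,A,C,A], [D,B,A,A,Z,D], [B,B,C,D,Z,B],
    [C,A,C,Z,B,C], [D,B,D,Z,B,D], [C,A,D,Z,A,D], [A,Z,C,D,A,B], [C,A,Z,A,B,C], [B,Z,D,D,C,B],
    [C,Z,B,A,D,C], [D,A,B,C,Z,D], [D,B,B,A,Z,D], [B,D,A,Z,D,A], [A,Z,D,C,C,A], [B,C,D,Z,D,A],
    [Z,C,A,B,D,B], [A,D,Z,C,D,A], [C,D,B,B,Z,D]]"

text \<open>These steps start from a complex that is no longer contractible; what they supply is the
  homotopy equivalence in \<open>grows_to\<close>.\<close>

definition outer_steps_1 :: "digit list list" where
  "outer_steps_1 = [
    [D,Z,A,D,E,A], [C,Z,E,A,G,B], [C,Z,E,A,D,B], [G,Z,C,B,B,D], [H,C,Z,F,B,D], [A,C,Z,F,B,D],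
    [B,Z,A,F,D,C], [D,D,A,E,Z,A], [D,B,A,D,E,Z], [C,A,B,E,D,Z], [G,A,Z,A,H,B], [B,A,G,G,D,Z],
    [Z,A,D,A,H,B], [B,A,G,Z,D,B], [F,C,D,D,B,Z], [B,A,D,Z,D,F], [D,D,E,Z,A,E], [D,D,E,B,A,Z],
    [Z,C,H,D,B,A], [A,F,B,C,G,Z], [C,E,C,Z,D,B], [C,A,F,B,D,Z], [A,Z,B,C,G,A], [C,B,B,Z,C,G],
    [C,Z,E,B,D,B], [G,B,B,Z,C,D], [Z,D,E,D,A,A], [D,D,B,F,A,Z], [B,H,A,D,Z,A], [B,A,H,Z,D,A],
    [B,H,A,D,Z,B], [C,D,E,B,A,Z], [A,Z,C,F,E,D], [A,Z,C,F,B,D], [D,D,Z,D,E,E], [B,Z,B,C,G,A],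
    [D,D,A,D,E,Z], [A,G,Z,E,C,D], [Z,D,C,D,A,E], [H,H,B,Z,A,A], [A,G,Z,B,C,D], [C,E,D,Z,A,B],
    [A,C,F,F,Z,C], [Z,A,D,A,H,A], [A,C,Z,F,B,C], [Z,H,B,D,E,A], [A,F,Z,C,E,D], [A,H,B,D,G,Z],
    [A,B,B,D,G,Z], [A,Z,C,C,E,D], [F,F,Z,C,C,C], [Z,H,B,D,C,A], [Z,F,B,C,C,C], [D,C,Z,F,B,C],
    [E,C,C,H,B,Z], [G,A,H,B,Z,B], [B,C,C,H,B,Z], [F,Z,A,C,C,E], [F,Z,A,C,G,C], [G,A,Z,B,D,B],
    [F,B,A,C,Z,C], [C,Z,E,B,C,B], [B,Z,B,C,G,C], [E,C,Z,A,B,D], [B,A,B,G,Z,H], [B,A,B,G,Z,C],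
    [C,H,A,D,E,Z], [A,Z,F,B,C,C], [C,B,D,Z,E,B], [C,B,A,D,E,Z], [F,A,C,Z,D,A], [H,D,A,Z,B,H],
    [H,Z,B,C,A,A], [H,F,A,D,B,Z], [Z,E,D,A,F,D], [H,H,A,Z,B,A], [H,Z,A,D,B,A], [C,E,Z,D,E,A],
    [C,E,D,A,Z,F], [C,E,D,A,Z,D], [C,D,Z,D,E,A], [A,G,D,B,C,Z], [A,B,B,Z,G,C], [D,C,Z,A,B,H],
    [H,C,Z,A,B,C], [Z,F,F,D,C,C], [Z,G,D,B,D,F], [B,F,Z,D,G,C], [B,F,Z,D,B,C], [C,D,E,Z,C,B],
    [A,D,G,F,Z,D], [A,D,Z,F,C,D], [Z,A,D,B,D,F], [B,Z,B,D,G,G], [E,Z,C,A,D,E], [B,Z,B,D,G,A],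
    [D,Z,B,D,E,G], [Z,A,C,A,D,E], [D,D,B,D,E,Z], [G,A,C,B,B,H]]"

definition outer_steps_2 :: "digit list list" where
  "outer_steps_2 = [
    [G,E,C,B,B,C], [B,Z,G,B,B,G], [B,C,Z,B,B,G], [C,F,A,D,B,Z], [Z,G,D,B,C,B], [Z,D,G,H,A,B],
    [Z,D,G,D,B,E], [D,D,Z,H,E,B], [D,D,Z,D,B,E], [C,H,Z,E,D,A], [C,Z,D,F,C,B], [D,D,A,H,Z,B],
    [C,A,Z,E,D,A], [C,H,A,H,Z,A], [C,E,D,H,Z,A], [C,Z,E,H,B,A], [B,Z,G,G,B,D], [C,Z,D,H,B,A],
    [B,A,Z,G,B,D], [A,D,G,Z,B,H], [A,D,G,Z,B,A], [E,C,C,B,F,Z], [B,C,C,B,F,Z], [D,E,Z,A,H,B],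
    [A,Z,B,E,C,D], [C,A,Z,D,E,B], [D,Z,A,A,H,B], [E,G,C,B,D,Z], [Z,B,A,C,C,G], [E,Z,C,B,D,B],
    [B,Z,B,B,G,D], [A,F,Z,D,G,C], [F,F,A,D,Z,C], [A,F,C,D,Z,C], [F,Z,F,C,C,D], [F,Z,A,D,C,G],
    [F,Z,A,D,C,A], [Z,B,F,C,C,D], [A,F,F,C,Z,C], [D,A,Z,A,H,A], [G,B,D,A,Z,H], [D,F,D,A,Z,H],
    [A,F,C,C,Z,C], [D,A,D,A,Z,H], [Z,B,B,D,A,G], [B,Z,G,B,B,D], [A,B,F,Z,C,D], [A,C,D,H,B,Z],
    [A,Z,G,C,B,D], [A,Z,C,B,F,C], [E,G,D,A,C,B], [C,Z,D,A,C,F], [G,A,C,B,Z,B], [C,D,B,F,A,Z],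
    [B,G,C,B,D,Z], [Z,D,G,B,B,H], [Z,D,G,F,A,D], [Z,D,B,F,A,D], [D,E,D,Z,E,B], [H,C,Z,F,A,C],
    [D,E,D,A,Z,B], [E,C,C,F,A,Z], [E,C,C,F,Z,C], [Z,C,C,F,A,C], [C,D,Z,F,B,H], [C,D,A,Z,B,H],
    [C,A,G,B,A,H], [C,A,G,B,A,C], [A,D,Z,A,G,D], [C,H,B,Z,E,A], [C,H,B,A,Z,A], [D,C,Z,D,F,E],
    [H,C,A,D,Z,E], [D,D,A,E,D,A], [Z,F,A,D,A,C], [F,Z,A,C,D,G], [B,C,A,D,Z,E], [C,F,A,D,E,C],
    [G,F,A,D,B,C], [D,F,A,D,F,C], [D,F,A,D,A,C], [F,D,A,C,H,Z], [F,D,A,C,Z,A], [Z,E,D,B,E,D],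
    [A,Z,D,G,E,D], [A,Z,D,B,E,D], [Z,D,E,C,A,E], [B,F,C,D,F,C], [D,D,E,C,E,Z], [G,A,B,Z,C,H],
    [D,D,Z,C,E,A], [D,Z,E,B,H,B], [B,A,B,Z,C,H], [B,A,G,D,F,C], [D,E,D,Z,D,F], [D,Z,D,B,H,F],
    [F,A,B,D,Z,G], [D,A,B,D,Z,G], [F,F,C,C,B,C], [F,A,C,C,B,C]]"

definition outer_steps_3 :: "digit list list" where
  "outer_steps_3 = [
    [D,A,D,B,H,Z], [D,C,A,A,D,E], [E,B,D,H,C,B], [E,D,C,B,D,Z], [E,B,D,C,C,B], [A,C,D,E,D,B],
    [E,C,C,A,H,Z], [C,E,D,A,Z,A], [C,E,C,A,H,Z], [Z,G,C,A,H,B], [C,Z,C,A,H,B], [Z,B,A,G,D,G],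
    [Z,B,E,A,D,G], [B,C,E,F,D,C], [A,G,F,Z,D,C], [A,Z,D,G,B,D], [B,G,B,F,D,C], [A,G,Z,A,H,C],
    [F,Z,B,C,D,G], [Z,B,B,E,D,G], [Z,A,B,C,D,G], [A,G,Z,A,B,C], [Z,B,B,C,D,G], [C,B,D,Z,C,F],
    [C,B,Z,A,D,G], [C,H,A,A,Z,A], [C,E,C,A,B,Z], [F,A,Z,C,C,F], [F,A,B,C,C,Z], [G,A,H,A,C,Z],
    [G,A,B,A,C,Z], [H,D,Z,C,B,E], [H,H,A,C,B,Z], [H,B,A,C,B,Z], [F,A,F,Z,C,C], [C,A,F,Z,C,C],
    [G,B,Z,A,G,B], [G,B,D,A,Z,B], [G,A,H,B,C,Z], [F,D,B,C,G,Z], [D,B,H,E,Z,B], [F,D,B,C,D,Z],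
    [D,B,H,Z,A,B], [H,C,A,Z,A,E], [Z,A,H,B,C,B], [H,C,B,Z,A,E], [Z,C,E,D,A,E], [Z,C,B,D,E,E],
    [Z,C,B,D,C,E], [B,Z,A,F,G,D], [Z,A,H,E,C,A], [C,Z,F,E,C,A], [F,Z,A,C,G,D], [C,A,Z,E,C,A],
    [Z,B,A,C,G,D], [A,G,D,A,B,Z], [E,G,D,B,B,Z], [C,E,C,Z,E,A], [C,E,C,Z,D,A], [B,G,D,B,F,Z],
    [B,G,D,B,Z,B], [G,Z,C,A,F,C], [A,Z,C,A,F,C], [B,D,G,Z,B,E], [H,C,A,B,A,Z], [B,D,Z,C,B,E],
    [D,D,A,D,E,A], [D,A,D,H,F,A], [D,A,D,H,A,A], [E,C,C,F,Z,D], [E,G,C,A,Z,D], [E,Z,C,A,B,D],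
    [C,A,F,F,D,C], [C,A,F,A,D,C], [D,D,E,A,Z,B], [B,B,E,G,D,Z], [E,D,C,B,H,B], [E,C,C,B,H,B],
    [F,D,B,C,G,A], [F,H,B,C,D,A], [A,D,B,C,G,E], [A,H,B,C,D,E], [B,G,C,B,H,B], [B,D,C,B,H,F],
    [E,C,Z,F,A,D], [Z,B,G,G,D,B], [A,Z,F,C,D,C], [B,B,Z,G,D,B], [D,C,Z,F,A,D], [G,B,B,A,C,H],
    [F,C,A,D,C,E], [G,B,B,A,C,C], [Z,A,D,C,C,F], [A,C,Z,D,A,E], [F,D,A,D,C,E], [D,A,Z,D,E,B],
    [F,H,A,D,C,B], [H,Z,A,H,A,B], [F,C,A,D,G,B], [Z,C,E,H,A,B]]"

definition outer_steps_4 :: "digit list list" where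
  "outer_steps_4 = [
    [B,D,G,B,B,Z], [C,E,C,D,Z,B], [E,C,D,H,A,Z], [Z,C,D,H,A,B], [C,E,C,H,A,B], [C,E,D,D,E,B],
    [C,B,H,D,E,B], [C,B,C,H,E,B], [C,B,G,Z,D,B], [Z,A,C,A,F,D], [D,D,B,C,Z,E], [C,H,A,D,Z,B],
    [E,C,D,F,Z,D], [G,B,C,A,Z,F], [H,B,A,C,A,Z], [G,B,C,A,Z,C], [E,C,D,Z,A,D], [C,D,Z,H,A,B],
    [Z,A,H,C,C,A], [C,E,D,B,Z,D], [A,D,G,Z,A,H], [A,D,G,Z,A,A], [A,B,Z,G,D,G], [D,B,F,C,A,D],
    [A,B,Z,G,D,B], [B,A,Z,G,D,C], [A,Z,D,A,F,D], [B,B,D,H,G,B], [B,B,D,C,G,B], [D,A,D,C,F,E],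
    [D,A,D,C,A,E], [C,B,A,A,G,H], [B,C,Z,F,F,D], [D,F,A,C,Z,D], [B,C,Z,F,C,D], [D,B,F,C,A,C],
    [C,B,A,A,G,C], [D,C,E,H,Z,B], [D,C,E,B,Z,B], [D,A,B,G,A,G], [D,A,B,G,A,D], [H,H,B,A,D,A],
    [H,C,B,A,D,A], [A,B,G,Z,B,C], [D,E,D,B,Z,D], [D,E,D,A,B,H], [E,Z,D,B,B,D], [C,E,D,A,B,H],
    [G,B,D,A,B,H], [G,B,Z,A,D,B], [D,B,D,A,B,H], [E,D,C,A,H,Z], [E,D,C,A,Z,D], [D,E,B,E,D,C],
    [D,E,B,B,D,C], [C,D,E,Z,B,A], [B,C,H,H,B,A], [A,D,Z,C,A,E], [F,C,C,H,B,A], [A,C,H,H,B,A],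
    [A,C,C,H,B,A], [Z,A,C,B,D,F], [C,D,F,F,A,D], [G,D,A,F,A,D], [D,D,E,F,A,D], [D,D,B,F,A,D],
    [H,C,A,F,B,H], [H,C,A,F,B,C], [H,C,A,A,B,G], [H,C,A,A,B,D], [A,C,H,A,G,A], [E,D,C,C,A,E],
    [A,D,G,D,A,E], [A,C,H,A,D,A], [A,D,G,H,A,B], [F,H,A,C,Z,B], [B,D,G,F,Z,D], [E,D,G,C,A,B],
    [D,H,Z,C,E,B], [D,H,A,C,Z,B], [B,B,G,G,Z,D], [B,D,Z,F,C,D], [A,B,D,G,E,D], [A,B,H,G,B,D],
    [A,B,C,G,E,D], [B,B,A,G,Z,D], [A,B,C,G,B,D], [B,E,D,Z,F,D], [B,Z,D,B,F,D], [A,G,G,Z,A,C],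
    [A,Z,G,D,A,C], [Z,D,E,A,B,H], [F,A,Z,D,C,F], [C,Z,B,D,E,G], [F,A,Z,D,C,C], [A,D,Z,A,B,H],
    [C,D,B,D,E,Z], [Z,B,D,E,D,F], [H,C,B,Z,A,D], [F,A,G,C,D,A]]"

definition outer_steps_5 :: "digit list list" where
  "outer_steps_5 = [
    [F,A,G,C,D,B], [B,B,D,Z,D,F], [D,B,Z,E,D,F], [F,A,D,C,D,E], [G,A,Z,B,C,D], [F,A,D,C,D,B],
    [D,E,D,A,Z,A], [Z,F,A,C,B,C], [D,B,Z,E,D,C], [D,B,Z,C,E,B], [F,C,F,B,C,C], [F,C,A,B,C,C],
    [E,C,C,Z,A,A], [C,D,E,B,G,B], [C,Z,D,B,B,H], [H,C,A,Z,B,A], [A,F,B,C,Z,D], [C,D,E,F,D,B],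
    [C,D,E,A,H,B], [C,D,E,A,C,B], [A,C,B,E,G,D], [A,G,B,B,G,D], [A,D,B,E,G,D], [A,D,B,B,G,D],
    [B,B,A,G,C,G], [G,B,C,A,B,G], [D,E,D,A,D,F], [E,C,D,F,B,D], [D,B,D,E,D,F], [H,D,A,H,A,B],
    [F,D,C,C,B,E], [C,E,C,D,E,A], [H,C,B,B,A,H], [E,C,C,F,B,D], [H,D,A,D,B,E], [F,A,F,C,C,D],
    [B,A,D,G,C,F], [A,D,G,B,A,H], [E,C,C,F,B,C], [G,B,D,A,C,F], [D,F,A,C,F,C], [F,A,D,D,C,F],
    [A,B,G,H,A,C], [C,A,H,H,B,A], [C,A,H,F,C,B], [C,D,E,D,B,E], [E,C,C,F,A,D], [D,C,E,F,D,B],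
    [G,A,D,B,B,H], [E,C,D,B,A,H], [D,D,E,E,D,B], [C,H,A,H,A,B], [B,B,C,G,D,F], [B,B,E,G,C,D],
    [G,A,B,B,C,H], [F,D,A,C,C,E], [H,A,B,D,A,G], [C,H,B,D,E,A], [B,B,B,G,G,G], [B,B,B,D,G,G],
    [D,H,A,C,E,A], [B,E,D,C,F,D], [F,A,B,D,C,G], [F,B,D,C,D,F], [F,H,A,C,D,A], [B,A,H,G,C,A],
    [G,A,F,A,C,D], [G,A,F,A,C,C], [B,C,B,F,G,D], [C,E,C,A,F,D], [D,E,D,D,E,B], [C,H,A,E,D,A],
    [B,A,B,G,D,G], [B,G,D,B,C,F], [F,A,H,D,C,A], [C,B,B,E,D,G], [D,C,E,D,A,E], [B,D,G,D,B,E],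
    [D,D,E,A,B,H], [C,E,D,B,A,H], [H,H,A,C,B,A], [B,C,D,F,F,D], [A,B,B,G,D,G], [C,E,D,H,A,A],
    [B,D,B,D,G,E], [D,E,D,B,B,H], [C,E,D,E,C,A], [E,C,C,A,B,H], [A,G,F,B,D,C], [D,C,E,H,A,B],
    [H,D,B,C,A,E], [E,D,C,A,H,A], [B,B,G,G,B,D], [D,H,B,D,E,A], [G,D,A,B,B,H], [D,F,D,C,E,B],
    [B,B,B,G,G,D], [C,E,C,B,D,F], [E,C,C,D,A,E], [B,C,C,F,F,D]]"

definition outer_steps_6 :: "digit list list" where
  "outer_steps_6 = [
    [C,E,C,A,H,A], [B,A,C,G,F,D], [B,D,G,F,B,D], [C,D,E,A,B,H], [F,H,A,C,C,B], [D,E,D,E,D,A],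
    [B,G,D,B,D,F], [C,E,D,E,D,F], [C,E,D,E,D,A], [A,F,G,D,B,C], [A,D,G,D,B,E], [G,A,H,A,C,B],
    [E,C,D,A,F,D], [D,D,E,B,B,H], [C,B,D,E,D,F], [A,D,G,B,B,H], [B,D,A,F,G,D], [A,F,B,D,G,C],
    [D,C,B,D,E,E], [D,D,E,B,H,B], [H,C,A,D,B,E], [F,A,F,C,C,C], [A,D,G,C,B,E], [C,B,A,E,D,G],
    [E,C,C,A,H,A], [C,H,A,H,A,A], [B,D,B,F,G,D], [A,G,C,A,H,B], [A,G,D,B,G,B], [B,B,E,G,D,C],
    [C,E,D,B,D,F], [H,C,A,F,A,C], [A,F,F,C,C,D], [A,B,D,G,D,F], [B,B,D,G,F,D], [C,E,C,H,B,A],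
    [A,C,F,F,C,C], [C,B,B,D,E,G], [D,B,B,D,E,G], [D,B,H,D,E,B], [A,G,G,B,A,C], [E,C,C,A,F,C],
    [C,H,B,E,D,A], [D,B,B,E,D,G], [A,G,D,B,D,F], [A,F,G,C,A,C], [H,F,A,C,A,D], [H,C,B,F,A,C],
    [B,C,B,D,G,E], [A,H,B,D,G,A], [E,D,C,A,B,H], [A,B,C,G,D,F], [B,B,B,G,D,G], [H,H,A,C,A,B],
    [H,F,A,C,B,D], [A,F,G,C,B,C], [C,D,F,E,C,A], [A,C,B,D,G,E], [A,F,F,C,C,C], [G,A,C,A,H,B],
    [G,B,C,A,F,D], [G,B,C,A,D,F], [D,A,H,B,H,B], [C,H,A,E,C,A], [G,A,F,B,C,C], [B,C,C,F,F,C],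
    [A,C,H,H,A,B], [C,A,B,D,E,G], [A,G,B,A,H,C], [D,C,E,A,H,B], [H,F,A,C,A,C], [E,D,C,A,H,B],
    [A,G,F,A,C,C], [G,A,C,A,F,C], [F,H,A,C,D,B], [F,B,A,D,C,G], [E,C,D,H,A,A], [E,C,C,H,A,B],
    [D,A,H,C,E,B], [D,B,A,E,D,G], [D,E,D,B,A,H], [H,C,A,F,A,D], [B,C,A,F,G,D]]"

section \<open>Running the certificate\<close>

definition core_steps :: "digit list list list" where
  "core_steps =
     [core_steps_1, core_steps_2, core_steps_3, core_steps_4, core_steps_5, core_steps_6,
     core_steps_7, core_steps_8, core_steps_9]"

definition outer_steps :: "digit list list list" where
  "outer_steps =
     [outer_steps_1, outer_steps_2, outer_steps_3, outer_steps_4, outer_steps_5,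
     outer_steps_6]"

text \<open>A word without obligatory letters gives an interval that begins at the empty simplex. It
  is put in by \<open>add\<close> directly, because the soundness of \<open>expand\<close>
  presupposes the empty simplex.\<close>

definition base_trie :: complex_trie where
  "base_trie = add [Z,Z,Z,Z,Z,E] Empty"

definition attachable :: "digit list \<Rightarrow> complex_trie \<Rightarrow> bool" where
  "attachable f t \<longleftrightarrow> list_all letter f \<and> list_all2 (\<lambda>_ _. True) edges f \<and> \<not> mem f t \<and> faces_mem f t"

text \<open>The closing equation shows that core, facets and outer steps exhaust the complex: the
  trie grown from one vertex equals the trie computed from the forbidden sets alone.\<close>

lemma certificate:
  "case expands edges core_steps base_trie of None \<Rightarrow> False | Some t \<Rightarrow>
     list_all (\<lambda>f. attachable f t) facets \<and>
     (case expands edges outer_steps (fold add facets t) of None \<Rightarrow> False | Some t' \<Rightarrow> t' = morse_trie)"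
  by code_simp

lemma distinct_facets: "distinct facets"
  by code_simp

text \<open>These are numbers of vertices: 4 and 5 correspond to spheres of dimension 3 and
  4.\<close>

lemma facet_dimensions: "map (\<lambda>f. length (filter (\<lambda>x. x \<noteq> Z) f)) facets = replicate 21 4 @ replicate 24 5"
  by code_simp

lemma complex_of_base_trie: "complex_of edges base_trie = {{}, {(E23, A)}}"
proof -
  let ?w = "[Z,Z,Z,Z,Z,E]"
  have len: "length ?w = length edges" by (simp add: edges_def)
  have "complex_of edges Empty = {}"
    by (simp add: complex_of_def)
  then have "complex_of edges base_trie =
      {simplex_of edges (map lower ?w)..simplex_of edges (map upper ?w)}"
    unfolding base_trie_def by (subst complex_of_add[OF distinct_edges well_shaped_Empty len]) simp
  also have "map lower ?w = word_of []"
    by (simp add: word_of_def edges_def)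
  also have "map upper ?w = word_of [(E23, A)]"
    by (simp add: word_of_def edges_def)
  also have "simplex_of edges (word_of []) = {}"
    by (simp add: simplex_of_word_of)
  also have "simplex_of edges (word_of [(E23, A)]) = {(E23, A)}"
    by (simp add: simplex_of_word_of hasse_codes_iff)
  finally show ?thesis by auto
qed

lemma base_trie:
  "admissible edges base_trie" "AR (body (complex_of edges base_trie))"
proof -
  have "well_shaped (length edges) base_trie"
    using well_shaped_add[of "[Z,Z,Z,Z,Z,E]" Empty] by (simp add: base_trie_def edges_def)
  then show "admissible edges base_trie"
    by (auto simp: admissible_def complex_of_base_trie down_closed_def)
  show "AR (body (complex_of edges base_trie))"
    by (simp add: complex_of_base_trie body_def AR_face)
qed

theorem mainTheorem11:
  shows "geometric_realization (morse_complex boundary_tetrahedron)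
           homotopy_equivalent_space
         wedge_spheres (\<lambda>i. if i < 21 then 3 else 4) {..<45}"
proof -
  let ?d = "\<lambda>i::nat. if i < 21 then 3 else 4 :: nat"
  obtain t where t: "expands edges core_steps base_trie = Some t"
    and facets: "list_all (\<lambda>f. attachable f t) facets"
    and outer: "expands edges outer_steps (fold add facets t) = Some morse_trie"
    using certificate by (auto split: option.splits)
  have core: "admissible edges t" "AR (body (complex_of edges t))"
    using expands_sound[OF distinct_edges base_trie(1) t] base_trie(2) by (auto simp: grows_to_def)
  have len: "length facets = 45"
    using arg_cong[OF facet_dimensions, of length] by simp
  have dims: "length (filter (\<lambda>x. x \<noteq> Z) (facets ! i)) = Suc (?d i)" if "i < length facets" for i
    using arg_cong[OF facet_dimensions, of "\<lambda>l. l ! i"] that by (simp add: nth_append len)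
  have att: "f \<in> words edges \<and> \<not> mem f t \<and> faces_mem f t" if "f \<in> set facets" for f
    using facets that by (auto simp: list_all_iff attachable_def words_def list_all2_conv_all_nth)
  have "facets \<noteq> []" using len by auto
  note wedge = attach_facets[OF distinct_edges core att distinct_facets this dims]
  \<comment> \<open>That the complex of \<open>morse_trie\<close> is down closed, as the passage to
    the realization requires, is inherited through the expansions instead of being derived from the
    forbidden sets.\<close>
  have "admissible edges morse_trie" and
    grow: "grows_to (complex_of edges (fold add facets t)) (complex_of edges morse_trie)"
    using expands_sound[OF distinct_edges wedge(1) outer] by auto
  then have "geometric_realization (morse_complex boundary_tetrahedron) homotopy_equivalent_space
      top_of_set (body (complex_of edges morse_trie))"
    by (intro homeomorphic_imp_homotopy_equivalent_space geometric_realization_morse_complex)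
      (simp add: admissible_def)
  also have "top_of_set (body (complex_of edges morse_trie)) homotopy_equivalent_space
      top_of_set (body (complex_of edges (fold add facets t)))"
    using grow by (simp add: grows_to_def)
  also have "top_of_set (body (complex_of edges (fold add facets t))) homotopy_equivalent_space
      wedge_spheres ?d {..<45}"
    using wedge(2) by (simp only: len)
  finally show ?thesis .
qed

end
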